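(* Let $(A,1,\Delta,\varepsilon)$ be a weak bialgebra, let $E:=A\rightharpoonup\varepsilon\subset\hat A$ be the cyclic left $A$-module generated by $\varepsilon$, and for every finite dimensional unital left $A$-module $V$ let $L_V:V\to E\times V$ and $R_V:V\to V\times E$ be the $K$-linear maps $$L_V(v)=(1_{(1)}\rightharpoonup\varepsilon)\otimes 1_{(2)}\cdot v,\qquad R_V(v)=1_{(1)}\cdot v\otimes(1_{(2)}\rightharpoonup\varepsilon).$$ Then: (i) $L_V$ is $A$-linear for all $V$ in $\mathrm{Rep}\,A$ if and only if $A$ is left-monoidal. (ii) $R_V$ is $A$-linear for all $V$ in $\mathrm{Rep}\,A$ if and only if $A$ is right-monoidal. (iii) If $A$ is monoidal, then $L_V$ and $R_V$ are bijective for all $V$ in $\mathrm{Rep}\,A$, and for all $V,W$ in $\mathrm{Rep}\,A$ $$R_V\times 1_W=1_V\times L_W,\qquad L_V\times 1_W=L_{V\times W},\qquad 1_W\times R_V=R_{W\times V},\qquad R_E=L_E .$$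
   Context: $K$ is a field and all spaces are finite dimensional over $K$. A weak bialgebra $(A,1,\Delta,\varepsilon)$ is a unital associative $K$-algebra $(A,1)$ which is also a coassociative coalgebra with coproduct $\Delta:A\to A\otimes A$ and counit $\varepsilon:A\to K$, such that $\Delta(ab)=\Delta(a)\Delta(b)$ for all $a,b\in A$. One requires neither $\Delta(1)=1\otimes1$ nor multiplicativity of $\varepsilon$. Sweedler notation $\Delta(a)=a_{(1)}\otimes a_{(2)}$ (summation suppressed) is used, in particular $\Delta(1)=1_{(1)}\otimes1_{(2)}$. $A$ is left-monoidal if $\varepsilon(abc)=\varepsilon(ab_{(1)})\varepsilon(b_{(2)}c)$ for all $a,b,c\in A$; right-monoidal if $\varepsilon(abc)=\varepsilon(ab_{(2)})\varepsilon(b_{(1)}c)$ for all $a,b,c\in A$; monoidal if both. $\hat A=\mathrm{Hom}_K(A,K)$ carries the left $A$-action $(a\rightharpoonup\phi)(b)=\phi(ba)$. $\mathrm{Rep}\,A$ is the category of finite dimensional unital left $A$-modules. For $V,W$ in $\mathrm{Rep}\,A$, $V\times W:=\Delta(1)(V\otimes W)\subset V\otimes W$ with $A$ acting through $\Delta$; this product is strictly associative. For $f:V\to V'$ and $g:W\to W'$ in $\mathrm{Rep}\,A$, $f\times g:V\times W\to V'\times W'$ is the restriction of $f\otimes g$ to $V\times W$. $1_V$ denotes the identity map of $V$. *)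

theory Defs
  imports "Jordan_Normal_Form.Missing_VectorSpace"
begin

section \<open>Tensor products of vector spaces\<close>

text \<open>
  The libraries have no tensor product of \<open>vectorspace\<close>s. A list \<open>[(v1,w1),...,(vn,wn)]\<close> stands
  for the formal sum \<open>v1 \<otimes> w1 + ... + vn \<otimes> wn\<close>; the tensor product is the set of formal sums
  modulo the congruence generated by commutativity of addition and the bilinearity relations.
  The universal property is proved at the end of this section.
\<close>

inductive tens_eq ::
  "('k, 'm) ring_scheme \<Rightarrow> ('k, 'v, 'x) module_scheme \<Rightarrow> ('k, 'w, 'y) module_scheme \<Rightarrow>
    ('v \<times> 'w) list \<Rightarrow> ('v \<times> 'w) list \<Rightarrow> bool"
  for K V W
where
  refl: "set x \<subseteq> carrier V \<times> carrier W \<Longrightarrow> tens_eq K V W x x"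
| sym: "tens_eq K V W x y \<Longrightarrow> tens_eq K V W y x"
| trans: "tens_eq K V W x y \<Longrightarrow> tens_eq K V W y z \<Longrightarrow> tens_eq K V W x z"
| append: "tens_eq K V W x x' \<Longrightarrow> tens_eq K V W y y' \<Longrightarrow> tens_eq K V W (x @ y) (x' @ y')"
| comm: "set x \<subseteq> carrier V \<times> carrier W \<Longrightarrow> set y \<subseteq> carrier V \<times> carrier W \<Longrightarrow>
    tens_eq K V W (x @ y) (y @ x)"
| zero: "w \<in> carrier W \<Longrightarrow> tens_eq K V W [(\<zero>\<^bsub>V\<^esub>, w)] []"
| add_left: "v \<in> carrier V \<Longrightarrow> v' \<in> carrier V \<Longrightarrow> w \<in> carrier W \<Longrightarrow>
    tens_eq K V W [(v \<oplus>\<^bsub>V\<^esub> v', w)] [(v, w), (v', w)]"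
| add_right: "v \<in> carrier V \<Longrightarrow> w \<in> carrier W \<Longrightarrow> w' \<in> carrier W \<Longrightarrow>
    tens_eq K V W [(v, w \<oplus>\<^bsub>W\<^esub> w')] [(v, w), (v, w')]"
| balanced: "c \<in> carrier K \<Longrightarrow> v \<in> carrier V \<Longrightarrow> w \<in> carrier W \<Longrightarrow>
    tens_eq K V W [(c \<odot>\<^bsub>V\<^esub> v, w)] [(v, c \<odot>\<^bsub>W\<^esub> w)]"

definition tens_class ::
  "('k, 'm) ring_scheme \<Rightarrow> ('k, 'v, 'x) module_scheme \<Rightarrow> ('k, 'w, 'y) module_scheme \<Rightarrow>
    ('v \<times> 'w) list \<Rightarrow> ('v \<times> 'w) list set" where
  "tens_class K V W x = {y. tens_eq K V W x y}"

text \<open>The fields \<open>mult\<close> and \<open>one\<close> of a \<open>module\<close> record play no role for vector spaces.\<close>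

definition tensor ::
  "('k, 'm) ring_scheme \<Rightarrow> ('k, 'v, 'x) module_scheme \<Rightarrow> ('k, 'w, 'y) module_scheme \<Rightarrow>
    ('k, ('v \<times> 'w) list set) module" where
  "tensor K V W =
    \<lparr>carrier = tens_class K V W ` {x. set x \<subseteq> carrier V \<times> carrier W},
     mult = undefined, one = undefined,
     zero = tens_class K V W [],
     add = (\<lambda>s t. {z. \<exists>x\<in>s. \<exists>y\<in>t. tens_eq K V W (x @ y) z}),
     smult = (\<lambda>c t. {z. \<exists>x\<in>t. tens_eq K V W (map (\<lambda>(v, w). (c \<odot>\<^bsub>V\<^esub> v, w)) x) z})\<rparr>"

definition tens ::
  "('k, 'm) ring_scheme \<Rightarrow> ('k, 'v, 'x) module_scheme \<Rightarrow> ('k, 'w, 'y) module_scheme \<Rightarrow>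
    'v \<Rightarrow> 'w \<Rightarrow> ('v \<times> 'w) list set" where
  "tens K V W v w = tens_class K V W [(v, w)]"

definition formal_sum ::
  "('u, 'm) ring_scheme \<Rightarrow> ('v \<Rightarrow> 'w \<Rightarrow> 'u) \<Rightarrow> ('v \<times> 'w) list \<Rightarrow> 'u" where
  "formal_sum U \<beta> x = foldr (\<lambda>(v, w) u. \<beta> v w \<oplus>\<^bsub>U\<^esub> u) x \<zero>\<^bsub>U\<^esub>"

text \<open>
  The linear map \<open>V \<otimes> W \<rightarrow> U\<close> induced by a bilinear map \<open>\<beta>\<close>; for bilinear \<open>\<beta>\<close> the choice of the
  representative is irrelevant. In Sweedler notation,
  \<open>tens_lift U \<beta> (\<Delta>(a))\<close> is \<open>\<beta>(a1, a2)\<close> for \<open>\<Delta>(a) = a1 \<otimes> a2\<close>.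
\<close>

definition tens_lift ::
  "('u, 'm) ring_scheme \<Rightarrow> ('v \<Rightarrow> 'w \<Rightarrow> 'u) \<Rightarrow> ('v \<times> 'w) list set \<Rightarrow> 'u" where
  "tens_lift U \<beta> t = formal_sum U \<beta> (SOME x. x \<in> t)"

definition bilinear_map ::
  "('k, 'm) ring_scheme \<Rightarrow> ('k, 'v, 'x) module_scheme \<Rightarrow> ('k, 'w, 'y) module_scheme \<Rightarrow>
    ('k, 'u, 'z) module_scheme \<Rightarrow> ('v \<Rightarrow> 'w \<Rightarrow> 'u) \<Rightarrow> bool" where
  "bilinear_map K V W U \<beta> \<longleftrightarrow>
    (\<forall>v\<in>carrier V. \<beta> v \<in> module_hom K W U) \<and>
    (\<forall>w\<in>carrier W. (\<lambda>v. \<beta> v w) \<in> module_hom K V U)"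

text \<open>\<open>f \<otimes> g\<close>, where \<open>V'\<close> and \<open>W'\<close> are the target spaces of \<open>f\<close> and \<open>g\<close>.\<close>

definition tens_map ::
  "('k, 'm) ring_scheme \<Rightarrow> ('k, 'v2, 'x) module_scheme \<Rightarrow> ('k, 'w2, 'y) module_scheme \<Rightarrow>
    ('v \<Rightarrow> 'v2) \<Rightarrow> ('w \<Rightarrow> 'w2) \<Rightarrow> ('v \<times> 'w) list set \<Rightarrow> ('v2 \<times> 'w2) list set" where
  "tens_map K V' W' f g = tens_lift (tensor K V' W') (\<lambda>v w. tens K V' W' (f v) (g w))"

text \<open>\<open>(a \<otimes> b) \<cdot> (v \<otimes> w) = f a v \<otimes> g b w\<close>, extended bilinearly.\<close>

definition tens_act ::
  "('k, 'm) ring_scheme \<Rightarrow> ('k, 'v, 'x) module_scheme \<Rightarrow> ('k, 'w, 'y) module_scheme \<Rightarrow>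
    ('a \<Rightarrow> 'v \<Rightarrow> 'v) \<Rightarrow> ('b \<Rightarrow> 'w \<Rightarrow> 'w) \<Rightarrow>
    ('a \<times> 'b) list set \<Rightarrow> ('v \<times> 'w) list set \<Rightarrow> ('v \<times> 'w) list set" where
  "tens_act K V W f g s t =
    tens_lift (tensor K V W) (\<lambda>a b. tens_map K V W (f a) (g b) t) s"

text \<open>
  Triple products are compared inside \<open>V \<otimes> (W \<otimes> X)\<close>: for subspaces \<open>P \<subseteq> V \<otimes> W\<close> and
  \<open>Q \<subseteq> W \<otimes> X\<close>, \<open>flat_left\<close> is the map \<open>P \<otimes> X \<rightarrow> V \<otimes> (W \<otimes> X)\<close> induced by the
  inclusion and the canonical isomorphism \<open>(V \<otimes> W) \<otimes> X \<cong> V \<otimes> (W \<otimes> X)\<close>, and \<open>flat_right\<close>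
  is the map \<open>V \<otimes> Q \<rightarrow> V \<otimes> (W \<otimes> X)\<close> induced by the inclusion. Both are injective over
  a field. For \<open>P = V \<otimes> W\<close>, \<open>flat_left\<close> is the associator.
\<close>

definition flat_left ::
  "('k, 'm) ring_scheme \<Rightarrow> ('k, 'v, 'x) module_scheme \<Rightarrow> ('k, 'w, 'y) module_scheme \<Rightarrow>
    ('k, 'u, 'z) module_scheme \<Rightarrow>
    (('v \<times> 'w) list set \<times> 'u) list set \<Rightarrow> ('v \<times> ('w \<times> 'u) list set) list set" where
  "flat_left K V W X =
    (let T = tensor K V (tensor K W X) in
      tens_lift T (\<lambda>p x. tens_lift T (\<lambda>v w. tens K V (tensor K W X) v (tens K W X w x)) p))"

definition flat_right ::
  "('k, 'm) ring_scheme \<Rightarrow> ('k, 'v, 'x) module_scheme \<Rightarrow> ('k, 'w, 'y) module_scheme \<Rightarrow>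
    ('k, 'u, 'z) module_scheme \<Rightarrow>
    ('v \<times> ('w \<times> 'u) list set) list set \<Rightarrow> ('v \<times> ('w \<times> 'u) list set) list set" where
  "flat_right K V W X = tens_map K V (tensor K W X) id id"

text \<open>The tensor product is a vector space with the expected universal property.\<close>

locale tensor_pair =
  V: vectorspace K V + W: vectorspace K W
  for K :: "('k, 'm) ring_scheme"
    and V :: "('k, 'v, 'x) module_scheme" and W :: "('k, 'w, 'y) module_scheme"
begin

abbreviation wf_sum :: "('v \<times> 'w) list \<Rightarrow> bool" where
  "wf_sum x \<equiv> set x \<subseteq> carrier V \<times> carrier W"

lemma tens_eq_wf: "tens_eq K V W x y \<Longrightarrow> wf_sum x \<and> wf_sum y"
  by (induction rule: tens_eq.induct) auto

lemma tens_class_eq_iff: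
  assumes "wf_sum x"
  shows "tens_class K V W x = tens_class K V W y \<longleftrightarrow> tens_eq K V W x y"
proof
  assume "tens_class K V W x = tens_class K V W y"
  moreover have "x \<in> tens_class K V W x" using assms by (simp add: tens_class_def tens_eq.refl)
  ultimately show "tens_eq K V W x y" by (simp add: tens_class_def tens_eq.sym)
next
  assume xy: "tens_eq K V W x y"
  have "tens_eq K V W x z \<longleftrightarrow> tens_eq K V W y z" for z
    using tens_eq.trans[OF xy] tens_eq.trans[OF tens_eq.sym[OF xy]] by blast
  then show "tens_class K V W x = tens_class K V W y" by (simp add: tens_class_def)
qed

lemma tens_eq_smult:
  assumes "c \<in> carrier K" "tens_eq K V W x y"
  shows "tens_eq K V W (map (\<lambda>(v, w). (c \<odot>\<^bsub>V\<^esub> v, w)) x) (map (\<lambda>(v, w). (c \<odot>\<^bsub>V\<^esub> v, w)) y)"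
  using assms(2)
proof (induction rule: tens_eq.induct)
  case (refl x)
  then show ?case using assms(1) by (intro tens_eq.refl) auto
next
  case (sym x y)
  from sym.IH show ?case by (rule tens_eq.sym)
next
  case (trans x y z)
  then show ?case by (blast intro: tens_eq.trans)
next
  case (append x x' y y')
  then show ?case by (simp add: tens_eq.append)
next
  case (comm x y)
  then show ?case using assms(1) unfolding map_append by (intro tens_eq.comm) auto
next
  case (zero w)
  have "c \<odot>\<^bsub>V\<^esub> \<zero>\<^bsub>V\<^esub> = \<zero>\<^bsub>V\<^esub>" using assms(1) by simp
  then show ?case using zero by (simp add: tens_eq.zero)
next
  case (add_left v v' w)
  then show ?case using assms(1) by (simp add: V.smult_r_distr tens_eq.add_left)
next
  case (add_right v w w')
  then show ?case using assms(1) by (simp add: tens_eq.add_right)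
next
  case (balanced d v w)
  then have "c \<odot>\<^bsub>V\<^esub> (d \<odot>\<^bsub>V\<^esub> v) = d \<odot>\<^bsub>V\<^esub> (c \<odot>\<^bsub>V\<^esub> v)"
    using assms(1) V.smult_assoc1[of c d v] V.smult_assoc1[of d c v] V.R.m_comm[of c d] by simp
  then show ?case using balanced assms(1) by (simp add: tens_eq.balanced)
qed

lemma wf_sum_smult:
  "c \<in> carrier K \<Longrightarrow> wf_sum x \<Longrightarrow> wf_sum (map (\<lambda>(v, w). (c \<odot>\<^bsub>V\<^esub> v, w)) x)"
  by auto

lemma tensor_carrier:
  "carrier (tensor K V W) = tens_class K V W ` {x. wf_sum x}"
  by (simp add: tensor_def)

lemma tensor_zero: "\<zero>\<^bsub>tensor K V W\<^esub> = tens_class K V W []"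
  by (simp add: tensor_def)

lemma tensor_add:
  assumes "wf_sum x" "wf_sum y"
  shows "tens_class K V W x \<oplus>\<^bsub>tensor K V W\<^esub> tens_class K V W y = tens_class K V W (x @ y)"
proof -
  have "(\<exists>x'. tens_eq K V W x x' \<and> (\<exists>y'. tens_eq K V W y y' \<and> tens_eq K V W (x' @ y') z)) \<longleftrightarrow>
      tens_eq K V W (x @ y) z" for z
  proof
    assume "\<exists>x'. tens_eq K V W x x' \<and> (\<exists>y'. tens_eq K V W y y' \<and> tens_eq K V W (x' @ y') z)"
    then show "tens_eq K V W (x @ y) z" using tens_eq.append tens_eq.trans by metis
  next
    assume "tens_eq K V W (x @ y) z"
    then show "\<exists>x'. tens_eq K V W x x' \<and> (\<exists>y'. tens_eq K V W y y' \<and> tens_eq K V W (x' @ y') z)"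
      using tens_eq.refl[OF assms(1)] tens_eq.refl[OF assms(2)] by blast
  qed
  then show ?thesis by (auto simp: tensor_def tens_class_def)
qed

lemma tensor_smult:
  assumes "c \<in> carrier K" "wf_sum x"
  shows "c \<odot>\<^bsub>tensor K V W\<^esub> tens_class K V W x =
    tens_class K V W (map (\<lambda>(v, w). (c \<odot>\<^bsub>V\<^esub> v, w)) x)"
proof -
  let ?f = "map (\<lambda>(v, w). (c \<odot>\<^bsub>V\<^esub> v, w))"
  have "(\<exists>x'. tens_eq K V W x x' \<and> tens_eq K V W (?f x') z) \<longleftrightarrow> tens_eq K V W (?f x) z" for z
    using tens_eq.refl[OF assms(2)] tens_eq.trans[OF tens_eq_smult[OF assms(1)]] by blast
  then show ?thesis by (simp add: tensor_def tens_class_def)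
qed

lemma tens_eq_smult_add:
  assumes "a \<in> carrier K" "b \<in> carrier K" "wf_sum x"
  shows "tens_eq K V W (map (\<lambda>(v, w). ((a \<oplus>\<^bsub>K\<^esub> b) \<odot>\<^bsub>V\<^esub> v, w)) x)
    (map (\<lambda>(v, w). (a \<odot>\<^bsub>V\<^esub> v, w)) x @ map (\<lambda>(v, w). (b \<odot>\<^bsub>V\<^esub> v, w)) x)"
  using assms(3)
proof (induction x)
  case Nil
  then show ?case by (simp add: tens_eq.refl)
next
  case (Cons p x)
  obtain v w where p: "p = (v, w)" and vw: "v \<in> carrier V" "w \<in> carrier W"
    using Cons.prems by (cases p) auto
  let ?f = "\<lambda>c. map (\<lambda>(v, w). (c \<odot>\<^bsub>V\<^esub> v, w))"
  have x: "wf_sum x" using Cons.prems by simp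
  have 1: "tens_eq K V W [((a \<oplus>\<^bsub>K\<^esub> b) \<odot>\<^bsub>V\<^esub> v, w)] [(a \<odot>\<^bsub>V\<^esub> v, w), (b \<odot>\<^bsub>V\<^esub> v, w)]"
    using vw assms(1,2) by (simp add: V.smult_l_distr tens_eq.add_left)
  have 2: "tens_eq K V W ([((a \<oplus>\<^bsub>K\<^esub> b) \<odot>\<^bsub>V\<^esub> v, w)] @ ?f (a \<oplus>\<^bsub>K\<^esub> b) x)
     ([(a \<odot>\<^bsub>V\<^esub> v, w), (b \<odot>\<^bsub>V\<^esub> v, w)] @ (?f a x @ ?f b x))"
    using tens_eq.append[OF 1 Cons.IH[OF x]] .
  have 3: "tens_eq K V W ([(b \<odot>\<^bsub>V\<^esub> v, w)] @ ?f a x) (?f a x @ [(b \<odot>\<^bsub>V\<^esub> v, w)])"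
    using vw assms wf_sum_smult[OF assms(1) x] by (intro tens_eq.comm) auto
  have 4: "tens_eq K V W [(a \<odot>\<^bsub>V\<^esub> v, w)] [(a \<odot>\<^bsub>V\<^esub> v, w)]" "tens_eq K V W (?f b x) (?f b x)"
    using vw assms(1) by (intro tens_eq.refl wf_sum_smult[OF assms(2) x]; simp)+
  have "tens_eq K V W ([(a \<odot>\<^bsub>V\<^esub> v, w)] @ (([(b \<odot>\<^bsub>V\<^esub> v, w)] @ ?f a x) @ ?f b x))
     ([(a \<odot>\<^bsub>V\<^esub> v, w)] @ ((?f a x @ [(b \<odot>\<^bsub>V\<^esub> v, w)]) @ ?f b x))"
    by (intro tens_eq.append 3 4)
  from tens_eq.trans[OF 2[simplified] this[simplified]] show ?case by (simp add: p)
qed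

lemma tens_eq_smult_zero:
  "wf_sum x \<Longrightarrow> tens_eq K V W (map (\<lambda>(v, w). (\<zero>\<^bsub>K\<^esub> \<odot>\<^bsub>V\<^esub> v, w)) x) []"
proof (induction x)
  case Nil
  then show ?case by (simp add: tens_eq.refl)
next
  case (Cons p x)
  obtain v w where p: "p = (v, w)" and vw: "v \<in> carrier V" "w \<in> carrier W"
    using Cons.prems by (cases p) auto
  have 1: "tens_eq K V W [(\<zero>\<^bsub>K\<^esub> \<odot>\<^bsub>V\<^esub> v, w)] []" using vw by (simp add: tens_eq.zero)
  from tens_eq.append[OF 1 Cons.IH] Cons.prems show ?case by (simp add: p)
qed

lemma map_smult_one: "wf_sum x \<Longrightarrow> map (\<lambda>(v, w). (\<one>\<^bsub>K\<^esub> \<odot>\<^bsub>V\<^esub> v, w)) x = x"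
  by (induction x) auto

lemma tensor_vectorspace: "vectorspace K (tensor K V W)"
proof -
  let ?T = "tensor K V W"
  let ?f = "\<lambda>c. map (\<lambda>(v, w). (c \<odot>\<^bsub>V\<^esub> v, w))"
  note [simp] = tensor_add tensor_smult tensor_zero tens_class_eq_iff
  have ag: "abelian_group ?T"
  proof (rule abelian_groupI)
    fix s t assume "s \<in> carrier ?T" "t \<in> carrier ?T"
    then obtain x y where st: "s = tens_class K V W x" "t = tens_class K V W y"
      "wf_sum x" "wf_sum y" by (auto simp: tensor_carrier)
    then have "wf_sum (x @ y)" by simp
    then show "s \<oplus>\<^bsub>?T\<^esub> t \<in> carrier ?T" unfolding st(1,2) tensor_add[OF st(3,4)] tensor_carrier by blast
    show "s \<oplus>\<^bsub>?T\<^esub> t = t \<oplus>\<^bsub>?T\<^esub> s" using st by (simp add: tens_eq.comm)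
    fix r assume "r \<in> carrier ?T"
    then obtain z where "r = tens_class K V W z" "wf_sum z" by (auto simp: tensor_carrier)
    then show "s \<oplus>\<^bsub>?T\<^esub> t \<oplus>\<^bsub>?T\<^esub> r = s \<oplus>\<^bsub>?T\<^esub> (t \<oplus>\<^bsub>?T\<^esub> r)" using st by (simp add: tens_eq.refl)
  next
    show "\<zero>\<^bsub>?T\<^esub> \<in> carrier ?T" by (auto simp: tensor_carrier)
  next
    fix s assume "s \<in> carrier ?T"
    then obtain x where s: "s = tens_class K V W x" "wf_sum x" by (auto simp: tensor_carrier)
    show "\<zero>\<^bsub>?T\<^esub> \<oplus>\<^bsub>?T\<^esub> s = s" using tensor_add[of "[]" x] s by simp
    let ?m = "\<ominus>\<^bsub>K\<^esub> \<one>\<^bsub>K\<^esub>"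
    have w: "wf_sum (?f ?m x)" using s(2) by (intro wf_sum_smult) auto
    have "tens_eq K V W (?f ?m x @ ?f \<one>\<^bsub>K\<^esub> x) []"
      using tens_eq.sym[OF tens_eq_smult_add[of ?m "\<one>\<^bsub>K\<^esub>" x]] tens_eq_smult_zero[OF s(2)] s(2)
      by (auto simp: V.R.l_neg intro: tens_eq.trans)
    then have "tens_eq K V W (?f ?m x @ x) []" using map_smult_one[OF s(2)] by simp
    then have "tens_class K V W (?f ?m x) \<oplus>\<^bsub>?T\<^esub> s = \<zero>\<^bsub>?T\<^esub>"
      using w s unfolding s(1) tensor_add[OF w s(2)] tensor_zero
      by (subst tens_class_eq_iff) auto
    moreover have "tens_class K V W (?f ?m x) \<in> carrier ?T"
      unfolding tensor_carrier using w by blast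
    ultimately show "\<exists>t\<in>carrier ?T. t \<oplus>\<^bsub>?T\<^esub> s = \<zero>\<^bsub>?T\<^esub>" by blast
  qed
  have rep: "\<exists>x. s = tens_class K V W x \<and> wf_sum x" if "s \<in> carrier ?T" for s
    using that by (auto simp: tensor_carrier)
  have smult_closed: "a \<odot>\<^bsub>?T\<^esub> s \<in> carrier ?T" if a: "a \<in> carrier K" and "s \<in> carrier ?T" for a s
  proof -
    from rep[OF that(2)] obtain x where s: "s = tens_class K V W x" "wf_sum x" by blast
    show ?thesis
      unfolding s(1) tensor_smult[OF a s(2)] tensor_carrier using wf_sum_smult[OF a s(2)] by blast
  qed
  have l_distr: "(a \<oplus>\<^bsub>K\<^esub> b) \<odot>\<^bsub>?T\<^esub> s = a \<odot>\<^bsub>?T\<^esub> s \<oplus>\<^bsub>?T\<^esub> b \<odot>\<^bsub>?T\<^esub> s"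
    if a: "a \<in> carrier K" and b: "b \<in> carrier K" and "s \<in> carrier ?T" for a b s
  proof -
    from rep[OF that(3)] obtain x where s: "s = tens_class K V W x" "wf_sum x" by blast
    show ?thesis
      unfolding s(1) tensor_smult[OF a s(2)] tensor_smult[OF b s(2)]
        tensor_smult[OF V.R.a_closed[OF a b] s(2)]
        tensor_add[OF wf_sum_smult[OF a s(2)] wf_sum_smult[OF b s(2)]]
        tens_class_eq_iff[OF wf_sum_smult[OF V.R.a_closed[OF a b] s(2)]]
      by (rule tens_eq_smult_add[OF a b s(2)])
  qed
  have assoc: "(a \<otimes>\<^bsub>K\<^esub> b) \<odot>\<^bsub>?T\<^esub> s = a \<odot>\<^bsub>?T\<^esub> (b \<odot>\<^bsub>?T\<^esub> s)"
    if a: "a \<in> carrier K" and b: "b \<in> carrier K" and "s \<in> carrier ?T" for a b s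
  proof -
    from rep[OF that(3)] obtain x where s: "s = tens_class K V W x" "wf_sum x" by blast
    have "?f (a \<otimes>\<^bsub>K\<^esub> b) x = ?f a (?f b x)"
      using s(2) a b by (auto simp: V.smult_assoc1)
    then show ?thesis
      unfolding s(1) tensor_smult[OF b s(2)] tensor_smult[OF a wf_sum_smult[OF b s(2)]]
        tensor_smult[OF V.R.m_closed[OF a b] s(2)] by (rule arg_cong)
  qed
  have r_distr: "a \<odot>\<^bsub>?T\<^esub> (s \<oplus>\<^bsub>?T\<^esub> t) = a \<odot>\<^bsub>?T\<^esub> s \<oplus>\<^bsub>?T\<^esub> a \<odot>\<^bsub>?T\<^esub> t"
    if a: "a \<in> carrier K" and "s \<in> carrier ?T" "t \<in> carrier ?T" for a s t
  proof -
    from rep[OF that(2)] obtain x where s: "s = tens_class K V W x" "wf_sum x" by blast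
    from rep[OF that(3)] obtain y where t: "t = tens_class K V W y" "wf_sum y" by blast
    have xy: "wf_sum (x @ y)" using s t by simp
    show ?thesis
      unfolding s(1) t(1) tensor_add[OF s(2) t(2)] tensor_smult[OF a xy]
        tensor_smult[OF a s(2)] tensor_smult[OF a t(2)]
        tensor_add[OF wf_sum_smult[OF a s(2)] wf_sum_smult[OF a t(2)]] map_append ..
  qed
  have one: "\<one>\<^bsub>K\<^esub> \<odot>\<^bsub>?T\<^esub> s = s" if "s \<in> carrier ?T" for s
  proof -
    from rep[OF that] obtain x where s: "s = tens_class K V W x" "wf_sum x" by blast
    show ?thesis
      unfolding s(1) tensor_smult[OF V.R.one_closed s(2)] map_smult_one[OF s(2)] ..
  qed
  have "module K ?T"
    by (rule moduleI[OF V.R.is_cring ag smult_closed l_distr r_distr assoc one])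
  then show ?thesis by (rule vectorspace.intro) (rule V.field_axioms)
qed

lemma tens_bilinear: "bilinear_map K V W (tensor K V W) (tens K V W)"
proof -
  let ?T = "tensor K V W"
  have closed: "tens K V W v w \<in> carrier ?T" if "v \<in> carrier V" "w \<in> carrier W" for v w
    unfolding tensor_carrier tens_def using that by (intro imageI) simp
  have al: "tens K V W (v \<oplus>\<^bsub>V\<^esub> v') w = tens K V W v w \<oplus>\<^bsub>?T\<^esub> tens K V W v' w"
    if "v \<in> carrier V" "v' \<in> carrier V" "w \<in> carrier W" for v v' w
    using tens_eq.add_left[OF that] that by (simp add: tens_def tensor_add tens_class_eq_iff)
  have ar: "tens K V W v (w \<oplus>\<^bsub>W\<^esub> w') = tens K V W v w \<oplus>\<^bsub>?T\<^esub> tens K V W v w'"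
    if "v \<in> carrier V" "w \<in> carrier W" "w' \<in> carrier W" for v w w'
    using tens_eq.add_right[OF that] that by (simp add: tens_def tensor_add tens_class_eq_iff)
  have sl: "tens K V W (c \<odot>\<^bsub>V\<^esub> v) w = c \<odot>\<^bsub>?T\<^esub> tens K V W v w"
    if "c \<in> carrier K" "v \<in> carrier V" "w \<in> carrier W" for c v w
    using that by (simp add: tens_def tensor_smult)
  have sr: "tens K V W v (c \<odot>\<^bsub>W\<^esub> w) = c \<odot>\<^bsub>?T\<^esub> tens K V W v w"
    if "c \<in> carrier K" "v \<in> carrier V" "w \<in> carrier W" for c v w
    using tens_eq.balanced[OF that] that sl[OF that]
    by (simp add: tens_def flip: tens_class_eq_iff)
  show ?thesis
    unfolding bilinear_map_def module_hom_def using closed al ar sl sr by simp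
qed

context
  fixes U :: "('k, 'u, 'z) module_scheme" and \<beta>
  assumes U: "vectorspace K U" and \<beta>: "bilinear_map K V W U \<beta>"
begin

interpretation U: vectorspace K U by (rule U)

lemma bilinear_closed: "v \<in> carrier V \<Longrightarrow> w \<in> carrier W \<Longrightarrow> \<beta> v w \<in> carrier U"
  using \<beta> by (auto simp: bilinear_map_def module_hom_def)

lemma bilinear_smult_left:
  "c \<in> carrier K \<Longrightarrow> v \<in> carrier V \<Longrightarrow> w \<in> carrier W \<Longrightarrow>
    \<beta> (c \<odot>\<^bsub>V\<^esub> v) w = c \<odot>\<^bsub>U\<^esub> \<beta> v w"
  using \<beta> by (auto simp: bilinear_map_def module_hom_def)

lemma formal_sum_closed: "wf_sum x \<Longrightarrow> formal_sum U \<beta> x \<in> carrier U"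
  by (induction x) (auto simp: formal_sum_def bilinear_closed)

lemma formal_sum_append:
  "wf_sum x \<Longrightarrow> wf_sum y \<Longrightarrow>
    formal_sum U \<beta> (x @ y) = formal_sum U \<beta> x \<oplus>\<^bsub>U\<^esub> formal_sum U \<beta> y"
proof (induction x)
  case Nil
  then show ?case using formal_sum_closed[of y] by (simp add: formal_sum_def)
next
  case (Cons p x)
  then show ?case
    using formal_sum_closed[of x] formal_sum_closed[of y] bilinear_closed
    by (cases p) (simp add: formal_sum_def U.a_assoc)
qed

lemma formal_sum_cong: "tens_eq K V W x y \<Longrightarrow> formal_sum U \<beta> x = formal_sum U \<beta> y"
proof (induction rule: tens_eq.induct)
  case (append x x' y y')
  then show ?case
    using tens_eq_wf[OF append.hyps(1)] tens_eq_wf[OF append.hyps(2)] by (simp add: formal_sum_append)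
next
  case (comm x y)
  show ?case
    unfolding formal_sum_append[OF comm] formal_sum_append[OF comm(2,1)]
    by (rule U.a_comm[OF comm[THEN formal_sum_closed]])
next
  case (zero w)
  have "\<beta> (\<zero>\<^bsub>K\<^esub> \<odot>\<^bsub>V\<^esub> \<zero>\<^bsub>V\<^esub>) w = \<zero>\<^bsub>K\<^esub> \<odot>\<^bsub>U\<^esub> \<beta> \<zero>\<^bsub>V\<^esub> w"
    using zero by (intro bilinear_smult_left) auto
  then show ?case using bilinear_closed[of "\<zero>\<^bsub>V\<^esub>" w] zero by (simp add: formal_sum_def)
next
  case (add_left v v' w)
  then have "\<beta> (v \<oplus>\<^bsub>V\<^esub> v') w = \<beta> v w \<oplus>\<^bsub>U\<^esub> \<beta> v' w"
    using \<beta> by (auto simp: bilinear_map_def module_hom_def)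
  then show ?case using add_left bilinear_closed by (simp add: formal_sum_def U.a_assoc)
next
  case (add_right v w w')
  then have "\<beta> v (w \<oplus>\<^bsub>W\<^esub> w') = \<beta> v w \<oplus>\<^bsub>U\<^esub> \<beta> v w'"
    using \<beta> by (auto simp: bilinear_map_def module_hom_def)
  then show ?case using add_right bilinear_closed by (simp add: formal_sum_def U.a_assoc)
next
  case (balanced c v w)
  then have "\<beta> (c \<odot>\<^bsub>V\<^esub> v) w = \<beta> v (c \<odot>\<^bsub>W\<^esub> w)"
    using \<beta> by (auto simp: bilinear_map_def module_hom_def)
  then show ?case by (simp add: formal_sum_def)
next
  case (refl x)
  show ?case ..
next
  case (sym x y)
  show ?case by (rule sym.IH[symmetric])
next
  case (trans x y z)
  show ?case by (rule HOL.trans[OF trans.IH])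
qed

lemma tens_lift_class:
  assumes "wf_sum x"
  shows "tens_lift U \<beta> (tens_class K V W x) = formal_sum U \<beta> x"
proof -
  have "x \<in> tens_class K V W x" using assms by (simp add: tens_class_def tens_eq.refl)
  then have "(SOME y. y \<in> tens_class K V W x) \<in> tens_class K V W x" by (rule someI)
  then have "tens_eq K V W x (SOME y. y \<in> tens_class K V W x)"
    by (simp only: tens_class_def mem_Collect_eq)
  then show ?thesis unfolding tens_lift_def by (rule formal_sum_cong[symmetric])
qed

lemma tens_lift_tens:
  assumes "v \<in> carrier V" "w \<in> carrier W"
  shows "tens_lift U \<beta> (tens K V W v w) = \<beta> v w"
proof -
  have "wf_sum [(v, w)]" using assms by simp
  then show ?thesis
    using bilinear_closed[OF assms] by (simp add: tens_def tens_lift_class formal_sum_def)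
qed

lemma formal_sum_smult:
  assumes "c \<in> carrier K"
  shows "wf_sum x \<Longrightarrow>
    formal_sum U \<beta> (map (\<lambda>(v, w). (c \<odot>\<^bsub>V\<^esub> v, w)) x) = c \<odot>\<^bsub>U\<^esub> formal_sum U \<beta> x"
proof (induction x)
  case Nil
  then show ?case using assms by (simp add: formal_sum_def)
next
  case (Cons p x)
  obtain v w where p: "p = (v, w)" and vw: "v \<in> carrier V" "w \<in> carrier W"
    using Cons.prems by (cases p) auto
  have "\<beta> (c \<odot>\<^bsub>V\<^esub> v) w = c \<odot>\<^bsub>U\<^esub> \<beta> v w"
    using \<beta> vw assms by (auto simp: bilinear_map_def module_hom_def)
  then show ?case
    using Cons formal_sum_closed[of x] assms bilinear_closed[OF vw]
    by (simp add: p formal_sum_def U.smult_r_distr)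
qed

lemma tens_lift_linear: "tens_lift U \<beta> \<in> module_hom K (tensor K V W) U"
proof -
  have "tens_lift U \<beta> (c \<odot>\<^bsub>tensor K V W\<^esub> tens_class K V W x) =
      c \<odot>\<^bsub>U\<^esub> tens_lift U \<beta> (tens_class K V W x)"
    if "c \<in> carrier K" "wf_sum x" for c x
    using that by (simp only: tensor_smult tens_lift_class wf_sum_smult formal_sum_smult)
  then show ?thesis
    unfolding module_hom_def tensor_carrier
    by (auto simp: tensor_add tens_lift_class formal_sum_closed formal_sum_append)
qed

lemma tens_lift_unique:
  assumes f: "f \<in> module_hom K (tensor K V W) U"
    and f_tens: "\<And>v w. v \<in> carrier V \<Longrightarrow> w \<in> carrier W \<Longrightarrow> f (tens K V W v w) = \<beta> v w"
    and t: "t \<in> carrier (tensor K V W)"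
  shows "f t = tens_lift U \<beta> t"
proof -
  interpret T: vectorspace K "tensor K V W" by (rule tensor_vectorspace)
  interpret f: mod_hom K "tensor K V W" U f
    by unfold_locales (rule f)
  have "f (tens_class K V W x) = formal_sum U \<beta> x" if "wf_sum x" for x
    using that
  proof (induction x)
    case Nil
    then show ?case using f.f0_is_0 by (simp add: tensor_zero formal_sum_def)
  next
    case (Cons p x)
    obtain v w where p: "p = (v, w)" and vw: "v \<in> carrier V" "w \<in> carrier W"
      using Cons.prems by (cases p) auto
    have x: "wf_sum x" using Cons.prems by simp
    have "tens_class K V W (p # x) = tens K V W v w \<oplus>\<^bsub>tensor K V W\<^esub> tens_class K V W x"
      using tensor_add[of "[(v, w)]" x] vw x by (simp add: p tens_def)
    moreover have "tens K V W v w \<in> carrier (tensor K V W)" "tens_class K V W x \<in> carrier (tensor K V W)"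
      using vw x by (auto simp: tens_def tensor_carrier)
    ultimately show ?case
      using Cons.IH[OF x] f_tens[OF vw] by (simp add: p formal_sum_def)
  qed
  with t show ?thesis by (auto simp: tensor_carrier tens_lift_class)
qed

end

end

section \<open>Weak bialgebras\<close>

definition ground_space :: "('k, 'm) ring_scheme \<Rightarrow> ('k, 'k) module" where
  "ground_space K =
    \<lparr>carrier = carrier K, mult = mult K, one = one K, zero = zero K, add = add K, smult = mult K\<rparr>"

record ('k, 'a) coalg = "('k, 'a) module" +
  comult :: "'a \<Rightarrow> ('a \<times> 'a) list set"
  counit :: "'a \<Rightarrow> 'k"

locale weak_bialgebra =
  vectorspace K A + alg: ring A
  for K :: "('k, 'm) ring_scheme" and A :: "('k, 'a, 'x) coalg_scheme" +
  assumes finite_dim: "fin_dim"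
    and smult_mult_left: "\<lbrakk>c \<in> carrier K; a \<in> carrier A; b \<in> carrier A\<rbrakk> \<Longrightarrow>
      (c \<odot>\<^bsub>A\<^esub> a) \<otimes>\<^bsub>A\<^esub> b = c \<odot>\<^bsub>A\<^esub> (a \<otimes>\<^bsub>A\<^esub> b)"
    and smult_mult_right: "\<lbrakk>c \<in> carrier K; a \<in> carrier A; b \<in> carrier A\<rbrakk> \<Longrightarrow>
      a \<otimes>\<^bsub>A\<^esub> (c \<odot>\<^bsub>A\<^esub> b) = c \<odot>\<^bsub>A\<^esub> (a \<otimes>\<^bsub>A\<^esub> b)"
    and comult_linear: "comult A \<in> module_hom K A (tensor K A A)"
    and counit_linear: "counit A \<in> module_hom K A (ground_space K)"
    and coassoc: "a \<in> carrier A \<Longrightarrow>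
      flat_left K A A A (tens_map K (tensor K A A) A (comult A) id (comult A a)) =
      tens_map K A (tensor K A A) id (comult A) (comult A a)"
    and counit_left: "a \<in> carrier A \<Longrightarrow>
      tens_lift A (\<lambda>x y. counit A x \<odot>\<^bsub>A\<^esub> y) (comult A a) = a"
    and counit_right: "a \<in> carrier A \<Longrightarrow>
      tens_lift A (\<lambda>x y. counit A y \<odot>\<^bsub>A\<^esub> x) (comult A a) = a"
    and comult_mult: "\<lbrakk>a \<in> carrier A; b \<in> carrier A\<rbrakk> \<Longrightarrow>
      comult A (a \<otimes>\<^bsub>A\<^esub> b) = tens_act K A A (mult A) (mult A) (comult A a) (comult A b)"

definition left_monoidal ::
  "('k, 'm) ring_scheme \<Rightarrow> ('k, 'a, 'x) coalg_scheme \<Rightarrow> bool" where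
  "left_monoidal K A \<longleftrightarrow>
    (\<forall>a\<in>carrier A. \<forall>b\<in>carrier A. \<forall>c\<in>carrier A.
      counit A (a \<otimes>\<^bsub>A\<^esub> b \<otimes>\<^bsub>A\<^esub> c) =
      tens_lift K (\<lambda>x y. counit A (a \<otimes>\<^bsub>A\<^esub> x) \<otimes>\<^bsub>K\<^esub> counit A (y \<otimes>\<^bsub>A\<^esub> c)) (comult A b))"

definition right_monoidal ::
  "('k, 'm) ring_scheme \<Rightarrow> ('k, 'a, 'x) coalg_scheme \<Rightarrow> bool" where
  "right_monoidal K A \<longleftrightarrow>
    (\<forall>a\<in>carrier A. \<forall>b\<in>carrier A. \<forall>c\<in>carrier A.
      counit A (a \<otimes>\<^bsub>A\<^esub> b \<otimes>\<^bsub>A\<^esub> c) =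
      tens_lift K (\<lambda>x y. counit A (a \<otimes>\<^bsub>A\<^esub> y) \<otimes>\<^bsub>K\<^esub> counit A (x \<otimes>\<^bsub>A\<^esub> c)) (comult A b))"

definition monoidal ::
  "('k, 'm) ring_scheme \<Rightarrow> ('k, 'a, 'x) coalg_scheme \<Rightarrow> bool" where
  "monoidal K A \<longleftrightarrow> left_monoidal K A \<and> right_monoidal K A"

section \<open>Representations\<close>

record ('k, 'v, 'a) rep = "('k, 'v) module" +
  act :: "'a \<Rightarrow> 'v \<Rightarrow> 'v"

text \<open>
  Finite dimensional unital left modules over the algebra \<open>A\<close>: the objects of \<open>Rep A\<close>.
  A quantifier over all of \<open>Rep A\<close> that is only in a conclusion is rendered by a free type variable
  for the elements of the modules. Where it occurs as a hypothesis, HOL needs a fixed type;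
  \<open>nat \<Rightarrow> 'k\<close> is used, which contains a copy of every \<open>K^n\<close> and hence an isomorphic copy of every
  object of \<open>Rep A\<close>.
\<close>

locale representation =
  vectorspace K V
  for K :: "('k, 'm) ring_scheme" and A :: "('k, 'a, 'x) module_scheme"
    and V :: "('k, 'v, 'a, 'y) rep_scheme" +
  assumes finite_dim: "fin_dim"
    and act_bilinear: "bilinear_map K A V V (act V)"
    and act_one: "v \<in> carrier V \<Longrightarrow> act V \<one>\<^bsub>A\<^esub> v = v"
    and act_mult: "\<lbrakk>a \<in> carrier A; b \<in> carrier A; v \<in> carrier V\<rbrakk> \<Longrightarrow>
      act V (a \<otimes>\<^bsub>A\<^esub> b) v = act V a (act V b v)"

definition rep_hom ::
  "('k, 'm) ring_scheme \<Rightarrow> ('k, 'a, 'x) module_scheme \<Rightarrow>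
    ('k, 'v, 'a, 'y) rep_scheme \<Rightarrow> ('k, 'w, 'a, 'z) rep_scheme \<Rightarrow> ('v \<Rightarrow> 'w) set" where
  "rep_hom K A V W =
    {f \<in> module_hom K V W. \<forall>a\<in>carrier A. \<forall>v\<in>carrier V. f (act V a v) = act W a (f v)}"

text \<open>\<open>V \<times> W = \<Delta>(1)(V \<otimes> W)\<close> with \<open>A\<close> acting through \<open>\<Delta>\<close>.\<close>

definition rep_prod ::
  "('k, 'm) ring_scheme \<Rightarrow> ('k, 'a, 'x) coalg_scheme \<Rightarrow>
    ('k, 'v, 'a, 'y) rep_scheme \<Rightarrow> ('k, 'w, 'a, 'z) rep_scheme \<Rightarrow>
    ('k, ('v \<times> 'w) list set, 'a) rep" where
  "rep_prod K A V W =
    (let T = tensor K V W; \<alpha> = (\<lambda>a. tens_act K V W (act V) (act W) (comult A a)) in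
      \<lparr>carrier = \<alpha> \<one>\<^bsub>A\<^esub> ` carrier T, mult = mult T, one = one T, zero = zero T, add = add T,
       smult = smult T, act = \<alpha>\<rparr>)"

text \<open>\<open>f \<times> g : V \<times> W \<rightarrow> V' \<times> W'\<close>, the restriction of \<open>f \<otimes> g\<close>.\<close>

definition rep_prod_map ::
  "('k, 'm) ring_scheme \<Rightarrow> ('k, 'a, 'x) coalg_scheme \<Rightarrow>
    ('k, 'v, 'a, 'y) rep_scheme \<Rightarrow> ('k, 'w, 'a, 'z) rep_scheme \<Rightarrow>
    ('k, 'v2, 'a, 'y2) rep_scheme \<Rightarrow> ('k, 'w2, 'a, 'z2) rep_scheme \<Rightarrow>
    ('v \<Rightarrow> 'v2) \<Rightarrow> ('w \<Rightarrow> 'w2) \<Rightarrow> ('v \<times> 'w) list set \<Rightarrow> ('v2 \<times> 'w2) list set" where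
  "rep_prod_map K A V W V' W' f g =
    restrict (tens_map K V' W' f g) (carrier (rep_prod K A V W))"

text \<open>
  \<open>Hom(A, K)\<close> with the action \<open>(a \<rightharpoonup> \<phi>)(b) = \<phi>(ba)\<close>. Functionals are \<open>extensional\<close> (undefined
  off \<open>carrier A\<close>), so that equality is equality as maps on \<open>carrier A\<close>.
\<close>

definition dual_rep ::
  "('k, 'm) ring_scheme \<Rightarrow> ('k, 'a, 'x) module_scheme \<Rightarrow> ('k, 'a \<Rightarrow> 'k, 'a) rep" where
  "dual_rep K A =
    (let F = ring.func_space K (carrier A) in
      \<lparr>carrier = module_hom K A (ground_space K) \<inter> extensional (carrier A),
       mult = mult F, one = one F, zero = zero F, add = add F, smult = smult F,
       act = (\<lambda>a \<phi>. \<lambda>b\<in>carrier A. \<phi> (b \<otimes>\<^bsub>A\<^esub> a))\<rparr>)"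

definition counit_rep ::
  "('k, 'm) ring_scheme \<Rightarrow> ('k, 'a, 'x) coalg_scheme \<Rightarrow> ('k, 'a \<Rightarrow> 'k, 'a) rep" where
  "counit_rep K A =
    (dual_rep K A)\<lparr>carrier := (\<lambda>a. act (dual_rep K A) a (counit A)) ` carrier A\<rparr>"

text \<open>The maps \<open>L\<^sub>V : V \<rightarrow> E \<times> V\<close> and \<open>R\<^sub>V : V \<rightarrow> V \<times> E\<close>, where \<open>E = A \<rightharpoonup> \<epsilon>\<close> is \<open>counit_rep\<close>.\<close>

definition left_unit_map ::
  "('k, 'm) ring_scheme \<Rightarrow> ('k, 'a, 'x) coalg_scheme \<Rightarrow> ('k, 'v, 'a, 'y) rep_scheme \<Rightarrow>
    'v \<Rightarrow> (('a \<Rightarrow> 'k) \<times> 'v) list set" where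
  "left_unit_map K A V v =
    tens_lift (tensor K (counit_rep K A) V)
      (\<lambda>x y. tens K (counit_rep K A) V (act (dual_rep K A) x (counit A)) (act V y v))
      (comult A \<one>\<^bsub>A\<^esub>)"

definition right_unit_map ::
  "('k, 'm) ring_scheme \<Rightarrow> ('k, 'a, 'x) coalg_scheme \<Rightarrow> ('k, 'v, 'a, 'y) rep_scheme \<Rightarrow>
    'v \<Rightarrow> ('v \<times> ('a \<Rightarrow> 'k)) list set" where
  "right_unit_map K A V v =
    tens_lift (tensor K V (counit_rep K A))
      (\<lambda>x y. tens K V (counit_rep K A) (act V x v) (act (dual_rep K A) y (counit A)))
      (comult A \<one>\<^bsub>A\<^esub>)"

end

theory Submission
  imports Defs
begin

text \<open>
  One has \<open>L(v) = \<Delta>(1)(\<epsilon> \<otimes> v)\<close>, so \<open>a L(v) = (a1 \<rightharpoonup> \<epsilon>) \<otimes> a2 v\<close>, and left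
  monoidality says \<open>\<epsilon>(x2 a) (x1 \<rightharpoonup> \<epsilon>) = x a \<rightharpoonup> \<epsilon>\<close>. To move \<open>a\<close> in \<open>L(a v) = (1\<^sub>1 \<rightharpoonup> \<epsilon>) \<otimes> 1\<^sub>2 a v\<close> to
  both tensor factors, expand \<open>1\<^sub>2 a\<close> with the counit and use coassociativity and this identity.
  Conversely, equivariance on the regular module gives
  \<open>\<epsilon>(b 1\<^sub>1) \<epsilon>(1\<^sub>2 a c) = \<epsilon>(b a1) \<epsilon>(a2 c)\<close>; the case \<open>c = 1\<close>, applied to \<open>a c\<close>, shows that the left side
  is \<open>\<epsilon>(b a c)\<close>. For bijectivity, evaluation of the functional at \<open>1\<close> is a left inverse of \<open>L\<close>, and
  \<open>\<Delta>(1)(\<phi> \<otimes> v)\<close> is the image of \<open>\<phi>(1\<^sub>1) 1\<^sub>2 v\<close> by right monoidality. The triple identities follow by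
  evaluating both sides at \<open>\<Delta>(1)(v \<otimes> w)\<close>, and \<open>R\<close> and \<open>L\<close> agree on \<open>E\<close> because they agree at \<open>\<epsilon>\<close>.
\<close>

section \<open>Linear and bilinear maps\<close>

lemma module_hom_im: "f \<in> module_hom K M N \<Longrightarrow> m \<in> carrier M \<Longrightarrow> f m \<in> carrier N"
  by (auto simp: module_hom_def)

lemma module_homI:
  assumes "\<And>m. m \<in> carrier M \<Longrightarrow> f m \<in> carrier N"
    and "\<And>m m'. m \<in> carrier M \<Longrightarrow> m' \<in> carrier M \<Longrightarrow> f (m \<oplus>\<^bsub>M\<^esub> m') = f m \<oplus>\<^bsub>N\<^esub> f m'"
    and "\<And>c m. c \<in> carrier K \<Longrightarrow> m \<in> carrier M \<Longrightarrow> f (c \<odot>\<^bsub>M\<^esub> m) = c \<odot>\<^bsub>N\<^esub> f m"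
  shows "f \<in> module_hom K M N"
  using assms by (auto simp: module_hom_def)

lemma module_hom_cong:
  assumes "vectorspace K M" "f \<in> module_hom K M N"
    and "\<And>m. m \<in> carrier M \<Longrightarrow> g m = f m"
  shows "g \<in> module_hom K M N"
proof -
  interpret vectorspace K M by fact
  show ?thesis using assms(2,3) by (auto simp: module_hom_def Pi_def)
qed

lemma module_hom_id: "(\<lambda>x. x) \<in> module_hom K M M"
  by (auto simp: module_hom_def)

lemma module_hom_comp:
  "f \<in> module_hom K M N \<Longrightarrow> g \<in> module_hom K N P \<Longrightarrow> (\<lambda>x. g (f x)) \<in> module_hom K M P"
  by (auto simp: module_hom_def Pi_def)

lemma bilinear_mapI:
  assumes "\<And>v. v \<in> carrier V \<Longrightarrow> \<beta> v \<in> module_hom K W U"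
    and "\<And>w. w \<in> carrier W \<Longrightarrow> (\<lambda>v. \<beta> v w) \<in> module_hom K V U"
  shows "bilinear_map K V W U \<beta>"
  using assms by (auto simp: bilinear_map_def)

lemma
  assumes "bilinear_map K V W U \<beta>"
  shows bilinear_map_right: "v \<in> carrier V \<Longrightarrow> \<beta> v \<in> module_hom K W U"
    and bilinear_map_left: "w \<in> carrier W \<Longrightarrow> (\<lambda>v. \<beta> v w) \<in> module_hom K V U"
    and bilinear_map_im: "v \<in> carrier V \<Longrightarrow> w \<in> carrier W \<Longrightarrow> \<beta> v w \<in> carrier U"
  using assms by (auto simp: bilinear_map_def module_hom_def)

lemma bilinear_map_comp:
  assumes "bilinear_map K V' W' U \<beta>" "f \<in> module_hom K V V'" "g \<in> module_hom K W W'"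
  shows "bilinear_map K V W U (\<lambda>v w. \<beta> (f v) (g w))"
proof (rule bilinear_mapI)
  fix v assume "v \<in> carrier V"
  then have "f v \<in> carrier V'" using assms(2) by (simp add: module_hom_im)
  then show "(\<lambda>w. \<beta> (f v) (g w)) \<in> module_hom K W U"
    using module_hom_comp[OF assms(3) bilinear_map_right[OF assms(1)]] by blast
next
  fix w assume "w \<in> carrier W"
  then have "g w \<in> carrier W'" using assms(3) by (simp add: module_hom_im)
  then show "(\<lambda>v. \<beta> (f v) (g w)) \<in> module_hom K V U"
    using module_hom_comp[OF assms(2) bilinear_map_left[OF assms(1)]] by blast
qed

lemma module_hom_bilinear_map:
  assumes "bilinear_map K V W U \<beta>" "h \<in> module_hom K U U'"
  shows "bilinear_map K V W U' (\<lambda>v w. h (\<beta> v w))"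
  using assms by (auto simp: bilinear_map_def intro: module_hom_comp)

lemma vectorspace_smult_hom:
  assumes "vectorspace K U" "f \<in> module_hom K V U" "c \<in> carrier K"
  shows "(\<lambda>v. c \<odot>\<^bsub>U\<^esub> f v) \<in> module_hom K V U"
proof -
  interpret U: vectorspace K U by fact
  have "c \<odot>\<^bsub>U\<^esub> (d \<odot>\<^bsub>U\<^esub> u) = d \<odot>\<^bsub>U\<^esub> (c \<odot>\<^bsub>U\<^esub> u)" if "d \<in> carrier K" "u \<in> carrier U" for d u
    using that assms(3) by (simp flip: U.smult_assoc1 add: U.R.m_comm)
  then show ?thesis
    using assms(2,3) by (auto simp: module_hom_def U.smult_r_distr Pi_def)
qed

lemma vectorspace_ground_space:
  assumes "vectorspace K V"
  shows "vectorspace K (ground_space K)"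
proof -
  interpret vectorspace K V by fact
  have "module K (ground_space K)"
    by (rule module_criteria)
      (auto simp: ground_space_def R.is_cring R.a_ac R.m_assoc R.l_distr R.r_distr
        intro!: bexI[of _ "\<ominus>\<^bsub>K\<^esub> _"] R.r_neg)
  then show ?thesis by (rule vectorspace.intro) (rule field_axioms)
qed

lemma smult_bilinear:
  assumes "vectorspace K U"
  shows "bilinear_map K (ground_space K) U U (\<lambda>c u. c \<odot>\<^bsub>U\<^esub> u)"
proof -
  interpret U: vectorspace K U by fact
  show ?thesis
    by (rule bilinear_mapI; rule module_homI)
      (auto simp: ground_space_def U.smult_l_distr U.smult_r_distr U.smult_assoc1
        U.R.m_comm simp flip: U.smult_assoc1)
qed

lemma bilinear_map_flip:
  "bilinear_map K V W U \<beta> \<Longrightarrow> bilinear_map K W V U (\<lambda>w v. \<beta> v w)"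
  by (auto simp: bilinear_map_def)

lemma vectorspace_subset:
  assumes V: "vectorspace K V" and sub: "carrier S \<subseteq> carrier V"
    and ops: "\<zero>\<^bsub>S\<^esub> = \<zero>\<^bsub>V\<^esub>" "add S = add V" "smult S = smult V"
    and zero: "\<zero>\<^bsub>V\<^esub> \<in> carrier S"
    and add: "\<And>x y. x \<in> carrier S \<Longrightarrow> y \<in> carrier S \<Longrightarrow> x \<oplus>\<^bsub>V\<^esub> y \<in> carrier S"
    and smult: "\<And>c x. c \<in> carrier K \<Longrightarrow> x \<in> carrier S \<Longrightarrow> c \<odot>\<^bsub>V\<^esub> x \<in> carrier S"
  shows "vectorspace K S"
proof -
  interpret V: vectorspace K V by fact
  have neg: "\<exists>y\<in>carrier S. x \<oplus>\<^bsub>V\<^esub> y = \<zero>\<^bsub>V\<^esub>" if x: "x \<in> carrier S" for x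
  proof
    show "(\<ominus>\<^bsub>K\<^esub> \<one>\<^bsub>K\<^esub>) \<odot>\<^bsub>V\<^esub> x \<in> carrier S" using smult x by simp
    show "x \<oplus>\<^bsub>V\<^esub> (\<ominus>\<^bsub>K\<^esub> \<one>\<^bsub>K\<^esub>) \<odot>\<^bsub>V\<^esub> x = \<zero>\<^bsub>V\<^esub>"
      using x sub by (simp add: V.smult_minus_1 V.r_neg subset_iff)
  qed
  have "module K S"
    by (rule module_criteria)
      (use sub zero add smult neg in \<open>auto simp: ops V.R.is_cring V.a_ac V.smult_assoc1 V.smult_l_distr
        V.smult_r_distr subset_iff\<close>)
  then show ?thesis by (rule vectorspace.intro) (rule V.field_axioms)
qed

section \<open>Maps out of tensor products\<close>

lemma formal_sum_Cons: "formal_sum U \<beta> ((v, w) # x) = \<beta> v w \<oplus>\<^bsub>U\<^esub> formal_sum U \<beta> x"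
  by (simp add: formal_sum_def)

lemma formal_sum_Nil: "formal_sum U \<beta> [] = \<zero>\<^bsub>U\<^esub>"
  by (simp add: formal_sum_def)

lemma tens_lift_ground_space: "tens_lift (ground_space K) \<beta> t = tens_lift K \<beta> t"
  by (simp add: tens_lift_def formal_sum_def ground_space_def)

context tensor_pair
begin

text \<open>
  \<open>tens_lift\<close> evaluates all \<open>\<beta>\<close> on the same representative of \<open>t\<close>. Hence it is
  well behaved in \<open>\<beta>\<close> without any bilinearity assumption.
\<close>

lemma wf_sum_representative:
  assumes "t \<in> carrier (tensor K V W)"
  shows "wf_sum (SOME x. x \<in> t)"
proof -
  obtain x where t: "t = tens_class K V W x" and x: "wf_sum x"
    using assms by (auto simp: tensor_carrier)
  have "x \<in> t" using x by (simp add: t tens_class_def tens_eq.refl)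
  then have "(SOME x. x \<in> t) \<in> t" by (rule someI)
  then have "tens_eq K V W x (SOME x. x \<in> t)" by (simp only: t tens_class_def mem_Collect_eq)
  then show ?thesis using tens_eq_wf by blast
qed

lemma tens_lift_cong:
  assumes t: "t \<in> carrier (tensor K V W)"
    and eq: "\<And>v w. v \<in> carrier V \<Longrightarrow> w \<in> carrier W \<Longrightarrow> \<beta> v w = \<beta>' v w"
  shows "tens_lift U \<beta> t = tens_lift U \<beta>' t"
proof -
  have "formal_sum U \<beta> x = formal_sum U \<beta>' x" if "wf_sum x" for x
    using that by (induction x) (auto simp: formal_sum_def eq)
  then show ?thesis using wf_sum_representative[OF t] by (simp add: tens_lift_def)
qed

lemma tens_lift_closed:
  assumes U: "vectorspace K U" and t: "t \<in> carrier (tensor K V W)"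
    and \<beta>: "\<And>v w. v \<in> carrier V \<Longrightarrow> w \<in> carrier W \<Longrightarrow> \<beta> v w \<in> carrier U"
  shows "tens_lift U \<beta> t \<in> carrier U"
proof -
  interpret U: vectorspace K U by fact
  have "formal_sum U \<beta> x \<in> carrier U" if "wf_sum x" for x
    using that by (induction x) (auto simp: formal_sum_def \<beta>)
  then show ?thesis using wf_sum_representative[OF t] by (simp add: tens_lift_def)
qed

lemma hom_tens_lift:
  assumes U: "vectorspace K U" and U': "vectorspace K U'" and t: "t \<in> carrier (tensor K V W)"
    and f: "f \<in> module_hom K U U'"
    and \<beta>: "\<And>v w. v \<in> carrier V \<Longrightarrow> w \<in> carrier W \<Longrightarrow> \<beta> v w \<in> carrier U"
  shows "f (tens_lift U \<beta> t) = tens_lift U' (\<lambda>v w. f (\<beta> v w)) t"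
proof -
  interpret U: vectorspace K U by fact
  interpret U': vectorspace K U' by fact
  interpret f: mod_hom K U U' f by unfold_locales (rule f)
  have "formal_sum U \<beta> x \<in> carrier U \<and> f (formal_sum U \<beta> x) = formal_sum U' (\<lambda>v w. f (\<beta> v w)) x"
    if "wf_sum x" for x
    using that by (induction x) (auto simp: formal_sum_Cons formal_sum_Nil \<beta>)
  then show ?thesis using wf_sum_representative[OF t] by (simp add: tens_lift_def)
qed

lemma tens_lift_hom:
  assumes U: "vectorspace K U" and t: "t \<in> carrier (tensor K V W)"
    and \<beta>: "\<And>v w. v \<in> carrier V \<Longrightarrow> w \<in> carrier W \<Longrightarrow> (\<lambda>x. \<beta> x v w) \<in> module_hom K X U"
  shows "(\<lambda>x. tens_lift U (\<beta> x) t) \<in> module_hom K X U"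
proof -
  interpret U: vectorspace K U by fact
  note D = \<beta>[THEN module_hom_im] \<beta>[THEN module_hom_add] \<beta>[THEN module_hom_smult]
  have *: "formal_sum U (\<beta> x) l \<in> carrier U" if "wf_sum l" "x \<in> carrier X" for x l
    using that by (induction l) (auto simp: formal_sum_Cons formal_sum_Nil D)
  have "(\<lambda>x. formal_sum U (\<beta> x) l) \<in> module_hom K X U" if "wf_sum l" for l
    using that
  proof (induction l)
    case Nil
    show ?case by (rule module_homI) (auto simp: formal_sum_Nil)
  next
    case (Cons p l)
    obtain v w where p: "p = (v, w)" and vw: "v \<in> carrier V" "w \<in> carrier W" and l: "wf_sum l"
      using Cons.prems by (cases p) auto
    note IH = Cons.IH[OF l]
    show ?case
      using module_hom_im[OF IH] module_hom_add[OF IH] module_hom_smult[OF IH] D[OF vw]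
      by (intro module_homI) (simp_all add: p formal_sum_Cons U.a_ac U.smult_r_distr)
  qed
  then show ?thesis using wf_sum_representative[OF t] by (simp add: tens_lift_def)
qed

lemma tens_lift_swap:
  assumes "tensor_pair K V' W'" and U: "vectorspace K U"
    and t: "t \<in> carrier (tensor K V W)" and s: "s \<in> carrier (tensor K V' W')"
    and \<beta>: "\<And>v w v' w'. v \<in> carrier V \<Longrightarrow> w \<in> carrier W \<Longrightarrow> v' \<in> carrier V' \<Longrightarrow> w' \<in> carrier W' \<Longrightarrow>
      \<beta> v w v' w' \<in> carrier U"
  shows "tens_lift U (\<lambda>v w. tens_lift U (\<beta> v w) s) t =
    tens_lift U (\<lambda>v' w'. tens_lift U (\<lambda>v w. \<beta> v w v' w') t) s"
proof -
  interpret U: vectorspace K U by fact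
  interpret P: tensor_pair K V' W' by fact
  have zero: "formal_sum U (\<lambda>v' w'. \<zero>\<^bsub>U\<^esub>) m = \<zero>\<^bsub>U\<^esub>" for m
    by (induction m) (auto simp: formal_sum_Cons formal_sum_Nil)
  have closed: "formal_sum U (\<lambda>v w. \<beta> v w v' w') l \<in> carrier U"
    if "wf_sum l" "v' \<in> carrier V'" "w' \<in> carrier W'" for l v' w'
    using that by (induction l) (auto simp: formal_sum_Cons formal_sum_Nil \<beta>)
  have add: "formal_sum U (\<lambda>v' w'. f v' w' \<oplus>\<^bsub>U\<^esub> g v' w') m = formal_sum U f m \<oplus>\<^bsub>U\<^esub> formal_sum U g m
      \<and> formal_sum U f m \<in> carrier U \<and> formal_sum U g m \<in> carrier U"
    if "P.wf_sum m" "\<And>v' w'. v' \<in> carrier V' \<Longrightarrow> w' \<in> carrier W' \<Longrightarrow> f v' w' \<in> carrier U"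
      "\<And>v' w'. v' \<in> carrier V' \<Longrightarrow> w' \<in> carrier W' \<Longrightarrow> g v' w' \<in> carrier U" for f g m
    using that(1) by (induction m) (auto simp: formal_sum_Cons formal_sum_Nil that(2,3) U.a_ac)
  have "formal_sum U (\<lambda>v w. formal_sum U (\<beta> v w) m) l =
      formal_sum U (\<lambda>v' w'. formal_sum U (\<lambda>v w. \<beta> v w v' w') l) m"
    if "wf_sum l" "P.wf_sum m" for l m
    using that(1)
  proof (induction l)
    case Nil
    then show ?case by (simp add: formal_sum_Nil zero)
  next
    case (Cons p l)
    obtain v w where p: "p = (v, w)" and vw: "v \<in> carrier V" "w \<in> carrier W" and l: "wf_sum l"
      using Cons.prems by (cases p) auto
    show ?case
      using add[OF that(2), of "\<beta> v w" "\<lambda>v' w'. formal_sum U (\<lambda>v w. \<beta> v w v' w') l"]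
        Cons.IH[OF l] vw l by (simp add: p formal_sum_Cons \<beta> closed)
  qed
  then show ?thesis
    using wf_sum_representative[OF t] P.wf_sum_representative[OF s] by (simp add: tens_lift_def)
qed

lemma tens_closed:
  "v \<in> carrier V \<Longrightarrow> w \<in> carrier W \<Longrightarrow> tens K V W v w \<in> carrier (tensor K V W)"
  using bilinear_map_im[OF tens_bilinear] .

lemma tensor_hom_eqI:
  assumes U: "vectorspace K U"
    and f: "f \<in> module_hom K (tensor K V W) U" and g: "g \<in> module_hom K (tensor K V W) U"
    and eq: "\<And>v w. v \<in> carrier V \<Longrightarrow> w \<in> carrier W \<Longrightarrow> f (tens K V W v w) = g (tens K V W v w)"
    and t: "t \<in> carrier (tensor K V W)"
  shows "f t = g t"
  using tens_lift_unique[OF U module_hom_bilinear_map[OF tens_bilinear g] f eq t]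
    tens_lift_unique[OF U module_hom_bilinear_map[OF tens_bilinear g] g _ t] by simp

end

lemma tens_map_bilinear:
  assumes "tensor_pair K V' W'" "f \<in> module_hom K V V'" "g \<in> module_hom K W W'"
  shows "bilinear_map K V W (tensor K V' W') (\<lambda>v w. tens K V' W' (f v) (g w))"
  by (rule bilinear_map_comp[OF tensor_pair.tens_bilinear[OF assms(1)] assms(2,3)])

lemma tens_map_hom:
  assumes "tensor_pair K V W" "tensor_pair K V' W'" "f \<in> module_hom K V V'" "g \<in> module_hom K W W'"
  shows "tens_map K V' W' f g \<in> module_hom K (tensor K V W) (tensor K V' W')"
  unfolding tens_map_def
  by (rule tensor_pair.tens_lift_linear[OF assms(1)
        tensor_pair.tensor_vectorspace[OF assms(2)] tens_map_bilinear[OF assms(2-4)]])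

lemma tens_map_tens:
  assumes "tensor_pair K V W" "tensor_pair K V' W'" "f \<in> module_hom K V V'" "g \<in> module_hom K W W'"
    "v \<in> carrier V" "w \<in> carrier W"
  shows "tens_map K V' W' f g (tens K V W v w) = tens K V' W' (f v) (g w)"
  unfolding tens_map_def
  by (rule tensor_pair.tens_lift_tens[OF assms(1)
        tensor_pair.tensor_vectorspace[OF assms(2)] tens_map_bilinear[OF assms(2-4)] assms(5,6)])

context
  fixes K :: "('k, 'm) ring_scheme" and V :: "('k, 'v, 'x) module_scheme"
    and W :: "('k, 'w, 'y) module_scheme" and X :: "('k, 'u, 'z) module_scheme"
    and P :: "('k, ('v \<times> 'w) list set, 'p) module_scheme"
  assumes V: "vectorspace K V" and W: "vectorspace K W" and X: "vectorspace K X"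
    and P: "vectorspace K P" and incl: "(\<lambda>p. p) \<in> module_hom K P (tensor K V W)"
begin

interpretation VW: tensor_pair K V W by (intro tensor_pair.intro V W)
interpretation WX: tensor_pair K W X by (intro tensor_pair.intro W X)
interpretation V_WX: tensor_pair K V "tensor K W X"
  by (intro tensor_pair.intro V WX.tensor_vectorspace)
interpretation PX: tensor_pair K P X by (intro tensor_pair.intro P X)

lemma flat_left_bilinear:
  "bilinear_map K P X (tensor K V (tensor K W X))
    (\<lambda>p x. tens_lift (tensor K V (tensor K W X)) (\<lambda>v w. tens K V (tensor K W X) v (tens K W X w x)) p)"
proof (rule bilinear_mapI)
  fix p assume "p \<in> carrier P"
  then have p: "p \<in> carrier (tensor K V W)" by (rule module_hom_im[OF incl])
  show "(\<lambda>x. tens_lift (tensor K V (tensor K W X)) (\<lambda>v w. tens K V (tensor K W X) v (tens K W X w x)) p)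
      \<in> module_hom K X (tensor K V (tensor K W X))"
    by (rule VW.tens_lift_hom[OF V_WX.tensor_vectorspace p])
      (rule module_hom_comp[OF bilinear_map_right[OF WX.tens_bilinear]
          bilinear_map_right[OF V_WX.tens_bilinear]])
next
  fix x assume x: "x \<in> carrier X"
  have "bilinear_map K V W (tensor K V (tensor K W X)) (\<lambda>v w. tens K V (tensor K W X) v (tens K W X w x))"
    by (rule bilinear_map_comp[OF V_WX.tens_bilinear module_hom_id
          bilinear_map_left[OF WX.tens_bilinear x]])
  from module_hom_comp[OF incl VW.tens_lift_linear[OF V_WX.tensor_vectorspace this]]
  show "(\<lambda>p. tens_lift (tensor K V (tensor K W X)) (\<lambda>v w. tens K V (tensor K W X) v (tens K W X w x)) p)
      \<in> module_hom K P (tensor K V (tensor K W X))" .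
qed

lemma flat_left_hom: "flat_left K V W X \<in> module_hom K (tensor K P X) (tensor K V (tensor K W X))"
  unfolding flat_left_def Let_def
  by (rule PX.tens_lift_linear[OF V_WX.tensor_vectorspace flat_left_bilinear])

lemma flat_left_tens:
  assumes "p \<in> carrier P" "x \<in> carrier X"
  shows "flat_left K V W X (tens K P X p x) =
    tens_lift (tensor K V (tensor K W X)) (\<lambda>v w. tens K V (tensor K W X) v (tens K W X w x)) p"
  unfolding flat_left_def Let_def
  by (rule PX.tens_lift_tens[OF V_WX.tensor_vectorspace flat_left_bilinear assms])

end

context
  fixes K :: "('k, 'm) ring_scheme" and V :: "('k, 'v, 'x) module_scheme"
    and W :: "('k, 'w, 'y) module_scheme" and X :: "('k, 'u, 'z) module_scheme"
    and P :: "('k, ('w \<times> 'u) list set, 'p) module_scheme"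
  assumes V: "vectorspace K V" and W: "vectorspace K W" and X: "vectorspace K X"
    and P: "vectorspace K P" and incl: "(\<lambda>p. p) \<in> module_hom K P (tensor K W X)"
begin

interpretation WX: tensor_pair K W X by (intro tensor_pair.intro W X)
interpretation V_WX: tensor_pair K V "tensor K W X"
  by (intro tensor_pair.intro V WX.tensor_vectorspace)
interpretation VP: tensor_pair K V P by (intro tensor_pair.intro V P)

lemma flat_right_hom: "flat_right K V W X \<in> module_hom K (tensor K V P) (tensor K V (tensor K W X))"
  unfolding flat_right_def
  by (rule tens_map_hom[OF VP.tensor_pair_axioms V_WX.tensor_pair_axioms])
    (use incl module_hom_id[of K V] in \<open>simp_all add: id_def\<close>)

lemma flat_right_tens:
  assumes "v \<in> carrier V" "p \<in> carrier P"
  shows "flat_right K V W X (tens K V P v p) = tens K V (tensor K W X) v p"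
  using tens_map_tens[OF VP.tensor_pair_axioms V_WX.tensor_pair_axioms module_hom_id incl assms]
  by (simp add: flat_right_def id_def)

end

section \<open>Sweedler calculus\<close>

text \<open>
  A representation without the finiteness condition, so that \<open>E\<close> and \<open>V \<times> W\<close> can be used as modules
  without showing that they are finite dimensional.
\<close>

locale alg_module =
  vectorspace K V
  for K :: "('k, 'm) ring_scheme" and A :: "('k, 'a, 'x) module_scheme"
    and V :: "('k, 'v, 'a, 'y) rep_scheme" +
  assumes act_bilinear: "bilinear_map K A V V (act V)"
    and act_one: "v \<in> carrier V \<Longrightarrow> act V \<one>\<^bsub>A\<^esub> v = v"
    and act_mult: "\<lbrakk>a \<in> carrier A; b \<in> carrier A; v \<in> carrier V\<rbrakk> \<Longrightarrow>
      act V (a \<otimes>\<^bsub>A\<^esub> b) v = act V a (act V b v)"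

lemma representation_alg_module: "representation K A V \<Longrightarrow> alg_module K A V"
  by (simp add: representation_def representation_axioms_def alg_module_def alg_module_axioms_def)

context alg_module
begin

lemma act_closed: "a \<in> carrier A \<Longrightarrow> v \<in> carrier V \<Longrightarrow> act V a v \<in> carrier V"
  by (rule bilinear_map_im[OF act_bilinear])

lemma act_hom: "a \<in> carrier A \<Longrightarrow> act V a \<in> module_hom K V V"
  by (rule bilinear_map_right[OF act_bilinear])

lemma act_hom_left: "v \<in> carrier V \<Longrightarrow> (\<lambda>a. act V a v) \<in> module_hom K A V"
  by (rule bilinear_map_left[OF act_bilinear])

end

context weak_bialgebra
begin

interpretation AA: tensor_pair K A A
  by (intro tensor_pair.intro vectorspace_axioms)

lemma comult_closed: "a \<in> carrier A \<Longrightarrow> comult A a \<in> carrier (tensor K A A)"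
  by (rule module_hom_im[OF comult_linear])

lemma counit_closed: "a \<in> carrier A \<Longrightarrow> counit A a \<in> carrier K"
  using module_hom_im[OF counit_linear] by (simp add: ground_space_def)

lemma mult_hom_right: "a \<in> carrier A \<Longrightarrow> (\<lambda>b. a \<otimes>\<^bsub>A\<^esub> b) \<in> module_hom K A A"
  by (rule module_homI) (auto simp: alg.r_distr smult_mult_right)

lemma mult_hom_left: "b \<in> carrier A \<Longrightarrow> (\<lambda>a. a \<otimes>\<^bsub>A\<^esub> b) \<in> module_hom K A A"
  by (rule module_homI) (auto simp: alg.l_distr smult_mult_left)

abbreviation sweedler :: "('u, 'z) ring_scheme \<Rightarrow> 'a \<Rightarrow> ('a \<Rightarrow> 'a \<Rightarrow> 'u) \<Rightarrow> 'u" where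
  "sweedler U a \<beta> \<equiv> tens_lift U \<beta> (comult A a)"

lemma sweedler_cong:
  assumes "a \<in> carrier A" "\<And>x y. x \<in> carrier A \<Longrightarrow> y \<in> carrier A \<Longrightarrow> \<beta> x y = \<beta>' x y"
  shows "sweedler U a \<beta> = sweedler U a \<beta>'"
  using AA.tens_lift_cong[OF comult_closed] assms by blast

lemma sweedler_closed:
  assumes "vectorspace K U" "a \<in> carrier A"
    "\<And>x y. x \<in> carrier A \<Longrightarrow> y \<in> carrier A \<Longrightarrow> \<beta> x y \<in> carrier U"
  shows "sweedler U a \<beta> \<in> carrier U"
  using AA.tens_lift_closed[OF assms(1) comult_closed] assms by blast

lemma hom_sweedler:
  assumes "vectorspace K U" "vectorspace K U'" "a \<in> carrier A" "f \<in> module_hom K U U'"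
    "\<And>x y. x \<in> carrier A \<Longrightarrow> y \<in> carrier A \<Longrightarrow> \<beta> x y \<in> carrier U"
  shows "f (sweedler U a \<beta>) = sweedler U' a (\<lambda>x y. f (\<beta> x y))"
  using AA.hom_tens_lift[OF assms(1,2) comult_closed assms(4)] assms by blast

lemma sweedler_hom_parameter:
  assumes "vectorspace K U" "a \<in> carrier A"
    "\<And>x y. x \<in> carrier A \<Longrightarrow> y \<in> carrier A \<Longrightarrow> (\<lambda>v. \<beta> v x y) \<in> module_hom K X U"
  shows "(\<lambda>v. sweedler U a (\<beta> v)) \<in> module_hom K X U"
  using AA.tens_lift_hom[OF assms(1) comult_closed] assms by blast

lemma sweedler_hom:
  assumes "vectorspace K U" "bilinear_map K A A U \<beta>"
  shows "(\<lambda>a. sweedler U a \<beta>) \<in> module_hom K A U"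
  by (rule module_hom_comp[OF comult_linear AA.tens_lift_linear[OF assms]])

lemma sweedler_swap:
  assumes "vectorspace K U" "a \<in> carrier A" "b \<in> carrier A"
    "\<And>x y x' y'. x \<in> carrier A \<Longrightarrow> y \<in> carrier A \<Longrightarrow> x' \<in> carrier A \<Longrightarrow> y' \<in> carrier A \<Longrightarrow>
      \<beta> x y x' y' \<in> carrier U"
  shows "sweedler U a (\<lambda>x y. sweedler U b (\<beta> x y)) =
    sweedler U b (\<lambda>x' y'. sweedler U a (\<lambda>x y. \<beta> x y x' y'))"
  by (rule AA.tens_lift_swap[OF AA.tensor_pair_axioms assms(1) comult_closed comult_closed assms(4)])
    (simp_all add: assms)

lemma sweedler_mult:
  assumes U: "vectorspace K U" and \<beta>: "bilinear_map K A A U \<beta>"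
    and a: "a \<in> carrier A" and b: "b \<in> carrier A"
  shows "sweedler U (a \<otimes>\<^bsub>A\<^esub> b) \<beta> =
    sweedler U a (\<lambda>x y. sweedler U b (\<lambda>x' y'. \<beta> (x \<otimes>\<^bsub>A\<^esub> x') (y \<otimes>\<^bsub>A\<^esub> y')))"
proof -
  let ?T = "tensor K A A"
  note T = AA.tensor_vectorspace
  note L = AA.tens_lift_linear[OF U \<beta>]
  have hom: "tens_map K A A (mult A x) (mult A y) \<in> module_hom K ?T ?T"
    if "x \<in> carrier A" "y \<in> carrier A" for x y
    by (intro tens_map_hom AA.tensor_pair_axioms mult_hom_right that)
  have "sweedler U (a \<otimes>\<^bsub>A\<^esub> b) \<beta> =
      tens_lift U \<beta> (sweedler ?T a (\<lambda>x y. tens_map K A A (mult A x) (mult A y) (comult A b)))"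
    using a b by (simp add: comult_mult tens_act_def)
  also have "\<dots> = sweedler U a (\<lambda>x y. tens_lift U \<beta> (tens_map K A A (mult A x) (mult A y) (comult A b)))"
    by (rule hom_sweedler[OF T U a L]) (rule module_hom_im[OF hom comult_closed[OF b]])
  also have "\<dots> = sweedler U a (\<lambda>x y. sweedler U b (\<lambda>x' y'. \<beta> (x \<otimes>\<^bsub>A\<^esub> x') (y \<otimes>\<^bsub>A\<^esub> y')))"
  proof (rule sweedler_cong[OF a])
    fix x y assume xy: "x \<in> carrier A" "y \<in> carrier A"
    have "tens_lift U \<beta> (tens_map K A A (mult A x) (mult A y) (comult A b)) =
        sweedler U b (\<lambda>x' y'. tens_lift U \<beta> (tens K A A (x \<otimes>\<^bsub>A\<^esub> x') (y \<otimes>\<^bsub>A\<^esub> y')))"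
      unfolding tens_map_def
      by (rule hom_sweedler[OF T U b L]) (use xy in \<open>auto intro: AA.tens_closed\<close>)
    also have "\<dots> = sweedler U b (\<lambda>x' y'. \<beta> (x \<otimes>\<^bsub>A\<^esub> x') (y \<otimes>\<^bsub>A\<^esub> y'))"
      by (rule sweedler_cong[OF b]) (use xy in \<open>simp add: AA.tens_lift_tens[OF U \<beta>]\<close>)
    finally show "tens_lift U \<beta> (tens_map K A A (mult A x) (mult A y) (comult A b)) =
        sweedler U b (\<lambda>x' y'. \<beta> (x \<otimes>\<^bsub>A\<^esub> x') (y \<otimes>\<^bsub>A\<^esub> y'))" .
  qed
  finally show ?thesis .
qed

lemma sweedler_coassoc:
  assumes U: "vectorspace K U" and a: "a \<in> carrier A"
    and \<gamma>1: "\<And>y z. y \<in> carrier A \<Longrightarrow> z \<in> carrier A \<Longrightarrow> (\<lambda>x. \<gamma> x y z) \<in> module_hom K A U"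
    and \<gamma>2: "\<And>x z. x \<in> carrier A \<Longrightarrow> z \<in> carrier A \<Longrightarrow> (\<lambda>y. \<gamma> x y z) \<in> module_hom K A U"
    and \<gamma>3: "\<And>x y. x \<in> carrier A \<Longrightarrow> y \<in> carrier A \<Longrightarrow> (\<lambda>z. \<gamma> x y z) \<in> module_hom K A U"
  shows "sweedler U a (\<lambda>x y. sweedler U x (\<lambda>x1 x2. \<gamma> x1 x2 y)) =
    sweedler U a (\<lambda>x y. sweedler U y (\<lambda>y1 y2. \<gamma> x y1 y2))"
proof -
  let ?T2 = "tensor K A A"
  let ?T = "tensor K A ?T2"
  note T2 = AA.tensor_vectorspace
  interpret A_AA: tensor_pair K A ?T2 by (intro tensor_pair.intro vectorspace_axioms T2)
  interpret AA_A: tensor_pair K ?T2 A by (intro tensor_pair.intro vectorspace_axioms T2)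
  note T = A_AA.tensor_vectorspace
  have bil: "bilinear_map K A A U (\<gamma> x)" if "x \<in> carrier A" for x
    using \<gamma>2 \<gamma>3 that by (intro bilinear_mapI) auto
  have bil': "bilinear_map K A ?T2 U (\<lambda>x. tens_lift U (\<gamma> x))"
    by (intro bilinear_mapI AA.tens_lift_linear[OF U bil] AA.tens_lift_hom[OF U] \<gamma>1)
  define f where "f = tens_lift U (\<lambda>x. tens_lift U (\<gamma> x))"
  have f: "f \<in> module_hom K ?T U" unfolding f_def by (rule A_AA.tens_lift_linear[OF U bil'])
  have f_tens: "f (tens K A ?T2 x p) = tens_lift U (\<gamma> x) p" if "x \<in> carrier A" "p \<in> carrier ?T2" for x p
    unfolding f_def by (rule A_AA.tens_lift_tens[OF U bil' that])
  note FH = flat_left_hom[OF vectorspace_axioms vectorspace_axioms vectorspace_axioms T2 module_hom_id]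
  note FT = flat_left_tens[OF vectorspace_axioms vectorspace_axioms vectorspace_axioms T2 module_hom_id]
  have "f (flat_left K A A A (tens_map K ?T2 A (comult A) id (comult A a))) =
     sweedler U a (\<lambda>x y. f (flat_left K A A A (tens K ?T2 A (comult A x) y)))"
    unfolding tens_map_def id_def
    by (rule hom_sweedler[OF AA_A.tensor_vectorspace U a module_hom_comp[OF FH f]])
      (simp add: AA_A.tens_closed comult_closed)
  also have "\<dots> = sweedler U a (\<lambda>x y. sweedler U x (\<lambda>x1 x2. \<gamma> x1 x2 y))"
  proof (rule sweedler_cong[OF a])
    fix x y assume xy: "x \<in> carrier A" "y \<in> carrier A"
    have "f (flat_left K A A A (tens K ?T2 A (comult A x) y)) =
        f (sweedler ?T x (\<lambda>v w. tens K A ?T2 v (tens K A A w y)))"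
      using xy by (simp add: FT comult_closed)
    also have "\<dots> = sweedler U x (\<lambda>v w. f (tens K A ?T2 v (tens K A A w y)))"
      by (rule hom_sweedler[OF T U xy(1) f]) (simp add: A_AA.tens_closed AA.tens_closed xy)
    also have "\<dots> = sweedler U x (\<lambda>x1 x2. \<gamma> x1 x2 y)"
      by (rule sweedler_cong[OF xy(1)])
        (simp add: f_tens AA.tens_closed xy AA.tens_lift_tens[OF U bil])
    finally show "f (flat_left K A A A (tens K ?T2 A (comult A x) y)) =
        sweedler U x (\<lambda>x1 x2. \<gamma> x1 x2 y)" .
  qed
  finally have 1: "f (flat_left K A A A (tens_map K ?T2 A (comult A) id (comult A a))) =
    sweedler U a (\<lambda>x y. sweedler U x (\<lambda>x1 x2. \<gamma> x1 x2 y))" .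
  have "f (tens_map K A ?T2 id (comult A) (comult A a)) =
      sweedler U a (\<lambda>x y. f (tens K A ?T2 x (comult A y)))"
    unfolding tens_map_def id_def
    by (rule hom_sweedler[OF T U a f]) (simp add: A_AA.tens_closed comult_closed)
  also have "\<dots> = sweedler U a (\<lambda>x y. sweedler U y (\<lambda>y1 y2. \<gamma> x y1 y2))"
    by (rule sweedler_cong[OF a]) (simp add: f_tens comult_closed)
  finally show ?thesis using 1 coassoc[OF a] by simp
qed

lemma sweedler_counit_left:
  assumes U: "vectorspace K U" and a: "a \<in> carrier A" and f: "f \<in> module_hom K A U"
  shows "f a = sweedler U a (\<lambda>x y. counit A x \<odot>\<^bsub>U\<^esub> f y)"
proof -
  have "f a = f (sweedler A a (\<lambda>x y. counit A x \<odot>\<^bsub>A\<^esub> y))" using counit_left[OF a] by simp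
  also have "\<dots> = sweedler U a (\<lambda>x y. f (counit A x \<odot>\<^bsub>A\<^esub> y))"
    by (rule hom_sweedler[OF vectorspace_axioms U a f]) (simp add: counit_closed)
  also have "\<dots> = sweedler U a (\<lambda>x y. counit A x \<odot>\<^bsub>U\<^esub> f y)"
    by (rule sweedler_cong[OF a]) (simp add: module_hom_smult[OF f] counit_closed)
  finally show ?thesis .
qed

lemma sweedler_counit_right:
  assumes U: "vectorspace K U" and a: "a \<in> carrier A" and f: "f \<in> module_hom K A U"
  shows "f a = sweedler U a (\<lambda>x y. counit A y \<odot>\<^bsub>U\<^esub> f x)"
proof -
  have "f a = f (sweedler A a (\<lambda>x y. counit A y \<odot>\<^bsub>A\<^esub> x))" using counit_right[OF a] by simp
  also have "\<dots> = sweedler U a (\<lambda>x y. f (counit A y \<odot>\<^bsub>A\<^esub> x))"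
    by (rule hom_sweedler[OF vectorspace_axioms U a f]) (simp add: counit_closed)
  also have "\<dots> = sweedler U a (\<lambda>x y. counit A y \<odot>\<^bsub>U\<^esub> f x)"
    by (rule sweedler_cong[OF a]) (simp add: module_hom_smult[OF f] counit_closed)
  finally show ?thesis .
qed

section \<open>The tensor product as a nonunital module\<close>

abbreviation tens_act' :: "('k, 'v, 'a, 'y) rep_scheme \<Rightarrow> ('k, 'w, 'a, 'z) rep_scheme \<Rightarrow> 'a \<Rightarrow>
    ('v \<times> 'w) list set \<Rightarrow> ('v \<times> 'w) list set" where
  "tens_act' V W a \<equiv> tens_act K V W (act V) (act W) (comult A a)"

context
  fixes V :: "('k, 'v, 'a, 'y) rep_scheme" and W :: "('k, 'w, 'a, 'z) rep_scheme"
  assumes V: "alg_module K A V" and W: "alg_module K A W"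
begin

interpretation V: alg_module K A V by (rule V)
interpretation W: alg_module K A W by (rule W)
interpretation VW: tensor_pair K V W
  by (intro tensor_pair.intro V.vectorspace_axioms W.vectorspace_axioms)

lemma tens_act_bilinear: "bilinear_map K A (tensor K V W) (tensor K V W) (tens_act' V W)"
proof (rule bilinear_mapI)
  fix a assume a: "a \<in> carrier A"
  show "tens_act' V W a \<in> module_hom K (tensor K V W) (tensor K V W)"
    unfolding tens_act_def
    by (rule sweedler_hom_parameter[OF VW.tensor_vectorspace a])
      (intro tens_map_hom VW.tensor_pair_axioms V.act_hom W.act_hom)
next
  fix t assume t: "t \<in> carrier (tensor K V W)"
  have "bilinear_map K A A (tensor K V W) (\<lambda>a b. tens_map K V W (act V a) (act W b) t)"
    unfolding tens_map_def
  proof (intro bilinear_mapI VW.tens_lift_hom[OF VW.tensor_vectorspace t])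
    fix a v w assume "a \<in> carrier A" "v \<in> carrier V" "w \<in> carrier W"
    then show "(\<lambda>b. tens K V W (act V a v) (act W b w)) \<in> module_hom K A (tensor K V W)"
      by (intro module_hom_comp[OF W.act_hom_left bilinear_map_right[OF VW.tens_bilinear]] V.act_closed)
  next
    fix b v w assume "b \<in> carrier A" "v \<in> carrier V" "w \<in> carrier W"
    then show "(\<lambda>a. tens K V W (act V a v) (act W b w)) \<in> module_hom K A (tensor K V W)"
      by (intro module_hom_comp[OF V.act_hom_left bilinear_map_left[OF VW.tens_bilinear]] W.act_closed)
  qed
  from sweedler_hom[OF VW.tensor_vectorspace this]
  show "(\<lambda>a. tens_act' V W a t) \<in> module_hom K A (tensor K V W)"
    by (simp add: tens_act_def)
qed

lemma tens_act_tens: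
  assumes "a \<in> carrier A" "v \<in> carrier V" "w \<in> carrier W"
  shows "tens_act' V W a (tens K V W v w) =
    sweedler (tensor K V W) a (\<lambda>x y. tens K V W (act V x v) (act W y w))"
  unfolding tens_act_def
  by (rule sweedler_cong[OF assms(1)])
    (intro tens_map_tens VW.tensor_pair_axioms V.act_hom W.act_hom assms)

lemma tens_act_tens_bilinear:
  assumes "v \<in> carrier V" "w \<in> carrier W"
  shows "bilinear_map K A A (tensor K V W) (\<lambda>x y. tens K V W (act V x v) (act W y w))"
  by (rule bilinear_map_comp[OF VW.tens_bilinear]) (intro V.act_hom_left W.act_hom_left assms)+

lemma tens_act_mult:
  assumes a: "a \<in> carrier A" and b: "b \<in> carrier A" and t: "t \<in> carrier (tensor K V W)"
  shows "tens_act' V W (a \<otimes>\<^bsub>A\<^esub> b) t = tens_act' V W a (tens_act' V W b t)"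
proof (rule VW.tensor_hom_eqI[OF VW.tensor_vectorspace _ _ _ t])
  let ?T = "tensor K V W"
  note hom = bilinear_map_right[OF tens_act_bilinear]
  show "tens_act' V W (a \<otimes>\<^bsub>A\<^esub> b) \<in> module_hom K ?T ?T" using a b by (simp add: hom)
  show "(\<lambda>t. tens_act' V W a (tens_act' V W b t)) \<in> module_hom K ?T ?T"
    by (rule module_hom_comp[OF hom[OF b] hom[OF a]])
  fix v w assume v: "v \<in> carrier V" and w: "w \<in> carrier W"
  let ?s = "\<lambda>x y x' y'. tens K V W (act V (x \<otimes>\<^bsub>A\<^esub> x') v) (act W (y \<otimes>\<^bsub>A\<^esub> y') w)"
  have "tens_act' V W (a \<otimes>\<^bsub>A\<^esub> b) (tens K V W v w) = sweedler ?T a (\<lambda>x y. sweedler ?T b (?s x y))"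
    using a b v w by (simp add: tens_act_tens
        sweedler_mult[OF VW.tensor_vectorspace tens_act_tens_bilinear])
  also have "\<dots> = sweedler ?T b (\<lambda>x' y'. sweedler ?T a (\<lambda>x y. ?s x y x' y'))"
    by (rule sweedler_swap[OF VW.tensor_vectorspace a b])
      (simp add: VW.tens_closed V.act_closed W.act_closed v w)
  also have "\<dots> = sweedler ?T b (\<lambda>x' y'. tens_act' V W a (tens K V W (act V x' v) (act W y' w)))"
  proof (rule sweedler_cong[OF b])
    fix x' y' assume x'y': "x' \<in> carrier A" "y' \<in> carrier A"
    then have "tens_act' V W a (tens K V W (act V x' v) (act W y' w)) = sweedler ?T a
        (\<lambda>x y. tens K V W (act V x (act V x' v)) (act W y (act W y' w)))"
      by (simp add: tens_act_tens a V.act_closed W.act_closed v w)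
    also have "\<dots> = sweedler ?T a (\<lambda>x y. ?s x y x' y')"
      by (rule sweedler_cong[OF a]) (simp add: V.act_mult W.act_mult v w x'y')
    finally show "sweedler ?T a (\<lambda>x y. ?s x y x' y') =
      tens_act' V W a (tens K V W (act V x' v) (act W y' w))" ..
  qed
  also have "\<dots> = tens_act' V W a (tens_act' V W b (tens K V W v w))"
    unfolding tens_act_tens[OF b v w]
    by (rule hom_sweedler[OF VW.tensor_vectorspace VW.tensor_vectorspace b hom[OF a], symmetric])
      (simp add: VW.tens_closed V.act_closed W.act_closed v w)
  finally show "tens_act' V W (a \<otimes>\<^bsub>A\<^esub> b) (tens K V W v w) =
    tens_act' V W a (tens_act' V W b (tens K V W v w))" .
qed

lemma rep_prod_simps:
  "carrier (rep_prod K A V W) = tens_act' V W \<one>\<^bsub>A\<^esub> ` carrier (tensor K V W)"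
  "\<zero>\<^bsub>rep_prod K A V W\<^esub> = \<zero>\<^bsub>tensor K V W\<^esub>"
  "add (rep_prod K A V W) = add (tensor K V W)"
  "smult (rep_prod K A V W) = smult (tensor K V W)"
  "act (rep_prod K A V W) = tens_act' V W"
  by (simp_all add: rep_prod_def Let_def)

lemma tens_act_closed:
  "a \<in> carrier A \<Longrightarrow> t \<in> carrier (tensor K V W) \<Longrightarrow> tens_act' V W a t \<in> carrier (tensor K V W)"
  by (rule bilinear_map_im[OF tens_act_bilinear])

lemma tens_act_in_rep_prod:
  assumes "a \<in> carrier A" "t \<in> carrier (tensor K V W)"
  shows "tens_act' V W a t \<in> carrier (rep_prod K A V W)"
proof -
  have "tens_act' V W a t = tens_act' V W \<one>\<^bsub>A\<^esub> (tens_act' V W a t)"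
    using tens_act_mult[of "\<one>\<^bsub>A\<^esub>" a t] assms by simp
  then show ?thesis using tens_act_closed[OF assms] by (auto simp: rep_prod_simps)
qed

lemma rep_prod_subset: "carrier (rep_prod K A V W) \<subseteq> carrier (tensor K V W)"
  by (auto simp: rep_prod_simps tens_act_closed)

lemma rep_prod_tens_act_one:
  "t \<in> carrier (rep_prod K A V W) \<Longrightarrow> tens_act' V W \<one>\<^bsub>A\<^esub> t = t"
  by (auto simp: rep_prod_simps simp flip: tens_act_mult)

lemma rep_prod_vectorspace: "vectorspace K (rep_prod K A V W)"
proof -
  interpret T: vectorspace K "tensor K V W" by (rule VW.tensor_vectorspace)
  note hom = bilinear_map_right[OF tens_act_bilinear alg.one_closed]
  have zero: "tens_act' V W \<one>\<^bsub>A\<^esub> \<zero>\<^bsub>tensor K V W\<^esub> = \<zero>\<^bsub>tensor K V W\<^esub>"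
    using module_hom_smult[OF hom R.zero_closed T.zero_closed] tens_act_closed by simp
  show ?thesis
  proof (rule vectorspace_subset[OF T.vectorspace_axioms rep_prod_subset rep_prod_simps(2-4)])
    show "\<zero>\<^bsub>tensor K V W\<^esub> \<in> carrier (rep_prod K A V W)"
      using zero tens_act_in_rep_prod[OF alg.one_closed T.zero_closed] by simp
  next
    fix s t assume *: "s \<in> carrier (rep_prod K A V W)" "t \<in> carrier (rep_prod K A V W)"
    then have "s \<in> carrier (tensor K V W)" "t \<in> carrier (tensor K V W)" using rep_prod_subset by auto
    then show "s \<oplus>\<^bsub>tensor K V W\<^esub> t \<in> carrier (rep_prod K A V W)"
      using tens_act_in_rep_prod[of "\<one>\<^bsub>A\<^esub>" "s \<oplus>\<^bsub>tensor K V W\<^esub> t"] *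
      by (simp add: module_hom_add[OF hom] rep_prod_tens_act_one)
  next
    fix c t assume *: "c \<in> carrier K" "t \<in> carrier (rep_prod K A V W)"
    then have "t \<in> carrier (tensor K V W)" using rep_prod_subset by auto
    then show "c \<odot>\<^bsub>tensor K V W\<^esub> t \<in> carrier (rep_prod K A V W)"
      using tens_act_in_rep_prod[of "\<one>\<^bsub>A\<^esub>" "c \<odot>\<^bsub>tensor K V W\<^esub> t"] *
      by (simp add: module_hom_smult[OF hom] rep_prod_tens_act_one)
  qed
qed

lemma rep_prod_incl: "(\<lambda>t. t) \<in> module_hom K (rep_prod K A V W) (tensor K V W)"
  using rep_prod_subset by (intro module_homI) (auto simp: rep_prod_simps(3,4))

lemma hom_into_rep_prod:
  assumes "f \<in> module_hom K X (tensor K V W)"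
    and "\<And>x. x \<in> carrier X \<Longrightarrow> f x \<in> carrier (rep_prod K A V W)"
  shows "f \<in> module_hom K X (rep_prod K A V W)"
  using assms by (intro module_homI) (auto simp: rep_prod_simps(3,4) module_hom_add module_hom_smult)

lemma rep_prod_alg_module: "alg_module K A (rep_prod K A V W)"
proof (intro alg_module.intro alg_module_axioms.intro rep_prod_vectorspace)
  have sub: "t \<in> carrier (tensor K V W)" if "t \<in> carrier (rep_prod K A V W)" for t
    using rep_prod_subset that by auto
  show "bilinear_map K A (rep_prod K A V W) (rep_prod K A V W) (act (rep_prod K A V W))"
    unfolding rep_prod_simps(5)
    by (intro bilinear_mapI hom_into_rep_prod tens_act_in_rep_prod sub
        module_hom_comp[OF rep_prod_incl bilinear_map_right[OF tens_act_bilinear]]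
        bilinear_map_left[OF tens_act_bilinear])
  show "act (rep_prod K A V W) \<one>\<^bsub>A\<^esub> t = t" if "t \<in> carrier (rep_prod K A V W)" for t
    using that unfolding rep_prod_simps(5) by (rule rep_prod_tens_act_one)
  show "act (rep_prod K A V W) (a \<otimes>\<^bsub>A\<^esub> b) t = act (rep_prod K A V W) a (act (rep_prod K A V W) b t)"
    if "a \<in> carrier A" "b \<in> carrier A" "t \<in> carrier (rep_prod K A V W)" for a b t
    unfolding rep_prod_simps(5) by (rule tens_act_mult[OF that(1,2) sub[OF that(3)]])
qed

end

section \<open>The unit object\<close>

abbreviation E :: "('k, 'a \<Rightarrow> 'k, 'a) rep" where "E \<equiv> counit_rep K A"

abbreviation counit_act :: "'a \<Rightarrow> 'a \<Rightarrow> 'k" where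
  "counit_act a \<equiv> act (dual_rep K A) a (counit A)"

lemma counit_act_eq: "counit_act a = (\<lambda>b\<in>carrier A. counit A (b \<otimes>\<^bsub>A\<^esub> a))"
  by (simp add: dual_rep_def Let_def)

lemma counit_rep_simps:
  "carrier E = counit_act ` carrier A"
  "\<zero>\<^bsub>E\<^esub> = (\<lambda>b\<in>carrier A. \<zero>\<^bsub>K\<^esub>)"
  "add E = (\<lambda>\<phi> \<psi>. \<lambda>b\<in>carrier A. \<phi> b \<oplus>\<^bsub>K\<^esub> \<psi> b)"
  "smult E = (\<lambda>c \<phi>. \<lambda>b\<in>carrier A. c \<otimes>\<^bsub>K\<^esub> \<phi> b)"
  "act E = (\<lambda>a \<phi>. \<lambda>b\<in>carrier A. \<phi> (b \<otimes>\<^bsub>A\<^esub> a))"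
  by (simp_all add: counit_rep_def dual_rep_def Let_def R.func_space_def)

lemma counit_add:
  "a \<in> carrier A \<Longrightarrow> b \<in> carrier A \<Longrightarrow> counit A (a \<oplus>\<^bsub>A\<^esub> b) = counit A a \<oplus>\<^bsub>K\<^esub> counit A b"
  using module_hom_add[OF counit_linear] by (simp add: ground_space_def)

lemma counit_smult:
  "c \<in> carrier K \<Longrightarrow> a \<in> carrier A \<Longrightarrow> counit A (c \<odot>\<^bsub>A\<^esub> a) = c \<otimes>\<^bsub>K\<^esub> counit A a"
  using module_hom_smult[OF counit_linear] by (simp add: ground_space_def)

lemma counit_act_apply: "b \<in> carrier A \<Longrightarrow> counit_act a b = counit A (b \<otimes>\<^bsub>A\<^esub> a)"
  by (simp add: counit_act_eq)

lemma counit_act_closed: "a \<in> carrier A \<Longrightarrow> counit_act a \<in> carrier E"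
  by (simp add: counit_rep_simps)

lemma counit_act_hom: "counit_act \<in> module_hom K A E"
  by (rule module_homI)
    (auto simp: counit_rep_simps counit_act_eq alg.r_distr smult_mult_right counit_add counit_smult
      restrict_def)

lemma counit_rep_vectorspace: "vectorspace K E"
proof -
  have F: "vectorspace K (R.func_space (carrier A))"
    by (rule vectorspace.intro[OF R.func_space_is_module]) (rule field_axioms)
  have sub: "counit_act a \<in> carrier (R.func_space (carrier A))" if "a \<in> carrier A" for a
    using that by (auto simp: R.func_space_def counit_act_eq counit_closed)
  have ops: "\<zero>\<^bsub>E\<^esub> = \<zero>\<^bsub>R.func_space (carrier A)\<^esub>" "add E = add (R.func_space (carrier A))"
    "smult E = smult (R.func_space (carrier A))"
    by (auto simp: counit_rep_simps R.func_space_def)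
  show ?thesis
  proof (rule vectorspace_subset[OF F _ ops])
    show "carrier E \<subseteq> carrier (R.func_space (carrier A))" using sub by (auto simp: counit_rep_simps(1))
    have "\<zero>\<^bsub>E\<^esub> = counit_act \<zero>\<^bsub>A\<^esub>"
      using counit_smult[OF R.zero_closed M.zero_closed]
      by (auto simp: counit_rep_simps counit_act_eq restrict_def counit_closed)
    then show "\<zero>\<^bsub>R.func_space (carrier A)\<^esub> \<in> carrier E"
      unfolding ops[symmetric] by (simp add: counit_act_closed)
  next
    fix \<phi> \<psi> assume "\<phi> \<in> carrier E" "\<psi> \<in> carrier E"
    then show "\<phi> \<oplus>\<^bsub>R.func_space (carrier A)\<^esub> \<psi> \<in> carrier E"
      unfolding ops[symmetric] unfolding counit_rep_simps(1)
      by (auto simp flip: module_hom_add[OF counit_act_hom])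
  next
    fix c \<phi> assume "c \<in> carrier K" "\<phi> \<in> carrier E"
    then show "c \<odot>\<^bsub>R.func_space (carrier A)\<^esub> \<phi> \<in> carrier E"
      unfolding ops[symmetric] unfolding counit_rep_simps(1)
      by (auto simp flip: module_hom_smult[OF counit_act_hom])
  qed
qed

lemma counit_rep_eqI:
  assumes "\<phi> \<in> carrier E" "\<psi> \<in> carrier E" "\<And>b. b \<in> carrier A \<Longrightarrow> \<phi> b = \<psi> b"
  shows "\<phi> = \<psi>"
proof (rule extensionalityI)
  show "\<phi> \<in> extensional (carrier A)" "\<psi> \<in> extensional (carrier A)"
    using assms(1,2) by (auto simp: counit_rep_simps(1) counit_act_eq)
qed (rule assms(3))

lemma eval_hom: "b \<in> carrier A \<Longrightarrow> (\<lambda>\<phi>. \<phi> b) \<in> module_hom K E (ground_space K)"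
  by (rule module_homI) (auto simp: counit_rep_simps ground_space_def counit_act_apply counit_closed)

lemma act_counit_act:
  "a \<in> carrier A \<Longrightarrow> x \<in> carrier A \<Longrightarrow> act E a (counit_act x) = counit_act (a \<otimes>\<^bsub>A\<^esub> x)"
  by (auto simp: counit_rep_simps counit_act_eq restrict_def alg.m_assoc)

lemma counit_rep_alg_module: "alg_module K A E"
proof (intro alg_module.intro alg_module_axioms.intro counit_rep_vectorspace bilinear_mapI)
  note D = module_hom_add[OF counit_act_hom, symmetric] module_hom_smult[OF counit_act_hom, symmetric]
  have ex: "\<exists>x\<in>carrier A. \<phi> = counit_act x" if "\<phi> \<in> carrier E" for \<phi>
    using that by (auto simp: counit_rep_simps(1))
  show "act E a \<in> module_hom K E E" if "a \<in> carrier A" for a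
    by (rule module_homI) (use that in \<open>auto dest!: ex simp: D act_counit_act counit_act_closed
      alg.r_distr smult_mult_right\<close>)
  show "(\<lambda>a. act E a \<phi>) \<in> module_hom K A E" if "\<phi> \<in> carrier E" for \<phi>
    by (rule module_homI) (use that in \<open>auto dest!: ex simp: D act_counit_act counit_act_closed
      alg.l_distr smult_mult_left\<close>)
  show "act E \<one>\<^bsub>A\<^esub> \<phi> = \<phi>" if "\<phi> \<in> carrier E" for \<phi>
    using that by (auto dest!: ex simp: act_counit_act)
  show "act E (a \<otimes>\<^bsub>A\<^esub> b) \<phi> = act E a (act E b \<phi>)"
    if "a \<in> carrier A" "b \<in> carrier A" "\<phi> \<in> carrier E" for a b \<phi>
    using that by (auto dest!: ex simp: act_counit_act alg.m_assoc)
qed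

section \<open>Consequences of monoidality\<close>

lemma left_monoidal_counit_act:
  assumes "left_monoidal K A" and x: "x \<in> carrier A" and a: "a \<in> carrier A"
  shows "sweedler E x (\<lambda>p q. counit A (q \<otimes>\<^bsub>A\<^esub> a) \<odot>\<^bsub>E\<^esub> counit_act p) = counit_act (x \<otimes>\<^bsub>A\<^esub> a)"
proof -
  interpret E: vectorspace K E by (rule counit_rep_vectorspace)
  have closed: "counit A (q \<otimes>\<^bsub>A\<^esub> a) \<odot>\<^bsub>E\<^esub> counit_act p \<in> carrier E"
    if "p \<in> carrier A" "q \<in> carrier A" for p q
    using that a by (simp add: counit_closed counit_act_closed)
  show ?thesis
  proof (rule counit_rep_eqI)
    show "sweedler E x (\<lambda>p q. counit A (q \<otimes>\<^bsub>A\<^esub> a) \<odot>\<^bsub>E\<^esub> counit_act p) \<in> carrier E"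
      by (rule sweedler_closed[OF counit_rep_vectorspace x closed])
    show "counit_act (x \<otimes>\<^bsub>A\<^esub> a) \<in> carrier E" using x a by (simp add: counit_act_closed)
    fix b assume b: "b \<in> carrier A"
    have "sweedler E x (\<lambda>p q. counit A (q \<otimes>\<^bsub>A\<^esub> a) \<odot>\<^bsub>E\<^esub> counit_act p) b =
        sweedler (ground_space K) x (\<lambda>p q. (counit A (q \<otimes>\<^bsub>A\<^esub> a) \<odot>\<^bsub>E\<^esub> counit_act p) b)"
      by (rule hom_sweedler[OF counit_rep_vectorspace
            vectorspace_ground_space[OF vectorspace_axioms] x eval_hom[OF b] closed])
    also have "\<dots> = sweedler K x (\<lambda>p q. counit A (b \<otimes>\<^bsub>A\<^esub> p) \<otimes>\<^bsub>K\<^esub> counit A (q \<otimes>\<^bsub>A\<^esub> a))"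
      unfolding tens_lift_ground_space
      by (rule sweedler_cong[OF x])
        (simp add: counit_rep_simps(4) b a counit_act_apply counit_closed R.m_comm)
    also have "\<dots> = counit A (b \<otimes>\<^bsub>A\<^esub> x \<otimes>\<^bsub>A\<^esub> a)"
      using assms b by (simp add: left_monoidal_def)
    finally show "sweedler E x (\<lambda>p q. counit A (q \<otimes>\<^bsub>A\<^esub> a) \<odot>\<^bsub>E\<^esub> counit_act p) b =
        counit_act (x \<otimes>\<^bsub>A\<^esub> a) b"
      using b x a by (simp add: counit_act_apply alg.m_assoc)
  qed
qed

lemma right_monoidal_counit_act:
  assumes "right_monoidal K A" and x: "x \<in> carrier A" and a: "a \<in> carrier A"
  shows "sweedler E x (\<lambda>p q. counit A (p \<otimes>\<^bsub>A\<^esub> a) \<odot>\<^bsub>E\<^esub> counit_act q) = counit_act (x \<otimes>\<^bsub>A\<^esub> a)"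
proof -
  interpret E: vectorspace K E by (rule counit_rep_vectorspace)
  have closed: "counit A (p \<otimes>\<^bsub>A\<^esub> a) \<odot>\<^bsub>E\<^esub> counit_act q \<in> carrier E"
    if "p \<in> carrier A" "q \<in> carrier A" for p q
    using that a by (simp add: counit_closed counit_act_closed)
  show ?thesis
  proof (rule counit_rep_eqI)
    show "sweedler E x (\<lambda>p q. counit A (p \<otimes>\<^bsub>A\<^esub> a) \<odot>\<^bsub>E\<^esub> counit_act q) \<in> carrier E"
      by (rule sweedler_closed[OF counit_rep_vectorspace x closed])
    show "counit_act (x \<otimes>\<^bsub>A\<^esub> a) \<in> carrier E" using x a by (simp add: counit_act_closed)
    fix b assume b: "b \<in> carrier A"
    have "sweedler E x (\<lambda>p q. counit A (p \<otimes>\<^bsub>A\<^esub> a) \<odot>\<^bsub>E\<^esub> counit_act q) b =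
        sweedler (ground_space K) x (\<lambda>p q. (counit A (p \<otimes>\<^bsub>A\<^esub> a) \<odot>\<^bsub>E\<^esub> counit_act q) b)"
      by (rule hom_sweedler[OF counit_rep_vectorspace
            vectorspace_ground_space[OF vectorspace_axioms] x eval_hom[OF b] closed])
    also have "\<dots> = sweedler K x (\<lambda>p q. counit A (b \<otimes>\<^bsub>A\<^esub> q) \<otimes>\<^bsub>K\<^esub> counit A (p \<otimes>\<^bsub>A\<^esub> a))"
      unfolding tens_lift_ground_space
      by (rule sweedler_cong[OF x])
        (simp add: counit_rep_simps(4) b a counit_act_apply counit_closed R.m_comm)
    also have "\<dots> = counit A (b \<otimes>\<^bsub>A\<^esub> x \<otimes>\<^bsub>A\<^esub> a)"
      using assms b by (simp add: right_monoidal_def)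
    finally show "sweedler E x (\<lambda>p q. counit A (p \<otimes>\<^bsub>A\<^esub> a) \<odot>\<^bsub>E\<^esub> counit_act q) b =
        counit_act (x \<otimes>\<^bsub>A\<^esub> a) b"
      using b x a by (simp add: counit_act_apply alg.m_assoc)
  qed
qed

text \<open>
  For \<open>\<beta> x y = (x \<rightharpoonup> \<epsilon>) \<otimes> y v\<close>, the hypothesis \<open>left\<close> is left monoidality in
  \<open>sweedler_translate_right\<close> and right monoidality in \<open>sweedler_absorb_left\<close>. For
  \<open>\<beta> x y = x v \<otimes> (y \<rightharpoonup> \<epsilon>)\<close>, the hypothesis \<open>right\<close> is right monoidality in
  \<open>sweedler_translate_left\<close> and left monoidality in \<open>sweedler_absorb_right\<close>.
\<close>

context
  fixes U :: "('k, 'u, 'z) module_scheme" and \<beta> :: "'a \<Rightarrow> 'a \<Rightarrow> 'u" and b a :: 'a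
  assumes U: "vectorspace K U" and \<beta>: "bilinear_map K A A U \<beta>"
    and b: "b \<in> carrier A" and a: "a \<in> carrier A"
begin

interpretation U: vectorspace K U by (rule U)

lemma counit_mult_smult_hom:
  "c \<in> carrier A \<Longrightarrow> u \<in> carrier U \<Longrightarrow> (\<lambda>x. counit A (x \<otimes>\<^bsub>A\<^esub> c) \<odot>\<^bsub>U\<^esub> u) \<in> module_hom K A U"
  using module_hom_comp[OF module_hom_comp[OF mult_hom_left counit_linear]
      bilinear_map_left[OF smult_bilinear[OF U]]] .

lemma sweedler_translate_right:
  assumes left: "\<And>x y a. x \<in> carrier A \<Longrightarrow> y \<in> carrier A \<Longrightarrow> a \<in> carrier A \<Longrightarrow>
    sweedler U x (\<lambda>p q. counit A (q \<otimes>\<^bsub>A\<^esub> a) \<odot>\<^bsub>U\<^esub> \<beta> p y) = \<beta> (x \<otimes>\<^bsub>A\<^esub> a) y"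
  shows "sweedler U b (\<lambda>x y. \<beta> x (y \<otimes>\<^bsub>A\<^esub> a)) = sweedler U (b \<otimes>\<^bsub>A\<^esub> a) \<beta>"
proof -
  let ?\<gamma> = "\<lambda>x y z. sweedler U a (\<lambda>a1 a2. counit A (y \<otimes>\<^bsub>A\<^esub> a1) \<odot>\<^bsub>U\<^esub> \<beta> x (z \<otimes>\<^bsub>A\<^esub> a2))"
  note im = bilinear_map_im[OF \<beta>]
  have "sweedler U b (\<lambda>x y. \<beta> x (y \<otimes>\<^bsub>A\<^esub> a)) = sweedler U b (\<lambda>x y. sweedler U y (?\<gamma> x))"
  proof (rule sweedler_cong[OF b])
    fix x y assume x: "x \<in> carrier A" and y: "y \<in> carrier A"
    have "bilinear_map K A A U (\<lambda>p q. counit A p \<odot>\<^bsub>U\<^esub> \<beta> x q)"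
      by (rule bilinear_map_comp[OF smult_bilinear[OF U] counit_linear bilinear_map_right[OF \<beta> x]])
    from sweedler_mult[OF U this y a]
    show "\<beta> x (y \<otimes>\<^bsub>A\<^esub> a) = sweedler U y (?\<gamma> x)"
      using sweedler_counit_left[OF U _ bilinear_map_right[OF \<beta> x], of "y \<otimes>\<^bsub>A\<^esub> a"] y a by simp
  qed
  also have "\<dots> = sweedler U b (\<lambda>x y. sweedler U x (\<lambda>x1 x2. ?\<gamma> x1 x2 y))"
    by (rule sweedler_coassoc[OF U b, symmetric]; rule sweedler_hom_parameter[OF U a])
      (intro vectorspace_smult_hom[OF U] counit_mult_smult_hom bilinear_map_left[OF \<beta>] counit_closed
        alg.m_closed im module_hom_comp[OF mult_hom_left bilinear_map_right[OF \<beta>]]; assumption)+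
  also have "\<dots> = sweedler U b (\<lambda>x y. sweedler U a (\<lambda>a1 a2. \<beta> (x \<otimes>\<^bsub>A\<^esub> a1) (y \<otimes>\<^bsub>A\<^esub> a2)))"
  proof (rule sweedler_cong[OF b])
    fix x y assume x: "x \<in> carrier A" and y: "y \<in> carrier A"
    have "sweedler U x (\<lambda>x1 x2. ?\<gamma> x1 x2 y) = sweedler U a (\<lambda>a1 a2.
        sweedler U x (\<lambda>x1 x2. counit A (x2 \<otimes>\<^bsub>A\<^esub> a1) \<odot>\<^bsub>U\<^esub> \<beta> x1 (y \<otimes>\<^bsub>A\<^esub> a2)))"
      by (rule sweedler_swap[OF U x a]) (simp add: counit_closed im y)
    also have "\<dots> = sweedler U a (\<lambda>a1 a2. \<beta> (x \<otimes>\<^bsub>A\<^esub> a1) (y \<otimes>\<^bsub>A\<^esub> a2))"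
      by (rule sweedler_cong[OF a]) (simp add: left x y)
    finally show "sweedler U x (\<lambda>x1 x2. ?\<gamma> x1 x2 y) =
        sweedler U a (\<lambda>a1 a2. \<beta> (x \<otimes>\<^bsub>A\<^esub> a1) (y \<otimes>\<^bsub>A\<^esub> a2))" .
  qed
  also have "\<dots> = sweedler U (b \<otimes>\<^bsub>A\<^esub> a) \<beta>"
    by (rule sweedler_mult[OF U \<beta> b a, symmetric])
  finally show ?thesis .
qed

lemma sweedler_translate_left:
  assumes right: "\<And>x y a. x \<in> carrier A \<Longrightarrow> y \<in> carrier A \<Longrightarrow> a \<in> carrier A \<Longrightarrow>
    sweedler U y (\<lambda>p q. counit A (p \<otimes>\<^bsub>A\<^esub> a) \<odot>\<^bsub>U\<^esub> \<beta> x q) = \<beta> x (y \<otimes>\<^bsub>A\<^esub> a)"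
  shows "sweedler U b (\<lambda>x y. \<beta> (x \<otimes>\<^bsub>A\<^esub> a) y) = sweedler U (b \<otimes>\<^bsub>A\<^esub> a) \<beta>"
proof -
  let ?\<gamma> = "\<lambda>x y z. sweedler U a (\<lambda>a1 a2. counit A (y \<otimes>\<^bsub>A\<^esub> a2) \<odot>\<^bsub>U\<^esub> \<beta> (x \<otimes>\<^bsub>A\<^esub> a1) z)"
  note im = bilinear_map_im[OF \<beta>]
  have "sweedler U b (\<lambda>x y. \<beta> (x \<otimes>\<^bsub>A\<^esub> a) y) = sweedler U b (\<lambda>x y. sweedler U x (\<lambda>x1 x2. ?\<gamma> x1 x2 y))"
  proof (rule sweedler_cong[OF b])
    fix x y assume x: "x \<in> carrier A" and y: "y \<in> carrier A"
    have "bilinear_map K A A U (\<lambda>p q. counit A q \<odot>\<^bsub>U\<^esub> \<beta> p y)"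
      by (rule bilinear_map_flip)
        (rule bilinear_map_comp[OF smult_bilinear[OF U] counit_linear bilinear_map_left[OF \<beta> y]])
    from sweedler_mult[OF U this x a]
    show "\<beta> (x \<otimes>\<^bsub>A\<^esub> a) y = sweedler U x (\<lambda>x1 x2. ?\<gamma> x1 x2 y)"
      using sweedler_counit_right[OF U _ bilinear_map_left[OF \<beta> y], of "x \<otimes>\<^bsub>A\<^esub> a"] x a by simp
  qed
  also have "\<dots> = sweedler U b (\<lambda>x y. sweedler U y (?\<gamma> x))"
    by (rule sweedler_coassoc[OF U b]; rule sweedler_hom_parameter[OF U a])
      (intro vectorspace_smult_hom[OF U] counit_mult_smult_hom bilinear_map_right[OF \<beta>] counit_closed
        alg.m_closed im module_hom_comp[OF mult_hom_left bilinear_map_left[OF \<beta>]]; assumption)+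
  also have "\<dots> = sweedler U b (\<lambda>x y. sweedler U a (\<lambda>a1 a2. \<beta> (x \<otimes>\<^bsub>A\<^esub> a1) (y \<otimes>\<^bsub>A\<^esub> a2)))"
  proof (rule sweedler_cong[OF b])
    fix x y assume x: "x \<in> carrier A" and y: "y \<in> carrier A"
    have "sweedler U y (?\<gamma> x) = sweedler U a (\<lambda>a1 a2.
        sweedler U y (\<lambda>y1 y2. counit A (y1 \<otimes>\<^bsub>A\<^esub> a2) \<odot>\<^bsub>U\<^esub> \<beta> (x \<otimes>\<^bsub>A\<^esub> a1) y2))"
      by (rule sweedler_swap[OF U y a]) (simp add: counit_closed im x)
    also have "\<dots> = sweedler U a (\<lambda>a1 a2. \<beta> (x \<otimes>\<^bsub>A\<^esub> a1) (y \<otimes>\<^bsub>A\<^esub> a2))"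
      by (rule sweedler_cong[OF a]) (simp add: right x y)
    finally show "sweedler U y (?\<gamma> x) =
        sweedler U a (\<lambda>a1 a2. \<beta> (x \<otimes>\<^bsub>A\<^esub> a1) (y \<otimes>\<^bsub>A\<^esub> a2))" .
  qed
  also have "\<dots> = sweedler U (b \<otimes>\<^bsub>A\<^esub> a) \<beta>"
    by (rule sweedler_mult[OF U \<beta> b a, symmetric])
  finally show ?thesis .
qed

lemma sweedler_absorb_left:
  assumes left: "\<And>x y. x \<in> carrier A \<Longrightarrow> y \<in> carrier A \<Longrightarrow>
    sweedler U x (\<lambda>p q. counit A (p \<otimes>\<^bsub>A\<^esub> a) \<odot>\<^bsub>U\<^esub> \<beta> q y) = \<beta> (x \<otimes>\<^bsub>A\<^esub> a) y"
  shows "sweedler U b (\<lambda>x y. counit A (x \<otimes>\<^bsub>A\<^esub> a) \<odot>\<^bsub>U\<^esub> sweedler U y \<beta>) =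
    sweedler U b (\<lambda>x y. \<beta> (x \<otimes>\<^bsub>A\<^esub> a) y)"
proof -
  let ?\<gamma> = "\<lambda>x y z. counit A (x \<otimes>\<^bsub>A\<^esub> a) \<odot>\<^bsub>U\<^esub> \<beta> y z"
  note im = bilinear_map_im[OF \<beta>]
  have "sweedler U b (\<lambda>x y. counit A (x \<otimes>\<^bsub>A\<^esub> a) \<odot>\<^bsub>U\<^esub> sweedler U y \<beta>) =
      sweedler U b (\<lambda>x y. sweedler U y (?\<gamma> x))"
    by (rule sweedler_cong[OF b], rule hom_sweedler[OF U U _ vectorspace_smult_hom[OF U module_hom_id]])
      (simp_all add: im counit_closed a)
  also have "\<dots> = sweedler U b (\<lambda>x y. sweedler U x (\<lambda>x1 x2. ?\<gamma> x1 x2 y))"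
    by (rule sweedler_coassoc[OF U b, symmetric])
      (intro vectorspace_smult_hom[OF U] counit_mult_smult_hom[OF a] counit_closed alg.m_closed a im
        bilinear_map_left[OF \<beta>] bilinear_map_right[OF \<beta>]; assumption)+
  also have "\<dots> = sweedler U b (\<lambda>x y. \<beta> (x \<otimes>\<^bsub>A\<^esub> a) y)"
    by (rule sweedler_cong[OF b]) (simp add: left)
  finally show ?thesis .
qed

lemma sweedler_absorb_right:
  assumes right: "\<And>x y. x \<in> carrier A \<Longrightarrow> y \<in> carrier A \<Longrightarrow>
    sweedler U y (\<lambda>p q. counit A (q \<otimes>\<^bsub>A\<^esub> a) \<odot>\<^bsub>U\<^esub> \<beta> x p) = \<beta> x (y \<otimes>\<^bsub>A\<^esub> a)"
  shows "sweedler U b (\<lambda>x y. counit A (y \<otimes>\<^bsub>A\<^esub> a) \<odot>\<^bsub>U\<^esub> sweedler U x \<beta>) =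
    sweedler U b (\<lambda>x y. \<beta> x (y \<otimes>\<^bsub>A\<^esub> a))"
proof -
  let ?\<gamma> = "\<lambda>x y z. counit A (z \<otimes>\<^bsub>A\<^esub> a) \<odot>\<^bsub>U\<^esub> \<beta> x y"
  note im = bilinear_map_im[OF \<beta>]
  have "sweedler U b (\<lambda>x y. counit A (y \<otimes>\<^bsub>A\<^esub> a) \<odot>\<^bsub>U\<^esub> sweedler U x \<beta>) =
      sweedler U b (\<lambda>x y. sweedler U x (\<lambda>x1 x2. ?\<gamma> x1 x2 y))"
    by (rule sweedler_cong[OF b], rule hom_sweedler[OF U U _ vectorspace_smult_hom[OF U module_hom_id]])
      (simp_all add: im counit_closed a)
  also have "\<dots> = sweedler U b (\<lambda>x y. sweedler U y (?\<gamma> x))"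
    by (rule sweedler_coassoc[OF U b])
      (intro vectorspace_smult_hom[OF U] counit_mult_smult_hom[OF a] counit_closed alg.m_closed a im
        bilinear_map_left[OF \<beta>] bilinear_map_right[OF \<beta>]; assumption)+
  also have "\<dots> = sweedler U b (\<lambda>x y. \<beta> x (y \<otimes>\<^bsub>A\<^esub> a))"
    by (rule sweedler_cong[OF b]) (simp add: right)
  finally show ?thesis .
qed

end

section \<open>The unit maps\<close>

context
  fixes V :: "('k, 'v, 'a, 'y) rep_scheme"
  assumes V: "alg_module K A V"
begin

interpretation V: alg_module K A V by (rule V)
interpretation E: alg_module K A E by (rule counit_rep_alg_module)
interpretation EV: tensor_pair K E V
  by (intro tensor_pair.intro V.vectorspace_axioms E.vectorspace_axioms)
interpretation VE: tensor_pair K V E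
  by (intro tensor_pair.intro V.vectorspace_axioms E.vectorspace_axioms)

lemma tens_counit_act_left_bilinear:
  assumes "v \<in> carrier V"
  shows "bilinear_map K A A (tensor K E V) (\<lambda>x y. tens K E V (counit_act x) (act V y v))"
  by (rule bilinear_map_comp[OF EV.tens_bilinear counit_act_hom V.act_hom_left[OF assms]])

lemma tens_counit_act_right_bilinear:
  assumes "v \<in> carrier V"
  shows "bilinear_map K A A (tensor K V E) (\<lambda>x y. tens K V E (act V x v) (counit_act y))"
  by (rule bilinear_map_comp[OF VE.tens_bilinear V.act_hom_left[OF assms] counit_act_hom])

lemma tens_act_counit_act_left:
  assumes "a \<in> carrier A" "x \<in> carrier A" "v \<in> carrier V"
  shows "tens_act' E V a (tens K E V (counit_act x) v) =
    sweedler (tensor K E V) a (\<lambda>p q. tens K E V (counit_act (p \<otimes>\<^bsub>A\<^esub> x)) (act V q v))"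
  unfolding tens_act_tens[OF E.alg_module_axioms V assms(1) counit_act_closed[OF assms(2)] assms(3)]
  by (rule sweedler_cong[OF assms(1)]) (simp add: act_counit_act assms)

lemma tens_act_counit_act_right:
  assumes "a \<in> carrier A" "x \<in> carrier A" "v \<in> carrier V"
  shows "tens_act' V E a (tens K V E v (counit_act x)) =
    sweedler (tensor K V E) a (\<lambda>p q. tens K V E (act V p v) (counit_act (q \<otimes>\<^bsub>A\<^esub> x)))"
  unfolding tens_act_tens[OF V E.alg_module_axioms assms(1) assms(3) counit_act_closed[OF assms(2)]]
  by (rule sweedler_cong[OF assms(1)]) (simp add: act_counit_act assms)

lemma left_unit_map_eq:
  assumes "v \<in> carrier V"
  shows "left_unit_map K A V v = tens_act' E V \<one>\<^bsub>A\<^esub> (tens K E V (counit_act \<one>\<^bsub>A\<^esub>) v)"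
  unfolding left_unit_map_def tens_act_counit_act_left[OF alg.one_closed alg.one_closed assms]
  by (rule sweedler_cong) auto

lemma right_unit_map_eq:
  assumes "v \<in> carrier V"
  shows "right_unit_map K A V v = tens_act' V E \<one>\<^bsub>A\<^esub> (tens K V E v (counit_act \<one>\<^bsub>A\<^esub>))"
  unfolding right_unit_map_def tens_act_counit_act_right[OF alg.one_closed alg.one_closed assms]
  by (rule sweedler_cong) auto

lemma left_unit_map_hom: "left_unit_map K A V \<in> module_hom K V (rep_prod K A E V)"
proof -
  note hom = module_hom_comp[OF bilinear_map_right[OF EV.tens_bilinear counit_act_closed[OF alg.one_closed]]
      bilinear_map_right[OF tens_act_bilinear[OF E.alg_module_axioms V] alg.one_closed]]
  have "(\<lambda>v. tens_act' E V \<one>\<^bsub>A\<^esub> (tens K E V (counit_act \<one>\<^bsub>A\<^esub>) v)) \<in> module_hom K V (rep_prod K A E V)"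
    by (rule hom_into_rep_prod[OF E.alg_module_axioms V hom])
      (simp add: tens_act_in_rep_prod[OF E.alg_module_axioms V] EV.tens_closed counit_act_closed)
  then show ?thesis
    by (rule module_hom_cong[OF V.vectorspace_axioms]) (rule left_unit_map_eq)
qed

lemma right_unit_map_hom: "right_unit_map K A V \<in> module_hom K V (rep_prod K A V E)"
proof -
  note hom = module_hom_comp[OF bilinear_map_left[OF VE.tens_bilinear counit_act_closed[OF alg.one_closed]]
      bilinear_map_right[OF tens_act_bilinear[OF V E.alg_module_axioms] alg.one_closed]]
  have "(\<lambda>v. tens_act' V E \<one>\<^bsub>A\<^esub> (tens K V E v (counit_act \<one>\<^bsub>A\<^esub>))) \<in> module_hom K V (rep_prod K A V E)"
    by (rule hom_into_rep_prod[OF V E.alg_module_axioms hom])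
      (simp add: tens_act_in_rep_prod[OF V E.alg_module_axioms] VE.tens_closed counit_act_closed)
  then show ?thesis
    by (rule module_hom_cong[OF V.vectorspace_axioms]) (rule right_unit_map_eq)
qed

lemma tens_act_left_unit_map:
  assumes "a \<in> carrier A" "v \<in> carrier V"
  shows "tens_act' E V a (left_unit_map K A V v) =
    sweedler (tensor K E V) a (\<lambda>x y. tens K E V (counit_act x) (act V y v))"
proof -
  have "tens_act' E V a (left_unit_map K A V v) = tens_act' E V a (tens K E V (counit_act \<one>\<^bsub>A\<^esub>) v)"
    using tens_act_mult[OF E.alg_module_axioms V assms(1) alg.one_closed, of "tens K E V (counit_act \<one>\<^bsub>A\<^esub>) v"]
      assms by (simp add: left_unit_map_eq EV.tens_closed counit_act_closed)
  also have "\<dots> = sweedler (tensor K E V) a (\<lambda>x y. tens K E V (counit_act x) (act V y v))"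
    unfolding tens_act_counit_act_left[OF assms(1) alg.one_closed assms(2)]
    by (rule sweedler_cong[OF assms(1)]) simp
  finally show ?thesis .
qed

lemma tens_act_right_unit_map:
  assumes "a \<in> carrier A" "v \<in> carrier V"
  shows "tens_act' V E a (right_unit_map K A V v) =
    sweedler (tensor K V E) a (\<lambda>x y. tens K V E (act V x v) (counit_act y))"
proof -
  have "tens_act' V E a (right_unit_map K A V v) = tens_act' V E a (tens K V E v (counit_act \<one>\<^bsub>A\<^esub>))"
    using tens_act_mult[OF V E.alg_module_axioms assms(1) alg.one_closed, of "tens K V E v (counit_act \<one>\<^bsub>A\<^esub>)"]
      assms by (simp add: right_unit_map_eq VE.tens_closed counit_act_closed)
  also have "\<dots> = sweedler (tensor K V E) a (\<lambda>x y. tens K V E (act V x v) (counit_act y))"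
    unfolding tens_act_counit_act_right[OF assms(1) alg.one_closed assms(2)]
    by (rule sweedler_cong[OF assms(1)]) simp
  finally show ?thesis .
qed

lemma left_monoidal_tens:
  assumes lm: "left_monoidal K A"
    and x: "x \<in> carrier A" and a: "a \<in> carrier A" and v: "v \<in> carrier V"
  shows "sweedler (tensor K E V) x (\<lambda>p q. counit A (q \<otimes>\<^bsub>A\<^esub> a) \<odot>\<^bsub>tensor K E V\<^esub> tens K E V (counit_act p) v) =
      tens K E V (counit_act (x \<otimes>\<^bsub>A\<^esub> a)) v" (is ?E)
    and "sweedler (tensor K V E) x (\<lambda>p q. counit A (q \<otimes>\<^bsub>A\<^esub> a) \<odot>\<^bsub>tensor K V E\<^esub> tens K V E v (counit_act p)) =
      tens K V E v (counit_act (x \<otimes>\<^bsub>A\<^esub> a))" (is ?V)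
proof -
  have closed: "counit A (q \<otimes>\<^bsub>A\<^esub> a) \<odot>\<^bsub>E\<^esub> counit_act p \<in> carrier E"
    if "p \<in> carrier A" "q \<in> carrier A" for p q
    using that a by (simp add: counit_closed counit_act_closed)
  note EVh = bilinear_map_left[OF EV.tens_bilinear v]
  note VEh = bilinear_map_right[OF VE.tens_bilinear v]
  have "tens K E V (counit_act (x \<otimes>\<^bsub>A\<^esub> a)) v = tens K E V 
      (sweedler E x (\<lambda>p q. counit A (q \<otimes>\<^bsub>A\<^esub> a) \<odot>\<^bsub>E\<^esub> counit_act p)) v"
    by (simp only: left_monoidal_counit_act[OF lm x a])
  also have "\<dots> = sweedler (tensor K E V) x (\<lambda>p q.
      tens K E V (counit A (q \<otimes>\<^bsub>A\<^esub> a) \<odot>\<^bsub>E\<^esub> counit_act p) v)"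
    by (rule hom_sweedler[OF E.vectorspace_axioms EV.tensor_vectorspace x EVh closed])
  also have "\<dots> = sweedler (tensor K E V) x (\<lambda>p q.
      counit A (q \<otimes>\<^bsub>A\<^esub> a) \<odot>\<^bsub>tensor K E V\<^esub> tens K E V (counit_act p) v)"
    by (rule sweedler_cong[OF x]) (simp add: module_hom_smult[OF EVh] counit_closed counit_act_closed a)
  finally show ?E ..
  have "tens K V E v (counit_act (x \<otimes>\<^bsub>A\<^esub> a)) = tens K V E v 
      (sweedler E x (\<lambda>p q. counit A (q \<otimes>\<^bsub>A\<^esub> a) \<odot>\<^bsub>E\<^esub> counit_act p))"
    by (simp only: left_monoidal_counit_act[OF lm x a])
  also have "\<dots> = sweedler (tensor K V E) x (\<lambda>p q.
      tens K V E v (counit A (q \<otimes>\<^bsub>A\<^esub> a) \<odot>\<^bsub>E\<^esub> counit_act p))"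
    by (rule hom_sweedler[OF E.vectorspace_axioms VE.tensor_vectorspace x VEh closed])
  also have "\<dots> = sweedler (tensor K V E) x (\<lambda>p q.
      counit A (q \<otimes>\<^bsub>A\<^esub> a) \<odot>\<^bsub>tensor K V E\<^esub> tens K V E v (counit_act p))"
    by (rule sweedler_cong[OF x]) (simp add: module_hom_smult[OF VEh] counit_closed counit_act_closed a)
  finally show ?V ..
qed

lemma right_monoidal_tens:
  assumes rm: "right_monoidal K A"
    and x: "x \<in> carrier A" and a: "a \<in> carrier A" and v: "v \<in> carrier V"
  shows "sweedler (tensor K E V) x (\<lambda>p q. counit A (p \<otimes>\<^bsub>A\<^esub> a) \<odot>\<^bsub>tensor K E V\<^esub> tens K E V (counit_act q) v) =
      tens K E V (counit_act (x \<otimes>\<^bsub>A\<^esub> a)) v" (is ?E)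
    and "sweedler (tensor K V E) x (\<lambda>p q. counit A (p \<otimes>\<^bsub>A\<^esub> a) \<odot>\<^bsub>tensor K V E\<^esub> tens K V E v (counit_act q)) =
      tens K V E v (counit_act (x \<otimes>\<^bsub>A\<^esub> a))" (is ?V)
proof -
  have closed: "counit A (p \<otimes>\<^bsub>A\<^esub> a) \<odot>\<^bsub>E\<^esub> counit_act q \<in> carrier E"
    if "p \<in> carrier A" "q \<in> carrier A" for p q
    using that a by (simp add: counit_closed counit_act_closed)
  note EVh = bilinear_map_left[OF EV.tens_bilinear v]
  note VEh = bilinear_map_right[OF VE.tens_bilinear v]
  have "tens K E V (counit_act (x \<otimes>\<^bsub>A\<^esub> a)) v = tens K E V 
      (sweedler E x (\<lambda>p q. counit A (p \<otimes>\<^bsub>A\<^esub> a) \<odot>\<^bsub>E\<^esub> counit_act q)) v"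
    by (simp only: right_monoidal_counit_act[OF rm x a])
  also have "\<dots> = sweedler (tensor K E V) x (\<lambda>p q.
      tens K E V (counit A (p \<otimes>\<^bsub>A\<^esub> a) \<odot>\<^bsub>E\<^esub> counit_act q) v)"
    by (rule hom_sweedler[OF E.vectorspace_axioms EV.tensor_vectorspace x EVh closed])
  also have "\<dots> = sweedler (tensor K E V) x (\<lambda>p q.
      counit A (p \<otimes>\<^bsub>A\<^esub> a) \<odot>\<^bsub>tensor K E V\<^esub> tens K E V (counit_act q) v)"
    by (rule sweedler_cong[OF x]) (simp add: module_hom_smult[OF EVh] counit_closed counit_act_closed a)
  finally show ?E ..
  have "tens K V E v (counit_act (x \<otimes>\<^bsub>A\<^esub> a)) = tens K V E v 
      (sweedler E x (\<lambda>p q. counit A (p \<otimes>\<^bsub>A\<^esub> a) \<odot>\<^bsub>E\<^esub> counit_act q))"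
    by (simp only: right_monoidal_counit_act[OF rm x a])
  also have "\<dots> = sweedler (tensor K V E) x (\<lambda>p q.
      tens K V E v (counit A (p \<otimes>\<^bsub>A\<^esub> a) \<odot>\<^bsub>E\<^esub> counit_act q))"
    by (rule hom_sweedler[OF E.vectorspace_axioms VE.tensor_vectorspace x VEh closed])
  also have "\<dots> = sweedler (tensor K V E) x (\<lambda>p q.
      counit A (p \<otimes>\<^bsub>A\<^esub> a) \<odot>\<^bsub>tensor K V E\<^esub> tens K V E v (counit_act q))"
    by (rule sweedler_cong[OF x]) (simp add: module_hom_smult[OF VEh] counit_closed counit_act_closed a)
  finally show ?V ..
qed

lemma left_unit_map_act:
  assumes "left_monoidal K A" and a: "a \<in> carrier A" and v: "v \<in> carrier V"
  shows "left_unit_map K A V (act V a v) =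
    sweedler (tensor K E V) a (\<lambda>x y. tens K E V (counit_act x) (act V y v))"
proof -
  have "left_unit_map K A V (act V a v) =
      sweedler (tensor K E V) \<one>\<^bsub>A\<^esub> (\<lambda>x y. tens K E V (counit_act x) (act V (y \<otimes>\<^bsub>A\<^esub> a) v))"
    unfolding left_unit_map_def by (rule sweedler_cong) (simp_all add: V.act_mult a v)
  also have "\<dots> = sweedler (tensor K E V) (\<one>\<^bsub>A\<^esub> \<otimes>\<^bsub>A\<^esub> a) (\<lambda>x y. tens K E V (counit_act x) (act V y v))"
    by (rule sweedler_translate_right[OF EV.tensor_vectorspace tens_counit_act_left_bilinear[OF v]
          alg.one_closed a left_monoidal_tens(1)[OF assms(1)]]) (simp_all add: V.act_closed v)
  finally show ?thesis using a by simp
qed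

lemma right_unit_map_act:
  assumes "right_monoidal K A" and a: "a \<in> carrier A" and v: "v \<in> carrier V"
  shows "right_unit_map K A V (act V a v) =
    sweedler (tensor K V E) a (\<lambda>x y. tens K V E (act V x v) (counit_act y))"
proof -
  have "right_unit_map K A V (act V a v) =
      sweedler (tensor K V E) \<one>\<^bsub>A\<^esub> (\<lambda>x y. tens K V E (act V (x \<otimes>\<^bsub>A\<^esub> a) v) (counit_act y))"
    unfolding right_unit_map_def by (rule sweedler_cong) (simp_all add: V.act_mult a v)
  also have "\<dots> = sweedler (tensor K V E) (\<one>\<^bsub>A\<^esub> \<otimes>\<^bsub>A\<^esub> a) (\<lambda>x y. tens K V E (act V x v) (counit_act y))"
    by (rule sweedler_translate_left[OF VE.tensor_vectorspace tens_counit_act_right_bilinear[OF v]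
          alg.one_closed a right_monoidal_tens(2)[OF assms(1)]]) (simp_all add: V.act_closed v)
  finally show ?thesis using a by simp
qed

lemma left_unit_map_rep_hom:
  "left_monoidal K A \<Longrightarrow> left_unit_map K A V \<in> rep_hom K A V (rep_prod K A E V)"
  by (simp add: rep_hom_def left_unit_map_hom left_unit_map_act tens_act_left_unit_map
      rep_prod_simps(5)[OF E.alg_module_axioms V])

lemma right_unit_map_rep_hom:
  "right_monoidal K A \<Longrightarrow> right_unit_map K A V \<in> rep_hom K A V (rep_prod K A V E)"
  by (simp add: rep_hom_def right_unit_map_hom right_unit_map_act tens_act_right_unit_map
      rep_prod_simps(5)[OF V E.alg_module_axioms])

end

section \<open>Bijectivity\<close>

context
  fixes V :: "('k, 'v, 'a, 'y) rep_scheme"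
  assumes V: "alg_module K A V"
begin

interpretation V: alg_module K A V by (rule V)
interpretation E: alg_module K A E by (rule counit_rep_alg_module)
interpretation EV: tensor_pair K E V
  by (intro tensor_pair.intro V.vectorspace_axioms E.vectorspace_axioms)
interpretation VE: tensor_pair K V E
  by (intro tensor_pair.intro V.vectorspace_axioms E.vectorspace_axioms)

lemma left_unit_map_tensor_hom: "left_unit_map K A V \<in> module_hom K V (tensor K E V)"
  by (rule module_hom_comp[OF left_unit_map_hom[OF V] rep_prod_incl[OF E.alg_module_axioms V]])

lemma right_unit_map_tensor_hom: "right_unit_map K A V \<in> module_hom K V (tensor K V E)"
  by (rule module_hom_comp[OF right_unit_map_hom[OF V] rep_prod_incl[OF V E.alg_module_axioms]])

lemma left_unit_map_inj: "inj_on (left_unit_map K A V) (carrier V)"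
proof (rule inj_on_inverseI)
  fix v assume v: "v \<in> carrier V"
  have bil: "bilinear_map K E V V (\<lambda>\<phi> v. \<phi> \<one>\<^bsub>A\<^esub> \<odot>\<^bsub>V\<^esub> v)"
    by (rule bilinear_map_comp[OF smult_bilinear[OF V.vectorspace_axioms]
          eval_hom[OF alg.one_closed] module_hom_id])
  have "tens_lift V (\<lambda>\<phi> v. \<phi> \<one>\<^bsub>A\<^esub> \<odot>\<^bsub>V\<^esub> v) (left_unit_map K A V v) = sweedler V \<one>\<^bsub>A\<^esub>
      (\<lambda>x y. tens_lift V (\<lambda>\<phi> v. \<phi> \<one>\<^bsub>A\<^esub> \<odot>\<^bsub>V\<^esub> v) (tens K E V (counit_act x) (act V y v)))"
    unfolding left_unit_map_def
    by (rule hom_sweedler[OF EV.tensor_vectorspace V.vectorspace_axioms alg.one_closed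
          EV.tens_lift_linear[OF V.vectorspace_axioms bil]])
      (simp add: EV.tens_closed counit_act_closed V.act_closed v)
  also have "\<dots> = sweedler V \<one>\<^bsub>A\<^esub> (\<lambda>x y. counit A x \<odot>\<^bsub>V\<^esub> act V y v)"
    by (rule sweedler_cong) (simp_all add: EV.tens_lift_tens[OF V.vectorspace_axioms bil]
        counit_act_closed counit_act_apply V.act_closed v)
  also have "\<dots> = act V \<one>\<^bsub>A\<^esub> v"
    by (rule sweedler_counit_left[OF V.vectorspace_axioms alg.one_closed V.act_hom_left[OF v], symmetric])
  finally show "tens_lift V (\<lambda>\<phi> v. \<phi> \<one>\<^bsub>A\<^esub> \<odot>\<^bsub>V\<^esub> v) (left_unit_map K A V v) = v"
    by (simp add: V.act_one v)
qed

lemma right_unit_map_inj: "inj_on (right_unit_map K A V) (carrier V)"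
proof (rule inj_on_inverseI)
  fix v assume v: "v \<in> carrier V"
  have bil: "bilinear_map K V E V (\<lambda>v \<phi>. \<phi> \<one>\<^bsub>A\<^esub> \<odot>\<^bsub>V\<^esub> v)"
    by (rule bilinear_map_flip, rule bilinear_map_comp[OF smult_bilinear[OF V.vectorspace_axioms]
          eval_hom[OF alg.one_closed] module_hom_id])
  have "tens_lift V (\<lambda>v \<phi>. \<phi> \<one>\<^bsub>A\<^esub> \<odot>\<^bsub>V\<^esub> v) (right_unit_map K A V v) = sweedler V \<one>\<^bsub>A\<^esub>
      (\<lambda>x y. tens_lift V (\<lambda>v \<phi>. \<phi> \<one>\<^bsub>A\<^esub> \<odot>\<^bsub>V\<^esub> v) (tens K V E (act V x v) (counit_act y)))"
    unfolding right_unit_map_def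
    by (rule hom_sweedler[OF VE.tensor_vectorspace V.vectorspace_axioms alg.one_closed
          VE.tens_lift_linear[OF V.vectorspace_axioms bil]])
      (simp add: VE.tens_closed counit_act_closed V.act_closed v)
  also have "\<dots> = sweedler V \<one>\<^bsub>A\<^esub> (\<lambda>x y. counit A y \<odot>\<^bsub>V\<^esub> act V x v)"
    by (rule sweedler_cong) (simp_all add: VE.tens_lift_tens[OF V.vectorspace_axioms bil]
        counit_act_closed counit_act_apply V.act_closed v)
  also have "\<dots> = act V \<one>\<^bsub>A\<^esub> v"
    by (rule sweedler_counit_right[OF V.vectorspace_axioms alg.one_closed V.act_hom_left[OF v], symmetric])
  finally show "tens_lift V (\<lambda>v \<phi>. \<phi> \<one>\<^bsub>A\<^esub> \<odot>\<^bsub>V\<^esub> v) (right_unit_map K A V v) = v"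
    by (simp add: V.act_one v)
qed

lemma left_unit_map_surj:
  assumes lm: "left_monoidal K A" and rm: "right_monoidal K A"
  shows "left_unit_map K A V ` carrier V = carrier (rep_prod K A E V)"
proof
  show "left_unit_map K A V ` carrier V \<subseteq> carrier (rep_prod K A E V)"
    using module_hom_im[OF left_unit_map_hom[OF V]] by blast
  let ?T = "tensor K E V"
  let ?h = "\<lambda>\<phi> v. sweedler V \<one>\<^bsub>A\<^esub> (\<lambda>x y. \<phi> x \<odot>\<^bsub>V\<^esub> act V y v)"
  note L = left_unit_map_tensor_hom
  have eval: "\<phi> x \<in> carrier K" if "\<phi> \<in> carrier E" "x \<in> carrier A" for \<phi> x
    using module_hom_im[OF eval_hom[OF that(2)] that(1)] by (simp add: ground_space_def)
  have bil: "bilinear_map K E V V ?h"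
    by (rule bilinear_mapI; rule sweedler_hom_parameter[OF V.vectorspace_axioms alg.one_closed])
      (rule vectorspace_smult_hom[OF V.vectorspace_axioms V.act_hom], assumption, rule eval, assumption+,
        rule module_hom_comp[OF eval_hom bilinear_map_left[OF smult_bilinear[OF V.vectorspace_axioms]]],
        assumption, rule V.act_closed)
  have h: "tens_lift V ?h \<in> module_hom K ?T V"
    by (rule EV.tens_lift_linear[OF V.vectorspace_axioms bil])
  have L_h: "left_unit_map K A V (tens_lift V ?h s) = tens_act' E V \<one>\<^bsub>A\<^esub> s" if s: "s \<in> carrier ?T" for s
  proof (rule EV.tensor_hom_eqI[OF EV.tensor_vectorspace module_hom_comp[OF h L]
        bilinear_map_right[OF tens_act_bilinear[OF E.alg_module_axioms V] alg.one_closed] _ s])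
    fix \<phi> v assume \<phi>: "\<phi> \<in> carrier E" and v: "v \<in> carrier V"
    obtain a where a: "a \<in> carrier A" and \<phi>_eq: "\<phi> = counit_act a"
      using \<phi> by (auto simp: counit_rep_simps(1))
    have "left_unit_map K A V (tens_lift V ?h (tens K E V \<phi> v)) = left_unit_map K A V (?h \<phi> v)"
      by (simp add: EV.tens_lift_tens[OF V.vectorspace_axioms bil \<phi> v])
    also have "\<dots> = sweedler ?T \<one>\<^bsub>A\<^esub> (\<lambda>x y. left_unit_map K A V (\<phi> x \<odot>\<^bsub>V\<^esub> act V y v))"
      by (rule hom_sweedler[OF V.vectorspace_axioms EV.tensor_vectorspace alg.one_closed L])
        (simp add: eval \<phi> V.act_closed v)
    also have "\<dots> = sweedler ?T \<one>\<^bsub>A\<^esub> (\<lambda>x y. counit A (x \<otimes>\<^bsub>A\<^esub> a) \<odot>\<^bsub>?T\<^esub>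
        sweedler ?T y (\<lambda>x y. tens K E V (counit_act x) (act V y v)))"
      by (rule sweedler_cong) (simp_all add: module_hom_smult[OF L] left_unit_map_act[OF V lm]
          eval V.act_closed v \<phi>_eq counit_act_apply a counit_closed)
    also have "\<dots> = sweedler ?T \<one>\<^bsub>A\<^esub> (\<lambda>x y. tens K E V (counit_act (x \<otimes>\<^bsub>A\<^esub> a)) (act V y v))"
      by (rule sweedler_absorb_left[OF EV.tensor_vectorspace tens_counit_act_left_bilinear[OF V v]
            alg.one_closed a right_monoidal_tens(1)[OF V rm _ a]]) (simp_all add: V.act_closed v)
    also have "\<dots> = tens_act' E V \<one>\<^bsub>A\<^esub> (tens K E V \<phi> v)"
      unfolding \<phi>_eq by (rule tens_act_counit_act_left[OF V alg.one_closed a v, symmetric])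
    finally show "left_unit_map K A V (tens_lift V ?h (tens K E V \<phi> v)) =
        tens_act' E V \<one>\<^bsub>A\<^esub> (tens K E V \<phi> v)" .
  qed
  show "carrier (rep_prod K A E V) \<subseteq> left_unit_map K A V ` carrier V"
  proof
    fix t assume "t \<in> carrier (rep_prod K A E V)"
    then obtain s where s: "s \<in> carrier ?T" and t: "t = tens_act' E V \<one>\<^bsub>A\<^esub> s"
      by (auto simp: rep_prod_simps(1)[OF E.alg_module_axioms V])
    then show "t \<in> left_unit_map K A V ` carrier V"
      using L_h[OF s] module_hom_im[OF h s] by force
  qed
qed

lemma right_unit_map_surj:
  assumes lm: "left_monoidal K A" and rm: "right_monoidal K A"
  shows "right_unit_map K A V ` carrier V = carrier (rep_prod K A V E)"
proof
  show "right_unit_map K A V ` carrier V \<subseteq> carrier (rep_prod K A V E)"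
    using module_hom_im[OF right_unit_map_hom[OF V]] by blast
  let ?T = "tensor K V E"
  let ?h = "\<lambda>v \<phi>. sweedler V \<one>\<^bsub>A\<^esub> (\<lambda>x y. \<phi> y \<odot>\<^bsub>V\<^esub> act V x v)"
  note R = right_unit_map_tensor_hom
  have eval: "\<phi> x \<in> carrier K" if "\<phi> \<in> carrier E" "x \<in> carrier A" for \<phi> x
    using module_hom_im[OF eval_hom[OF that(2)] that(1)] by (simp add: ground_space_def)
  have bil: "bilinear_map K V E V ?h"
    by (rule bilinear_mapI; rule sweedler_hom_parameter[OF V.vectorspace_axioms alg.one_closed])
      (rule module_hom_comp[OF eval_hom bilinear_map_left[OF smult_bilinear[OF V.vectorspace_axioms]]],
        assumption, rule V.act_closed, assumption+,
        rule vectorspace_smult_hom[OF V.vectorspace_axioms V.act_hom], assumption, rule eval)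
  have h: "tens_lift V ?h \<in> module_hom K ?T V"
    by (rule VE.tens_lift_linear[OF V.vectorspace_axioms bil])
  have R_h: "right_unit_map K A V (tens_lift V ?h s) = tens_act' V E \<one>\<^bsub>A\<^esub> s" if s: "s \<in> carrier ?T" for s
  proof (rule VE.tensor_hom_eqI[OF VE.tensor_vectorspace module_hom_comp[OF h R]
        bilinear_map_right[OF tens_act_bilinear[OF V E.alg_module_axioms] alg.one_closed] _ s])
    fix v \<phi> assume v: "v \<in> carrier V" and \<phi>: "\<phi> \<in> carrier E"
    obtain a where a: "a \<in> carrier A" and \<phi>_eq: "\<phi> = counit_act a"
      using \<phi> by (auto simp: counit_rep_simps(1))
    have "right_unit_map K A V (tens_lift V ?h (tens K V E v \<phi>)) = right_unit_map K A V (?h v \<phi>)"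
      by (simp add: VE.tens_lift_tens[OF V.vectorspace_axioms bil v \<phi>])
    also have "\<dots> = sweedler ?T \<one>\<^bsub>A\<^esub> (\<lambda>x y. right_unit_map K A V (\<phi> y \<odot>\<^bsub>V\<^esub> act V x v))"
      by (rule hom_sweedler[OF V.vectorspace_axioms VE.tensor_vectorspace alg.one_closed R])
        (simp add: eval \<phi> V.act_closed v)
    also have "\<dots> = sweedler ?T \<one>\<^bsub>A\<^esub> (\<lambda>x y. counit A (y \<otimes>\<^bsub>A\<^esub> a) \<odot>\<^bsub>?T\<^esub>
        sweedler ?T x (\<lambda>x y. tens K V E (act V x v) (counit_act y)))"
      by (rule sweedler_cong) (simp_all add: module_hom_smult[OF R] right_unit_map_act[OF V rm]
          eval V.act_closed v \<phi>_eq counit_act_apply a counit_closed)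
    also have "\<dots> = sweedler ?T \<one>\<^bsub>A\<^esub> (\<lambda>x y. tens K V E (act V x v) (counit_act (y \<otimes>\<^bsub>A\<^esub> a)))"
      by (rule sweedler_absorb_right[OF VE.tensor_vectorspace tens_counit_act_right_bilinear[OF V v]
            alg.one_closed a left_monoidal_tens(2)[OF V lm _ a]]) (simp_all add: V.act_closed v)
    also have "\<dots> = tens_act' V E \<one>\<^bsub>A\<^esub> (tens K V E v \<phi>)"
      unfolding \<phi>_eq by (rule tens_act_counit_act_right[OF V alg.one_closed a v, symmetric])
    finally show "right_unit_map K A V (tens_lift V ?h (tens K V E v \<phi>)) =
        tens_act' V E \<one>\<^bsub>A\<^esub> (tens K V E v \<phi>)" .
  qed
  show "carrier (rep_prod K A V E) \<subseteq> right_unit_map K A V ` carrier V"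
  proof
    fix t assume "t \<in> carrier (rep_prod K A V E)"
    then obtain s where s: "s \<in> carrier ?T" and t: "t = tens_act' V E \<one>\<^bsub>A\<^esub> s"
      by (auto simp: rep_prod_simps(1)[OF V E.alg_module_axioms])
    then show "t \<in> right_unit_map K A V ` carrier V"
      using R_h[OF s] module_hom_im[OF h s] by force
  qed
qed

section \<open>Equivariance of the unit maps implies monoidality\<close>

context
  fixes \<psi> :: "'v \<Rightarrow> 'a" and v0 :: 'v
  assumes \<psi>: "\<psi> \<in> module_hom K V A"
    and \<psi>_act: "\<And>a v. a \<in> carrier A \<Longrightarrow> v \<in> carrier V \<Longrightarrow> \<psi> (act V a v) = a \<otimes>\<^bsub>A\<^esub> \<psi> v"
    and v0: "v0 \<in> carrier V" and \<psi>_v0: "\<psi> v0 = \<one>\<^bsub>A\<^esub>"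
begin

lemma pairing_bilinear:
  assumes "b \<in> carrier A" "c \<in> carrier A"
  shows "bilinear_map K E V (ground_space K) (\<lambda>\<phi> v. \<phi> b \<otimes>\<^bsub>K\<^esub> counit A (\<psi> v \<otimes>\<^bsub>A\<^esub> c))"
  using bilinear_map_comp[OF smult_bilinear[OF vectorspace_ground_space[OF vectorspace_axioms]] eval_hom[OF assms(1)]
      module_hom_comp[OF module_hom_comp[OF \<psi> mult_hom_left[OF assms(2)]] counit_linear]]
  by (simp add: ground_space_def)

lemma left_monoidal_if_equivariant:
  assumes equiv: "\<And>a. a \<in> carrier A \<Longrightarrow>
    left_unit_map K A V (act V a v0) = tens_act' E V a (left_unit_map K A V v0)"
  shows "left_monoidal K A"
proof -
  note G = vectorspace_ground_space[OF vectorspace_axioms]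
  have eq: "tens_lift K (\<lambda>x y. counit A (b \<otimes>\<^bsub>A\<^esub> x) \<otimes>\<^bsub>K\<^esub> counit A (y \<otimes>\<^bsub>A\<^esub> (a \<otimes>\<^bsub>A\<^esub> c))) (comult A \<one>\<^bsub>A\<^esub>) =
      tens_lift K (\<lambda>x y. counit A (b \<otimes>\<^bsub>A\<^esub> x) \<otimes>\<^bsub>K\<^esub> counit A (y \<otimes>\<^bsub>A\<^esub> c)) (comult A a)"
    if a: "a \<in> carrier A" and b: "b \<in> carrier A" and c: "c \<in> carrier A" for a b c
  proof -
    define f where "f = tens_lift (ground_space K) (\<lambda>\<phi> v. \<phi> b \<otimes>\<^bsub>K\<^esub> counit A (\<psi> v \<otimes>\<^bsub>A\<^esub> c))"
    have f: "f \<in> module_hom K (tensor K E V) (ground_space K)"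
      unfolding f_def by (rule EV.tens_lift_linear[OF G pairing_bilinear[OF b c]])
    have f_sweedler: "f (sweedler (tensor K E V) d (\<lambda>x y. tens K E V (counit_act x) (act V y v))) =
        tens_lift K (\<lambda>x y. counit A (b \<otimes>\<^bsub>A\<^esub> x) \<otimes>\<^bsub>K\<^esub> counit A (y \<otimes>\<^bsub>A\<^esub> (\<psi> v \<otimes>\<^bsub>A\<^esub> c))) (comult A d)"
      if d: "d \<in> carrier A" and v: "v \<in> carrier V" for d v
    proof -
      have "f (sweedler (tensor K E V) d (\<lambda>x y. tens K E V (counit_act x) (act V y v))) =
          sweedler (ground_space K) d (\<lambda>x y. f (tens K E V (counit_act x) (act V y v)))"
        by (rule hom_sweedler[OF EV.tensor_vectorspace G d f])
          (simp add: EV.tens_closed counit_act_closed V.act_closed v)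
      also have "\<dots> = tens_lift K (\<lambda>x y. counit A (b \<otimes>\<^bsub>A\<^esub> x) \<otimes>\<^bsub>K\<^esub> counit A (y \<otimes>\<^bsub>A\<^esub> (\<psi> v \<otimes>\<^bsub>A\<^esub> c)))
          (comult A d)"
        unfolding tens_lift_ground_space f_def
        by (rule sweedler_cong[OF d]) (simp add: EV.tens_lift_tens[OF G pairing_bilinear[OF b c], unfolded tens_lift_ground_space]
            counit_act_closed counit_act_apply V.act_closed v b c \<psi>_act module_hom_im[OF \<psi>] alg.m_assoc)
      finally show ?thesis .
    qed
    have "f (left_unit_map K A V (act V a v0)) = f (tens_act' E V a (left_unit_map K A V v0))"
      by (simp only: equiv[OF a])
    moreover have "f (left_unit_map K A V (act V a v0)) =
        tens_lift K (\<lambda>x y. counit A (b \<otimes>\<^bsub>A\<^esub> x) \<otimes>\<^bsub>K\<^esub> counit A (y \<otimes>\<^bsub>A\<^esub> (\<psi> (act V a v0) \<otimes>\<^bsub>A\<^esub> c))) (comult A \<one>\<^bsub>A\<^esub>)"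
      unfolding left_unit_map_def by (rule f_sweedler) (simp_all add: V.act_closed a v0)
    moreover have "f (tens_act' E V a (left_unit_map K A V v0)) =
        tens_lift K (\<lambda>x y. counit A (b \<otimes>\<^bsub>A\<^esub> x) \<otimes>\<^bsub>K\<^esub> counit A (y \<otimes>\<^bsub>A\<^esub> (\<psi> v0 \<otimes>\<^bsub>A\<^esub> c))) (comult A a)"
      unfolding tens_act_left_unit_map[OF V a v0] by (rule f_sweedler[OF a v0])
    ultimately show ?thesis using a c by (simp add: \<psi>_act v0 \<psi>_v0)
  qed
  have one: "tens_lift K (\<lambda>x y. counit A (b \<otimes>\<^bsub>A\<^esub> x) \<otimes>\<^bsub>K\<^esub> counit A (y \<otimes>\<^bsub>A\<^esub> a)) (comult A \<one>\<^bsub>A\<^esub>) =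
      counit A (b \<otimes>\<^bsub>A\<^esub> a)"
    if a: "a \<in> carrier A" and b: "b \<in> carrier A" for a b
  proof -
    have "counit A (b \<otimes>\<^bsub>A\<^esub> a) =
        sweedler (ground_space K) a (\<lambda>x y. counit A y \<odot>\<^bsub>ground_space K\<^esub> counit A (b \<otimes>\<^bsub>A\<^esub> x))"
      by (rule sweedler_counit_right[OF G a module_hom_comp[OF mult_hom_right[OF b] counit_linear]])
    also have "\<dots> = tens_lift K (\<lambda>x y. counit A (b \<otimes>\<^bsub>A\<^esub> x) \<otimes>\<^bsub>K\<^esub> counit A (y \<otimes>\<^bsub>A\<^esub> \<one>\<^bsub>A\<^esub>)) (comult A a)"
      unfolding tens_lift_ground_space
      by (rule sweedler_cong[OF a]) (simp add: ground_space_def counit_closed b R.m_comm)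
    finally show ?thesis using eq[OF a b alg.one_closed] a by simp
  qed
  show ?thesis
    unfolding left_monoidal_def
  proof (intro ballI)
    fix b a c assume *: "b \<in> carrier A" "a \<in> carrier A" "c \<in> carrier A"
    show "counit A (b \<otimes>\<^bsub>A\<^esub> a \<otimes>\<^bsub>A\<^esub> c) =
        tens_lift K (\<lambda>x y. counit A (b \<otimes>\<^bsub>A\<^esub> x) \<otimes>\<^bsub>K\<^esub> counit A (y \<otimes>\<^bsub>A\<^esub> c)) (comult A a)"
      using eq[of a b c] one[of "a \<otimes>\<^bsub>A\<^esub> c" b] * by (simp add: alg.m_assoc)
  qed
qed

lemma right_monoidal_if_equivariant:
  assumes equiv: "\<And>a. a \<in> carrier A \<Longrightarrow>
    right_unit_map K A V (act V a v0) = tens_act' V E a (right_unit_map K A V v0)"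
  shows "right_monoidal K A"
proof -
  note G = vectorspace_ground_space[OF vectorspace_axioms]
  have eq: "tens_lift K (\<lambda>x y. counit A (b \<otimes>\<^bsub>A\<^esub> y) \<otimes>\<^bsub>K\<^esub> counit A (x \<otimes>\<^bsub>A\<^esub> (a \<otimes>\<^bsub>A\<^esub> c))) (comult A \<one>\<^bsub>A\<^esub>) =
      tens_lift K (\<lambda>x y. counit A (b \<otimes>\<^bsub>A\<^esub> y) \<otimes>\<^bsub>K\<^esub> counit A (x \<otimes>\<^bsub>A\<^esub> c)) (comult A a)"
    if a: "a \<in> carrier A" and b: "b \<in> carrier A" and c: "c \<in> carrier A" for a b c
  proof -
    note bil = bilinear_map_flip[OF pairing_bilinear[OF b c]]
    define f where "f = tens_lift (ground_space K) (\<lambda>v \<phi>. \<phi> b \<otimes>\<^bsub>K\<^esub> counit A (\<psi> v \<otimes>\<^bsub>A\<^esub> c))"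
    have f: "f \<in> module_hom K (tensor K V E) (ground_space K)"
      unfolding f_def by (rule VE.tens_lift_linear[OF G bil])
    have f_sweedler: "f (sweedler (tensor K V E) d (\<lambda>x y. tens K V E (act V x v) (counit_act y))) =
        tens_lift K (\<lambda>x y. counit A (b \<otimes>\<^bsub>A\<^esub> y) \<otimes>\<^bsub>K\<^esub> counit A (x \<otimes>\<^bsub>A\<^esub> (\<psi> v \<otimes>\<^bsub>A\<^esub> c))) (comult A d)"
      if d: "d \<in> carrier A" and v: "v \<in> carrier V" for d v
    proof -
      have "f (sweedler (tensor K V E) d (\<lambda>x y. tens K V E (act V x v) (counit_act y))) =
          sweedler (ground_space K) d (\<lambda>x y. f (tens K V E (act V x v) (counit_act y)))"
        by (rule hom_sweedler[OF VE.tensor_vectorspace G d f])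
          (simp add: VE.tens_closed counit_act_closed V.act_closed v)
      also have "\<dots> = tens_lift K (\<lambda>x y. counit A (b \<otimes>\<^bsub>A\<^esub> y) \<otimes>\<^bsub>K\<^esub> counit A (x \<otimes>\<^bsub>A\<^esub> (\<psi> v \<otimes>\<^bsub>A\<^esub> c)))
          (comult A d)"
        unfolding tens_lift_ground_space f_def
        by (rule sweedler_cong[OF d]) (simp add: VE.tens_lift_tens[OF G bil, unfolded tens_lift_ground_space]
            counit_act_closed counit_act_apply V.act_closed v b c \<psi>_act module_hom_im[OF \<psi>] alg.m_assoc)
      finally show ?thesis .
    qed
    have "f (right_unit_map K A V (act V a v0)) = f (tens_act' V E a (right_unit_map K A V v0))"
      by (simp only: equiv[OF a])
    moreover have "f (right_unit_map K A V (act V a v0)) =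
        tens_lift K (\<lambda>x y. counit A (b \<otimes>\<^bsub>A\<^esub> y) \<otimes>\<^bsub>K\<^esub> counit A (x \<otimes>\<^bsub>A\<^esub> (\<psi> (act V a v0) \<otimes>\<^bsub>A\<^esub> c))) (comult A \<one>\<^bsub>A\<^esub>)"
      unfolding right_unit_map_def by (rule f_sweedler) (simp_all add: V.act_closed a v0)
    moreover have "f (tens_act' V E a (right_unit_map K A V v0)) =
        tens_lift K (\<lambda>x y. counit A (b \<otimes>\<^bsub>A\<^esub> y) \<otimes>\<^bsub>K\<^esub> counit A (x \<otimes>\<^bsub>A\<^esub> (\<psi> v0 \<otimes>\<^bsub>A\<^esub> c))) (comult A a)"
      unfolding tens_act_right_unit_map[OF V a v0] by (rule f_sweedler[OF a v0])
    ultimately show ?thesis using a c by (simp add: \<psi>_act v0 \<psi>_v0)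
  qed
  have one: "tens_lift K (\<lambda>x y. counit A (b \<otimes>\<^bsub>A\<^esub> y) \<otimes>\<^bsub>K\<^esub> counit A (x \<otimes>\<^bsub>A\<^esub> a)) (comult A \<one>\<^bsub>A\<^esub>) =
      counit A (b \<otimes>\<^bsub>A\<^esub> a)"
    if a: "a \<in> carrier A" and b: "b \<in> carrier A" for a b
  proof -
    have "counit A (b \<otimes>\<^bsub>A\<^esub> a) =
        sweedler (ground_space K) a (\<lambda>x y. counit A x \<odot>\<^bsub>ground_space K\<^esub> counit A (b \<otimes>\<^bsub>A\<^esub> y))"
      by (rule sweedler_counit_left[OF G a module_hom_comp[OF mult_hom_right[OF b] counit_linear]])
    also have "\<dots> = tens_lift K (\<lambda>x y. counit A (b \<otimes>\<^bsub>A\<^esub> y) \<otimes>\<^bsub>K\<^esub> counit A (x \<otimes>\<^bsub>A\<^esub> \<one>\<^bsub>A\<^esub>)) (comult A a)"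
      unfolding tens_lift_ground_space
      by (rule sweedler_cong[OF a]) (simp add: ground_space_def counit_closed b R.m_comm)
    finally show ?thesis using eq[OF a b alg.one_closed] a by simp
  qed
  show ?thesis
    unfolding right_monoidal_def
  proof (intro ballI)
    fix b a c assume *: "b \<in> carrier A" "a \<in> carrier A" "c \<in> carrier A"
    show "counit A (b \<otimes>\<^bsub>A\<^esub> a \<otimes>\<^bsub>A\<^esub> c) =
        tens_lift K (\<lambda>x y. counit A (b \<otimes>\<^bsub>A\<^esub> y) \<otimes>\<^bsub>K\<^esub> counit A (x \<otimes>\<^bsub>A\<^esub> c)) (comult A a)"
      using eq[of a b c] one[of "a \<otimes>\<^bsub>A\<^esub> c" b] * by (simp add: alg.m_assoc)
  qed
qed

end

end

text \<open>
  A choice of coordinates with respect to a finite generating set is an injection of \<open>A\<close> into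
  \<open>nat \<Rightarrow> 'k\<close>, not linear in general; the module structure is transported along it.
\<close>

lemma regular_representation_copy:
  obtains V :: "('k, nat \<Rightarrow> 'k, 'a) rep" and \<psi> v0 where
    "representation K A V" "\<psi> \<in> module_hom K V A"
    "\<And>a v. a \<in> carrier A \<Longrightarrow> v \<in> carrier V \<Longrightarrow> \<psi> (act V a v) = a \<otimes>\<^bsub>A\<^esub> \<psi> v"
    "v0 \<in> carrier V" "\<psi> v0 = \<one>\<^bsub>A\<^esub>"
proof -
  obtain B where B: "finite B" "B \<subseteq> carrier A" "span B = carrier A"
    using finite_dim by (auto simp: fin_dim_def)
  have "\<forall>a\<in>carrier A. \<exists>c. c \<in> B \<rightarrow> carrier K \<and> lincomb c B = a"
    by (intro ballI finite_in_span[OF B(1,2)]) (simp add: B(3))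
  then obtain coords where coords: "\<And>a. a \<in> carrier A \<Longrightarrow> coords a \<in> B \<rightarrow> carrier K"
      "\<And>a. a \<in> carrier A \<Longrightarrow> lincomb (coords a) B = a"
    by metis
  obtain e :: "'a \<Rightarrow> nat" where e: "inj_on e B"
    using finite_imp_inj_to_nat_seg[OF B(1)] by blast
  define \<phi> where "\<phi> a = (\<lambda>n. coords a (inv_into B e n))" for a
  have "inj_on \<phi> (carrier A)"
  proof (rule inj_onI)
    fix a b assume ab: "a \<in> carrier A" "b \<in> carrier A" "\<phi> a = \<phi> b"
    have eq: "coords a x = coords b x" if "x \<in> B" for x
      using fun_cong[OF ab(3), of "e x"] e that by (simp add: \<phi>_def)
    have "lincomb (coords a) B = lincomb (coords b) B"
      unfolding lincomb_def
      using eq B(2) coords(1)[OF ab(1)] coords(1)[OF ab(2)] by (intro M.finsum_cong') (auto simp: Pi_def)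
    then show "a = b" using coords(2) ab(1,2) by simp
  qed
  define \<psi> where "\<psi> = inv_into (carrier A) \<phi>"
  have \<psi>\<phi>: "\<psi> (\<phi> a) = a" if "a \<in> carrier A" for a
    using \<open>inj_on \<phi> (carrier A)\<close> that by (simp add: \<psi>_def)
  define V :: "('k, nat \<Rightarrow> 'k, 'a) rep" where "V =
    \<lparr>carrier = \<phi> ` carrier A, mult = undefined, one = undefined, zero = \<phi> \<zero>\<^bsub>A\<^esub>,
     add = (\<lambda>x y. \<phi> (\<psi> x \<oplus>\<^bsub>A\<^esub> \<psi> y)), smult = (\<lambda>c x. \<phi> (c \<odot>\<^bsub>A\<^esub> \<psi> x)),
     act = (\<lambda>a x. \<phi> (a \<otimes>\<^bsub>A\<^esub> \<psi> x))\<rparr>"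
  have V_simps: "carrier V = \<phi> ` carrier A" "\<zero>\<^bsub>V\<^esub> = \<phi> \<zero>\<^bsub>A\<^esub>" "add V = (\<lambda>x y. \<phi> (\<psi> x \<oplus>\<^bsub>A\<^esub> \<psi> y))"
    "smult V = (\<lambda>c x. \<phi> (c \<odot>\<^bsub>A\<^esub> \<psi> x))" "act V = (\<lambda>a x. \<phi> (a \<otimes>\<^bsub>A\<^esub> \<psi> x))"
    by (simp_all add: V_def)
  have neg: "\<forall>x\<in>carrier V. \<exists>y\<in>carrier V. x \<oplus>\<^bsub>V\<^esub> y = \<zero>\<^bsub>V\<^esub>"
  proof
    fix x assume "x \<in> carrier V"
    then show "\<exists>y\<in>carrier V. x \<oplus>\<^bsub>V\<^esub> y = \<zero>\<^bsub>V\<^esub>"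
      by (intro bexI[of _ "\<phi> (\<ominus>\<^bsub>A\<^esub> \<psi> x)"]) (auto simp: V_simps \<psi>\<phi> M.r_neg)
  qed
  have add_closed: "\<And>x y. x \<in> carrier V \<Longrightarrow> y \<in> carrier V \<Longrightarrow> x \<oplus>\<^bsub>V\<^esub> y \<in> carrier V"
    and smult_closed: "\<And>c x. c \<in> carrier K \<Longrightarrow> x \<in> carrier V \<Longrightarrow> c \<odot>\<^bsub>V\<^esub> x \<in> carrier V"
    and zero_closed: "\<zero>\<^bsub>V\<^esub> \<in> carrier V"
    by (auto simp: V_simps \<psi>\<phi>)
  have \<psi>_add: "\<And>x y. x \<in> carrier V \<Longrightarrow> y \<in> carrier V \<Longrightarrow> \<psi> (x \<oplus>\<^bsub>V\<^esub> y) = \<psi> x \<oplus>\<^bsub>A\<^esub> \<psi> y"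
    and \<psi>_smult: "\<And>c x. c \<in> carrier K \<Longrightarrow> x \<in> carrier V \<Longrightarrow> \<psi> (c \<odot>\<^bsub>V\<^esub> x) = c \<odot>\<^bsub>A\<^esub> \<psi> x"
    and \<psi>_zero: "\<psi> \<zero>\<^bsub>V\<^esub> = \<zero>\<^bsub>A\<^esub>"
    and \<psi>_closed: "\<And>x. x \<in> carrier V \<Longrightarrow> \<psi> x \<in> carrier A"
    by (auto simp: V_simps \<psi>\<phi>)
  have \<psi>_eq: "x = y" if "\<psi> x = \<psi> y" "x \<in> carrier V" "y \<in> carrier V" for x y
    using that by (auto simp: V_simps \<psi>\<phi>)
  note closed = add_closed smult_closed zero_closed and \<psi>_simps = \<psi>_add \<psi>_smult \<psi>_zero \<psi>_closed
  have "module K V"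
    by (rule module_criteria[OF R.is_cring zero_closed _ neg]; intro allI ballI impI; (elim conjE)?)
      ((rule \<psi>_eq)?; simp add: closed \<psi>_simps M.a_ac smult_assoc1 smult_l_distr smult_r_distr)+
  then have vs: "vectorspace K V" by (rule vectorspace.intro) (rule field_axioms)
  have \<phi>_hom: "\<phi> \<in> module_hom K A V"
    by (rule module_homI) (auto simp: V_simps \<psi>\<phi>)
  have \<psi>_hom: "\<psi> \<in> module_hom K V A"
    by (rule module_homI) (auto simp: V_simps \<psi>\<phi>)
  interpret \<phi>: linear_map K A V \<phi>
    by (intro linear_map.intro mod_hom.intro mod_hom_axioms.intro vectorspace_axioms vs
        vectorspace.axioms(1) \<phi>_hom)
  have fin: "vectorspace.fin_dim K V"
    by (rule \<phi>.rank_nullity_main(2)[OF finite_dim]) (simp add: V_simps)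
  have bil: "bilinear_map K A V V (act V)"
    unfolding V_simps(5)
    by (intro bilinear_mapI module_hom_comp[OF module_hom_comp[OF \<psi>_hom mult_hom_right] \<phi>_hom]
        module_hom_comp[OF mult_hom_left \<phi>_hom] \<psi>_closed)
  have "representation K A V"
  proof (intro representation.intro representation_axioms.intro vs fin bil)
    show "act V \<one>\<^bsub>A\<^esub> v = v" if "v \<in> carrier V" for v
      using that by (auto simp: V_simps \<psi>\<phi>)
    show "act V (a \<otimes>\<^bsub>A\<^esub> b) v = act V a (act V b v)"
      if "a \<in> carrier A" "b \<in> carrier A" "v \<in> carrier V" for a b v
      using that by (auto simp: V_simps \<psi>\<phi> alg.m_assoc)
  qed
  moreover have "\<psi> (act V a v) = a \<otimes>\<^bsub>A\<^esub> \<psi> v" if "a \<in> carrier A" "v \<in> carrier V" for a v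
    using that by (auto simp: V_simps \<psi>\<phi>)
  moreover have "\<phi> \<one>\<^bsub>A\<^esub> \<in> carrier V" "\<psi> (\<phi> \<one>\<^bsub>A\<^esub>) = \<one>\<^bsub>A\<^esub>" by (simp_all add: V_simps \<psi>\<phi>)
  ultimately show ?thesis using \<psi>_hom by (intro that)
qed

section \<open>Compatibility with triple products\<close>

context
  fixes X :: "('k, 'u, 'p) module_scheme" and Y :: "('k, 'v, 'q) module_scheme"
    and Z :: "('k, 'w, 'r) module_scheme"
    and a :: 'a
  assumes X: "vectorspace K X" and Y: "vectorspace K Y" and Z: "vectorspace K Z"
    and a: "a \<in> carrier A"
begin

interpretation XY: tensor_pair K X Y by (intro tensor_pair.intro X Y)
interpretation YZ: tensor_pair K Y Z by (intro tensor_pair.intro Y Z)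
interpretation X_YZ: tensor_pair K X "tensor K Y Z"
  by (intro tensor_pair.intro X YZ.tensor_vectorspace)

lemma sweedler_coassoc_tens:
  assumes f: "f \<in> module_hom K A X" and g: "g \<in> module_hom K A Y" and h: "h \<in> module_hom K A Z"
  shows "sweedler (tensor K X (tensor K Y Z)) a (\<lambda>x y. sweedler (tensor K X (tensor K Y Z)) x
      (\<lambda>x1 x2. tens K X (tensor K Y Z) (f x1) (tens K Y Z (g x2) (h y)))) =
    sweedler (tensor K X (tensor K Y Z)) a (\<lambda>x y. sweedler (tensor K X (tensor K Y Z)) y
      (\<lambda>y1 y2. tens K X (tensor K Y Z) (f x) (tens K Y Z (g y1) (h y2))))"
proof (rule sweedler_coassoc[OF X_YZ.tensor_vectorspace a])
  note im = f[THEN module_hom_im] g[THEN module_hom_im] h[THEN module_hom_im]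
  fix x y assume xy: "x \<in> carrier A" "y \<in> carrier A"
  show "(\<lambda>z. tens K X (tensor K Y Z) (f z) (tens K Y Z (g x) (h y))) \<in>
      module_hom K A (tensor K X (tensor K Y Z))"
    by (rule module_hom_comp[OF f bilinear_map_left[OF X_YZ.tens_bilinear]])
      (simp add: YZ.tens_closed im xy)
  show "(\<lambda>z. tens K X (tensor K Y Z) (f x) (tens K Y Z (g z) (h y))) \<in>
      module_hom K A (tensor K X (tensor K Y Z))"
    by (rule module_hom_comp[OF module_hom_comp[OF g bilinear_map_left[OF YZ.tens_bilinear]]
          bilinear_map_right[OF X_YZ.tens_bilinear]]) (simp_all add: im xy)
  show "(\<lambda>z. tens K X (tensor K Y Z) (f x) (tens K Y Z (g y) (h z))) \<in>
      module_hom K A (tensor K X (tensor K Y Z))"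
    by (rule module_hom_comp[OF module_hom_comp[OF h bilinear_map_right[OF YZ.tens_bilinear]]
          bilinear_map_right[OF X_YZ.tens_bilinear]]) (simp_all add: im xy)
qed

lemma flat_left_sweedler:
  assumes P: "vectorspace K P" "(\<lambda>p. p) \<in> module_hom K P (tensor K X Y)"
    and f: "f \<in> module_hom K A X" and g: "g \<in> module_hom K A Y"
    and p: "p \<in> carrier P" "p = sweedler (tensor K X Y) a (\<lambda>x y. tens K X Y (f x) (g y))"
    and z: "z \<in> carrier Z"
  shows "flat_left K X Y Z (tens K P Z p z) = sweedler (tensor K X (tensor K Y Z)) a
    (\<lambda>x y. tens K X (tensor K Y Z) (f x) (tens K Y Z (g y) z))"
proof -
  note im = f[THEN module_hom_im] g[THEN module_hom_im]
  have bil: "bilinear_map K X Y (tensor K X (tensor K Y Z))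
      (\<lambda>v w. tens K X (tensor K Y Z) v (tens K Y Z w z))"
    by (rule bilinear_map_comp[OF X_YZ.tens_bilinear module_hom_id
          bilinear_map_left[OF YZ.tens_bilinear z]])
  have "flat_left K X Y Z (tens K P Z p z) = tens_lift (tensor K X (tensor K Y Z))
      (\<lambda>v w. tens K X (tensor K Y Z) v (tens K Y Z w z)) (sweedler (tensor K X Y) a (\<lambda>x y. tens K X Y (f x) (g y)))"
    using flat_left_tens[OF X Y Z P p(1) z] p(2) by simp
  also have "\<dots> = sweedler (tensor K X (tensor K Y Z)) a (\<lambda>x y. tens_lift (tensor K X (tensor K Y Z))
      (\<lambda>v w. tens K X (tensor K Y Z) v (tens K Y Z w z)) (tens K X Y (f x) (g y)))"
    by (rule hom_sweedler[OF XY.tensor_vectorspace X_YZ.tensor_vectorspace a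
          XY.tens_lift_linear[OF X_YZ.tensor_vectorspace bil]]) (simp add: XY.tens_closed im)
  also have "\<dots> = sweedler (tensor K X (tensor K Y Z)) a
      (\<lambda>x y. tens K X (tensor K Y Z) (f x) (tens K Y Z (g y) z))"
    by (rule sweedler_cong[OF a]) (simp add: XY.tens_lift_tens[OF X_YZ.tensor_vectorspace bil] im)
  finally show ?thesis .
qed

lemma flat_right_sweedler:
  assumes P: "vectorspace K P" "(\<lambda>p. p) \<in> module_hom K P (tensor K Y Z)"
    and g: "g \<in> module_hom K A Y" and h: "h \<in> module_hom K A Z"
    and p: "p \<in> carrier P" "p = sweedler (tensor K Y Z) a (\<lambda>x y. tens K Y Z (g x) (h y))"
    and v: "v \<in> carrier X"
  shows "flat_right K X Y Z (tens K X P v p) = sweedler (tensor K X (tensor K Y Z)) a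
    (\<lambda>x y. tens K X (tensor K Y Z) v (tens K Y Z (g x) (h y)))"
proof -
  note im = g[THEN module_hom_im] h[THEN module_hom_im]
  have "flat_right K X Y Z (tens K X P v p) =
      tens K X (tensor K Y Z) v (sweedler (tensor K Y Z) a (\<lambda>x y. tens K Y Z (g x) (h y)))"
    using flat_right_tens[OF X Y Z P v p(1)] p(2) by simp
  also have "\<dots> = sweedler (tensor K X (tensor K Y Z)) a
      (\<lambda>x y. tens K X (tensor K Y Z) v (tens K Y Z (g x) (h y)))"
    by (rule hom_sweedler[OF YZ.tensor_vectorspace X_YZ.tensor_vectorspace a
          bilinear_map_right[OF X_YZ.tens_bilinear v]]) (simp add: YZ.tens_closed im)
  finally show ?thesis .
qed

end

lemma rep_prod_hom_eqI:
  assumes V: "alg_module K A V" and W: "alg_module K A W" and U: "vectorspace K U"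
    and F: "F \<in> module_hom K (rep_prod K A V W) U" and G: "G \<in> module_hom K (rep_prod K A V W) U"
    and eq: "\<And>v w. v \<in> carrier V \<Longrightarrow> w \<in> carrier W \<Longrightarrow>
      F (tens_act' V W \<one>\<^bsub>A\<^esub> (tens K V W v w)) = G (tens_act' V W \<one>\<^bsub>A\<^esub> (tens K V W v w))"
    and t: "t \<in> carrier (rep_prod K A V W)"
  shows "F t = G t"
proof -
  interpret V: alg_module K A V by (rule V)
  interpret W: alg_module K A W by (rule W)
  interpret VW: tensor_pair K V W
    by (intro tensor_pair.intro V.vectorspace_axioms W.vectorspace_axioms)
  have proj: "tens_act' V W \<one>\<^bsub>A\<^esub> \<in> module_hom K (tensor K V W) (rep_prod K A V W)"
    by (rule hom_into_rep_prod[OF V W bilinear_map_right[OF tens_act_bilinear[OF V W] alg.one_closed]])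
      (simp add: tens_act_in_rep_prod[OF V W])
  obtain s where s: "s \<in> carrier (tensor K V W)" and t_eq: "t = tens_act' V W \<one>\<^bsub>A\<^esub> s"
    using t by (auto simp: rep_prod_simps(1)[OF V W])
  show ?thesis
    unfolding t_eq
    by (rule VW.tensor_hom_eqI[OF U module_hom_comp[OF proj F] module_hom_comp[OF proj G] eq s])
qed

lemma tens_map_tens_act:
  assumes V: "alg_module K A V" and W: "alg_module K A W"
    and X: "vectorspace K X" and Y: "vectorspace K Y" and U: "vectorspace K U"
    and f: "f \<in> module_hom K V X" and g: "g \<in> module_hom K W Y"
    and F: "F \<in> module_hom K (tensor K X Y) U"
  shows "(\<lambda>t. F (tens_map K X Y f g t)) \<in> module_hom K (rep_prod K A V W) U"
    and "\<lbrakk>v \<in> carrier V; w \<in> carrier W\<rbrakk> \<Longrightarrow> F (tens_map K X Y f g (tens_act' V W \<one>\<^bsub>A\<^esub> (tens K V W v w))) =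
      sweedler U \<one>\<^bsub>A\<^esub> (\<lambda>x y. F (tens K X Y (f (act V x v)) (g (act W y w))))"
proof -
  interpret V: alg_module K A V by (rule V)
  interpret W: alg_module K A W by (rule W)
  interpret VW: tensor_pair K V W
    by (intro tensor_pair.intro V.vectorspace_axioms W.vectorspace_axioms)
  interpret XY: tensor_pair K X Y by (intro tensor_pair.intro X Y)
  note hom = module_hom_comp[OF tens_map_hom[OF VW.tensor_pair_axioms XY.tensor_pair_axioms f g] F]
  show "(\<lambda>t. F (tens_map K X Y f g t)) \<in> module_hom K (rep_prod K A V W) U"
    by (rule module_hom_comp[OF rep_prod_incl[OF V W] hom])
  assume v: "v \<in> carrier V" and w: "w \<in> carrier W"
  have "F (tens_map K X Y f g (tens_act' V W \<one>\<^bsub>A\<^esub> (tens K V W v w))) =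
      sweedler U \<one>\<^bsub>A\<^esub> (\<lambda>x y. F (tens_map K X Y f g (tens K V W (act V x v) (act W y w))))"
    unfolding tens_act_tens[OF V W alg.one_closed v w]
    by (rule hom_sweedler[OF VW.tensor_vectorspace U alg.one_closed hom])
      (simp add: VW.tens_closed V.act_closed W.act_closed v w)
  also have "\<dots> = sweedler U \<one>\<^bsub>A\<^esub> (\<lambda>x y. F (tens K X Y (f (act V x v)) (g (act W y w))))"
    by (rule sweedler_cong[OF alg.one_closed])
      (simp add: tens_map_tens[OF VW.tensor_pair_axioms XY.tensor_pair_axioms f g]
        V.act_closed W.act_closed v w)
  finally show "F (tens_map K X Y f g (tens_act' V W \<one>\<^bsub>A\<^esub> (tens K V W v w))) =
      sweedler U \<one>\<^bsub>A\<^esub> (\<lambda>x y. F (tens K X Y (f (act V x v)) (g (act W y w))))" .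
qed

lemma id_module_hom: "id \<in> module_hom K V V"
  using module_hom_id by (simp add: id_def)

context
  fixes V :: "('k, 'v, 'a, 'y) rep_scheme" and W :: "('k, 'w, 'a, 'z) rep_scheme"
  assumes V: "alg_module K A V" and W: "alg_module K A W"
begin

interpretation V: alg_module K A V by (rule V)
interpretation W: alg_module K A W by (rule W)
interpretation E: alg_module K A E by (rule counit_rep_alg_module)
interpretation VW: tensor_pair K V W
  by (intro tensor_pair.intro V.vectorspace_axioms W.vectorspace_axioms)
interpretation EW: tensor_pair K E W
  by (intro tensor_pair.intro W.vectorspace_axioms E.vectorspace_axioms)
interpretation WE: tensor_pair K W E
  by (intro tensor_pair.intro W.vectorspace_axioms E.vectorspace_axioms)

lemma right_unit_map_times_id:
  assumes lm: "left_monoidal K A" and rm: "right_monoidal K A"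
    and t: "t \<in> carrier (rep_prod K A V W)"
  shows "flat_left K V E W
      (rep_prod_map K A V W (rep_prod K A V E) W (right_unit_map K A V) id t) =
    flat_right K V E W
      (rep_prod_map K A V W V (rep_prod K A E W) id (left_unit_map K A W) t)"
proof -
  let ?T = "tensor K V (tensor K E W)" and ?VE = "rep_prod K A V E" and ?EW = "rep_prod K A E W"
  interpret T: tensor_pair K V "tensor K E W"
    by (intro tensor_pair.intro V.vectorspace_axioms EW.tensor_vectorspace)
  note VE_vs = rep_prod_vectorspace[OF V E.alg_module_axioms]
  note EW_vs = rep_prod_vectorspace[OF E.alg_module_axioms W]
  note VE_incl = rep_prod_incl[OF V E.alg_module_axioms]
  note EW_incl = rep_prod_incl[OF E.alg_module_axioms W]
  note R = right_unit_map_hom[OF V] and L = left_unit_map_hom[OF W]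
  note vs = V.vectorspace_axioms E.vectorspace_axioms W.vectorspace_axioms
  note F = tens_map_tens_act[OF V W VE_vs vs(3) T.tensor_vectorspace R id_module_hom
      flat_left_hom[OF vs VE_vs VE_incl]]
  note G = tens_map_tens_act[OF V W vs(1) EW_vs T.tensor_vectorspace id_module_hom L
      flat_right_hom[OF vs EW_vs EW_incl]]
  have "flat_left K V E W (tens_map K ?VE W (right_unit_map K A V) id t) =
      flat_right K V E W (tens_map K V ?EW id (left_unit_map K A W) t)"
  proof (rule rep_prod_hom_eqI[OF V W T.tensor_vectorspace F(1) G(1) _ t])
    fix v w assume v: "v \<in> carrier V" and w: "w \<in> carrier W"
    have "sweedler ?T \<one>\<^bsub>A\<^esub> (\<lambda>x y. flat_left K V E W (tens K ?VE W (right_unit_map K A V (act V x v)) (id (act W y w)))) =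
        sweedler ?T \<one>\<^bsub>A\<^esub> (\<lambda>x y. sweedler ?T x
          (\<lambda>x1 x2. tens K V (tensor K E W) (act V x1 v) (tens K E W (counit_act x2) (act W y w))))"
    proof (rule sweedler_cong[OF alg.one_closed], unfold id_apply)
      fix x y assume "x \<in> carrier A" "y \<in> carrier A"
      then show "flat_left K V E W (tens K ?VE W (right_unit_map K A V (act V x v)) (act W y w)) = sweedler ?T x
          (\<lambda>x1 x2. tens K V (tensor K E W) (act V x1 v) (tens K E W (counit_act x2) (act W y w)))"
        by (intro flat_left_sweedler[OF vs _ VE_vs VE_incl V.act_hom_left[OF v] counit_act_hom]
            module_hom_im[OF R] right_unit_map_act[OF V rm] V.act_closed W.act_closed v w)
    qed
    also have "\<dots> = sweedler ?T \<one>\<^bsub>A\<^esub> (\<lambda>x y. sweedler ?T y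
        (\<lambda>y1 y2. tens K V (tensor K E W) (act V x v) (tens K E W (counit_act y1) (act W y2 w))))"
      by (rule sweedler_coassoc_tens[OF vs alg.one_closed V.act_hom_left[OF v] counit_act_hom W.act_hom_left[OF w]])
    also have "\<dots> = sweedler ?T \<one>\<^bsub>A\<^esub> (\<lambda>x y. flat_right K V E W (tens K V ?EW (id (act V x v)) (left_unit_map K A W (act W y w))))"
    proof (rule sweedler_cong[OF alg.one_closed, symmetric], unfold id_apply)
      fix x y assume "x \<in> carrier A" "y \<in> carrier A"
      then show "flat_right K V E W (tens K V ?EW (act V x v) (left_unit_map K A W (act W y w))) = sweedler ?T y
          (\<lambda>y1 y2. tens K V (tensor K E W) (act V x v) (tens K E W (counit_act y1) (act W y2 w)))"
        by (intro flat_right_sweedler[OF vs _ EW_vs EW_incl counit_act_hom W.act_hom_left[OF w]]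
            module_hom_im[OF L] left_unit_map_act[OF W lm] V.act_closed W.act_closed v w)
    qed
    finally show "flat_left K V E W (tens_map K ?VE W (right_unit_map K A V) id (tens_act' V W \<one>\<^bsub>A\<^esub> (tens K V W v w))) =
        flat_right K V E W (tens_map K V ?EW id (left_unit_map K A W) (tens_act' V W \<one>\<^bsub>A\<^esub> (tens K V W v w)))"
      unfolding F(2)[OF v w] G(2)[OF v w] .
  qed
  then show ?thesis using t by (simp add: rep_prod_map_def)
qed

lemma tens_act_idem_tens:
  assumes "x \<in> carrier A" "v \<in> carrier V" "w \<in> carrier W"
  shows "tens_act' V W x (tens_act' V W \<one>\<^bsub>A\<^esub> (tens K V W v w)) =
    sweedler (tensor K V W) x (\<lambda>x1 x2. tens K V W (act V x1 v) (act W x2 w))"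
  using assms by (simp add: VW.tens_closed flip: tens_act_mult[OF V W] tens_act_tens[OF V W])

lemma left_unit_map_times_id:
  assumes lm: "left_monoidal K A" and t: "t \<in> carrier (rep_prod K A V W)"
  shows "flat_left K E V W
      (rep_prod_map K A V W (rep_prod K A E V) W (left_unit_map K A V) id t) =
    flat_right K E V W (left_unit_map K A (rep_prod K A V W) t)"
proof -
  let ?T = "tensor K E (tensor K V W)" and ?EV = "rep_prod K A E V" and ?P = "rep_prod K A V W"
  note P = rep_prod_alg_module[OF V W]
  note P_vs = rep_prod_vectorspace[OF V W]
  interpret T: tensor_pair K E "tensor K V W"
    by (intro tensor_pair.intro E.vectorspace_axioms VW.tensor_vectorspace)
  interpret EP: tensor_pair K E ?P
    by (intro tensor_pair.intro E.vectorspace_axioms P_vs)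
  note EV_vs = rep_prod_vectorspace[OF E.alg_module_axioms V]
  note EV_incl = rep_prod_incl[OF E.alg_module_axioms V]
  note P_incl = rep_prod_incl[OF V W]
  note L = left_unit_map_hom[OF V]
  note vs = E.vectorspace_axioms V.vectorspace_axioms W.vectorspace_axioms
  note F = tens_map_tens_act[OF V W EV_vs vs(3) T.tensor_vectorspace L id_module_hom
      flat_left_hom[OF vs EV_vs EV_incl]]
  note flat = flat_right_hom[OF vs P_vs P_incl]
  have "flat_left K E V W (tens_map K ?EV W (left_unit_map K A V) id t) =
      flat_right K E V W (left_unit_map K A ?P t)"
  proof (rule rep_prod_hom_eqI[OF V W T.tensor_vectorspace F(1)
        module_hom_comp[OF left_unit_map_tensor_hom[OF P] flat] _ t])
    fix v w assume v: "v \<in> carrier V" and w: "w \<in> carrier W"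
    let ?vw = "tens_act' V W \<one>\<^bsub>A\<^esub> (tens K V W v w)"
    have vw: "?vw \<in> carrier ?P" by (simp add: tens_act_in_rep_prod[OF V W] VW.tens_closed v w)
    have act_vw: "act ?P x ?vw \<in> carrier ?P" if "x \<in> carrier A" for x
      by (rule alg_module.act_closed[OF P that vw])
    have "sweedler ?T \<one>\<^bsub>A\<^esub> (\<lambda>x y. flat_left K E V W (tens K ?EV W (left_unit_map K A V (act V x v)) (id (act W y w)))) =
        sweedler ?T \<one>\<^bsub>A\<^esub> (\<lambda>x y. sweedler ?T x
          (\<lambda>x1 x2. tens K E (tensor K V W) (counit_act x1) (tens K V W (act V x2 v) (act W y w))))"
    proof (rule sweedler_cong[OF alg.one_closed], unfold id_apply)
      fix x y assume "x \<in> carrier A" "y \<in> carrier A"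
      then show "flat_left K E V W (tens K ?EV W (left_unit_map K A V (act V x v)) (act W y w)) = sweedler ?T x
          (\<lambda>x1 x2. tens K E (tensor K V W) (counit_act x1) (tens K V W (act V x2 v) (act W y w)))"
        by (intro flat_left_sweedler[OF vs _ EV_vs EV_incl counit_act_hom V.act_hom_left[OF v]]
            module_hom_im[OF L] left_unit_map_act[OF V lm] V.act_closed W.act_closed v w)
    qed
    also have "\<dots> = sweedler ?T \<one>\<^bsub>A\<^esub> (\<lambda>x y. sweedler ?T y
        (\<lambda>y1 y2. tens K E (tensor K V W) (counit_act x) (tens K V W (act V y1 v) (act W y2 w))))"
      by (rule sweedler_coassoc_tens[OF vs alg.one_closed counit_act_hom V.act_hom_left[OF v] W.act_hom_left[OF w]])
    also have "\<dots> = sweedler ?T \<one>\<^bsub>A\<^esub> (\<lambda>x y. flat_right K E V W (tens K E ?P (counit_act x) (act ?P y ?vw)))"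
    proof (rule sweedler_cong[OF alg.one_closed, symmetric])
      fix x y assume xy: "x \<in> carrier A" "y \<in> carrier A"
      show "flat_right K E V W (tens K E ?P (counit_act x) (act ?P y ?vw)) = sweedler ?T y
          (\<lambda>y1 y2. tens K E (tensor K V W) (counit_act x) (tens K V W (act V y1 v) (act W y2 w)))"
        by (rule flat_right_sweedler[OF vs xy(2) P_vs P_incl V.act_hom_left[OF v] W.act_hom_left[OF w]
              act_vw[OF xy(2)] _ counit_act_closed[OF xy(1)]])
          (simp add: rep_prod_simps(5)[OF V W] tens_act_idem_tens xy v w)
    qed
    also have "\<dots> = flat_right K E V W (left_unit_map K A ?P ?vw)"
      unfolding left_unit_map_def
      by (rule hom_sweedler[OF EP.tensor_vectorspace T.tensor_vectorspace alg.one_closed flat, symmetric])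
        (simp add: EP.tens_closed counit_act_closed act_vw)
    finally show "flat_left K E V W (tens_map K ?EV W (left_unit_map K A V) id ?vw) =
        flat_right K E V W (left_unit_map K A ?P ?vw)"
      unfolding F(2)[OF v w] .
  qed
  then show ?thesis using t by (simp add: rep_prod_map_def)
qed

lemma id_times_right_unit_map:
  assumes rm: "right_monoidal K A" and t: "t \<in> carrier (rep_prod K A V W)"
  shows "flat_right K V W E
      (rep_prod_map K A V W V (rep_prod K A W E) id (right_unit_map K A W) t) =
    flat_left K V W E (right_unit_map K A (rep_prod K A V W) t)"
proof -
  let ?T = "tensor K V (tensor K W E)" and ?WE = "rep_prod K A W E" and ?P = "rep_prod K A V W"
  note P = rep_prod_alg_module[OF V W]
  note P_vs = rep_prod_vectorspace[OF V W]
  interpret T: tensor_pair K V "tensor K W E"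
    by (intro tensor_pair.intro V.vectorspace_axioms WE.tensor_vectorspace)
  interpret PE: tensor_pair K ?P E
    by (intro tensor_pair.intro E.vectorspace_axioms P_vs)
  note WE_vs = rep_prod_vectorspace[OF W E.alg_module_axioms]
  note WE_incl = rep_prod_incl[OF W E.alg_module_axioms]
  note P_incl = rep_prod_incl[OF V W]
  note R = right_unit_map_hom[OF W]
  note vs = V.vectorspace_axioms W.vectorspace_axioms E.vectorspace_axioms
  note F = tens_map_tens_act[OF V W vs(1) WE_vs T.tensor_vectorspace id_module_hom R
      flat_right_hom[OF vs WE_vs WE_incl]]
  note flat = flat_left_hom[OF vs P_vs P_incl]
  have "flat_right K V W E (tens_map K V ?WE id (right_unit_map K A W) t) =
      flat_left K V W E (right_unit_map K A ?P t)"
  proof (rule rep_prod_hom_eqI[OF V W T.tensor_vectorspace F(1)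
        module_hom_comp[OF right_unit_map_tensor_hom[OF P] flat] _ t])
    fix v w assume v: "v \<in> carrier V" and w: "w \<in> carrier W"
    let ?vw = "tens_act' V W \<one>\<^bsub>A\<^esub> (tens K V W v w)"
    have vw: "?vw \<in> carrier ?P" by (simp add: tens_act_in_rep_prod[OF V W] VW.tens_closed v w)
    have act_vw: "act ?P x ?vw \<in> carrier ?P" if "x \<in> carrier A" for x
      by (rule alg_module.act_closed[OF P that vw])
    have "sweedler ?T \<one>\<^bsub>A\<^esub> (\<lambda>x y. flat_right K V W E (tens K V ?WE (id (act V x v)) (right_unit_map K A W (act W y w)))) =
        sweedler ?T \<one>\<^bsub>A\<^esub> (\<lambda>x y. sweedler ?T y
          (\<lambda>y1 y2. tens K V (tensor K W E) (act V x v) (tens K W E (act W y1 w) (counit_act y2))))"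
    proof (rule sweedler_cong[OF alg.one_closed], unfold id_apply)
      fix x y assume "x \<in> carrier A" "y \<in> carrier A"
      then show "flat_right K V W E (tens K V ?WE (act V x v) (right_unit_map K A W (act W y w))) = sweedler ?T y
          (\<lambda>y1 y2. tens K V (tensor K W E) (act V x v) (tens K W E (act W y1 w) (counit_act y2)))"
        by (intro flat_right_sweedler[OF vs _ WE_vs WE_incl W.act_hom_left[OF w] counit_act_hom]
            module_hom_im[OF R] right_unit_map_act[OF W rm] V.act_closed W.act_closed v w)
    qed
    also have "\<dots> = sweedler ?T \<one>\<^bsub>A\<^esub> (\<lambda>x y. sweedler ?T x
        (\<lambda>x1 x2. tens K V (tensor K W E) (act V x1 v) (tens K W E (act W x2 w) (counit_act y))))"
      by (rule sweedler_coassoc_tens[OF vs alg.one_closed V.act_hom_left[OF v] W.act_hom_left[OF w]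
            counit_act_hom, symmetric])
    also have "\<dots> = sweedler ?T \<one>\<^bsub>A\<^esub> (\<lambda>x y. flat_left K V W E (tens K ?P E (act ?P x ?vw) (counit_act y)))"
    proof (rule sweedler_cong[OF alg.one_closed, symmetric])
      fix x y assume xy: "x \<in> carrier A" "y \<in> carrier A"
      show "flat_left K V W E (tens K ?P E (act ?P x ?vw) (counit_act y)) = sweedler ?T x
          (\<lambda>x1 x2. tens K V (tensor K W E) (act V x1 v) (tens K W E (act W x2 w) (counit_act y)))"
        by (rule flat_left_sweedler[OF vs xy(1) P_vs P_incl V.act_hom_left[OF v] W.act_hom_left[OF w]
              act_vw[OF xy(1)] _ counit_act_closed[OF xy(2)]])
          (simp add: rep_prod_simps(5)[OF V W] tens_act_idem_tens xy v w)
    qed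
    also have "\<dots> = flat_left K V W E (right_unit_map K A ?P ?vw)"
      unfolding right_unit_map_def
      by (rule hom_sweedler[OF PE.tensor_vectorspace T.tensor_vectorspace alg.one_closed flat, symmetric])
        (simp add: PE.tens_closed counit_act_closed act_vw)
    finally show "flat_right K V W E (tens_map K V ?WE id (right_unit_map K A W) ?vw) =
        flat_left K V W E (right_unit_map K A ?P ?vw)"
      unfolding F(2)[OF v w] .
  qed
  then show ?thesis using t by (simp add: rep_prod_map_def)
qed

end

lemma right_unit_map_counit_rep:
  assumes lm: "left_monoidal K A" and rm: "right_monoidal K A" and \<phi>: "\<phi> \<in> carrier E"
  shows "right_unit_map K A E \<phi> = left_unit_map K A E \<phi>"
proof -
  note E = counit_rep_alg_module
  obtain a where a: "a \<in> carrier A" and "\<phi> = counit_act a"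
    using \<phi> by (auto simp: counit_rep_simps(1))
  then have \<phi>_eq: "\<phi> = act E a (counit_act \<one>\<^bsub>A\<^esub>)" by (simp add: act_counit_act)
  have one: "act E x (counit_act \<one>\<^bsub>A\<^esub>) = counit_act x" if "x \<in> carrier A" for x
    using that by (simp add: act_counit_act)
  show ?thesis
    unfolding \<phi>_eq left_unit_map_act[OF E lm a counit_act_closed[OF alg.one_closed]]
      right_unit_map_act[OF E rm a counit_act_closed[OF alg.one_closed]]
    by (rule sweedler_cong[OF a]) (simp add: one)
qed

lemma left_monoidal_if_rep_hom:
  assumes "\<And>V :: ('k, nat \<Rightarrow> 'k, 'a) rep. representation K A V \<Longrightarrow>
    left_unit_map K A V \<in> rep_hom K A V (rep_prod K A E V)"
  shows "left_monoidal K A"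
proof -
  obtain V :: "('k, nat \<Rightarrow> 'k, 'a) rep" and \<psi> v0 where
    V: "representation K A V" and \<psi>: "\<psi> \<in> module_hom K V A"
      "\<And>a v. a \<in> carrier A \<Longrightarrow> v \<in> carrier V \<Longrightarrow> \<psi> (act V a v) = a \<otimes>\<^bsub>A\<^esub> \<psi> v"
      "v0 \<in> carrier V" "\<psi> v0 = \<one>\<^bsub>A\<^esub>"
    using regular_representation_copy by blast
  note V' = representation_alg_module[OF V]
  show ?thesis
  proof (rule left_monoidal_if_equivariant[of V \<psi> v0, OF V' \<psi>(1) _ \<psi>(3,4)])
    show "\<psi> (act V a v) = a \<otimes>\<^bsub>A\<^esub> \<psi> v" if "a \<in> carrier A" "v \<in> carrier V" for a v
      by (rule \<psi>(2)[OF that])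
    show "left_unit_map K A V (act V a v0) = tens_act' E V a (left_unit_map K A V v0)" if "a \<in> carrier A" for a
      using assms[OF V] that \<psi>(3) by (simp add: rep_hom_def rep_prod_simps(5)[OF counit_rep_alg_module V'])
  qed
qed

lemma right_monoidal_if_rep_hom:
  assumes "\<And>V :: ('k, nat \<Rightarrow> 'k, 'a) rep. representation K A V \<Longrightarrow>
    right_unit_map K A V \<in> rep_hom K A V (rep_prod K A V E)"
  shows "right_monoidal K A"
proof -
  obtain V :: "('k, nat \<Rightarrow> 'k, 'a) rep" and \<psi> v0 where
    V: "representation K A V" and \<psi>: "\<psi> \<in> module_hom K V A"
      "\<And>a v. a \<in> carrier A \<Longrightarrow> v \<in> carrier V \<Longrightarrow> \<psi> (act V a v) = a \<otimes>\<^bsub>A\<^esub> \<psi> v"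
      "v0 \<in> carrier V" "\<psi> v0 = \<one>\<^bsub>A\<^esub>"
    using regular_representation_copy by blast
  note V' = representation_alg_module[OF V]
  show ?thesis
  proof (rule right_monoidal_if_equivariant[of V \<psi> v0, OF V' \<psi>(1) _ \<psi>(3,4)])
    show "\<psi> (act V a v) = a \<otimes>\<^bsub>A\<^esub> \<psi> v" if "a \<in> carrier A" "v \<in> carrier V" for a v
      by (rule \<psi>(2)[OF that])
    show "right_unit_map K A V (act V a v0) = tens_act' V E a (right_unit_map K A V v0)" if "a \<in> carrier A" for a
      using assms[OF V] that \<psi>(3) by (simp add: rep_hom_def rep_prod_simps(5)[OF V' counit_rep_alg_module])
  qed
qed

end

theorem theorem2p4:
  fixes K :: "('k, 'm) ring_scheme" and A :: "('k, 'a, 'x) coalg_scheme"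
  assumes "weak_bialgebra K A"
  shows
    "((\<forall>V :: ('k, nat \<Rightarrow> 'k, 'a) rep. representation K A V \<longrightarrow>
        left_unit_map K A V \<in> rep_hom K A V (rep_prod K A (counit_rep K A) V))
      \<longleftrightarrow> left_monoidal K A) \<and>
     (left_monoidal K A \<longrightarrow>
      (\<forall>V :: ('k, 'v, 'a) rep. representation K A V \<longrightarrow>
        left_unit_map K A V \<in> rep_hom K A V (rep_prod K A (counit_rep K A) V))) \<and>
     ((\<forall>V :: ('k, nat \<Rightarrow> 'k, 'a) rep. representation K A V \<longrightarrow>
        right_unit_map K A V \<in> rep_hom K A V (rep_prod K A V (counit_rep K A)))
      \<longleftrightarrow> right_monoidal K A) \<and>
     (right_monoidal K A \<longrightarrow>
      (\<forall>V :: ('k, 'v, 'a) rep. representation K A V \<longrightarrow>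
        right_unit_map K A V \<in> rep_hom K A V (rep_prod K A V (counit_rep K A)))) \<and>
     (monoidal K A \<longrightarrow>
      (\<forall>V :: ('k, 'v, 'a) rep. representation K A V \<longrightarrow>
        bij_betw (left_unit_map K A V)
          (carrier V) (carrier (rep_prod K A (counit_rep K A) V)) \<and>
        bij_betw (right_unit_map K A V)
          (carrier V) (carrier (rep_prod K A V (counit_rep K A)))) \<and>
      (\<forall>(V :: ('k, 'v, 'a) rep) (W :: ('k, 'w, 'a) rep).
        representation K A V \<longrightarrow> representation K A W \<longrightarrow>
        (\<forall>t\<in>carrier (rep_prod K A V W).
          flat_left K V (counit_rep K A) W
            (rep_prod_map K A V W (rep_prod K A V (counit_rep K A)) W
              (right_unit_map K A V) id t) =
          flat_right K V (counit_rep K A) W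
            (rep_prod_map K A V W V (rep_prod K A (counit_rep K A) W)
              id (left_unit_map K A W) t)) \<and>
        (\<forall>t\<in>carrier (rep_prod K A V W).
          flat_left K (counit_rep K A) V W
            (rep_prod_map K A V W (rep_prod K A (counit_rep K A) V) W
              (left_unit_map K A V) id t) =
          flat_right K (counit_rep K A) V W
            (left_unit_map K A (rep_prod K A V W) t)) \<and>
        (\<forall>t\<in>carrier (rep_prod K A W V).
          flat_right K W V (counit_rep K A)
            (rep_prod_map K A W V W (rep_prod K A V (counit_rep K A))
              id (right_unit_map K A V) t) =
          flat_left K W V (counit_rep K A)
            (right_unit_map K A (rep_prod K A W V) t))) \<and>
      (\<forall>e\<in>carrier (counit_rep K A).
        right_unit_map K A (counit_rep K A) e = left_unit_map K A (counit_rep K A) e))"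
proof -
  interpret weak_bialgebra K A by fact
  note M = representation_alg_module
  show ?thesis
    unfolding monoidal_def
    by (intro conjI impI allI ballI iffI; (elim conjE)?)
      (simp_all add: left_monoidal_if_rep_hom right_monoidal_if_rep_hom
        left_unit_map_rep_hom[OF M] right_unit_map_rep_hom[OF M] bij_betw_def
        left_unit_map_inj[OF M] right_unit_map_inj[OF M] left_unit_map_surj[OF M] right_unit_map_surj[OF M]
        right_unit_map_times_id[OF M M] left_unit_map_times_id[OF M M] id_times_right_unit_map[OF M M]
        right_unit_map_counit_rep)
qed

end
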